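(* Let $a,b\in\mathbb R\setminus\{0\}$ and set $$\mu_\omega^0:=\begin{cases}\frac{\gamma_\omega}{b} & \text{if }\omega\in\{\mathrm{os},\mathrm{oa},\mathrm{ea}\},\\ \frac{a+4b}{ab}\,\gamma_{\mathrm{es}} & \text{if }\omega=\mathrm{es}\text{ and }\frac{a+4b}{ab}>0,\\ 0 & \text{if }\omega=\mathrm{es}\text{ and }\frac{a+4b}{ab}\le 0.\end{cases}$$ (a) Let $\omega\in\{\mathrm{os},\mathrm{oa},\mathrm{ea}\}$. (a.i) If either $b<0$ and $\mu>0$, or $b>0$ and $\mu\in(0,\mu_\omega^0]$, then $H_{a,b}(\mu)|_{L^{2,\omega}(\mathbb T^2)}$ has no eigenvalues above the essential spectrum. (a.ii) If $b>0$, then for every $\mu>\mu_\omega^0$ the operator $H_{a,b}(\mu)|_{L^{2,\omega}(\mathbb T^2)}$ has a unique eigenvalue $E_\omega(\mu)>\mathfrak e_{\max}$, and the associated eigenfunction is $$\Psi_\mu^{\omega}(p)=\begin{cases}\frac{\sin p_1+\sin p_2}{E_\omega(\mu)-\mathfrak e(p)} & \text{if }\omega=\mathrm{os},\\ \frac{\sin p_1-\sin p_2}{E_\omega(\mu)-\mathfrak e(p)} & \text{if }\omega=\mathrm{oa},\\ \frac{\cos p_1-\cos p_2}{E_\omega(\mu)-\mathfrak e(p)} & \text{if }\omega=\mathrm{ea}.\end{cases}$$ Moreover, $E_\omega(\cdot)$ is real-analytic, strictly increasing and strictly convex in $(\mu_\omega^0,+\infty)$. (b) Let $\omega=\mathrm{es}$.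 (b.i) If either $a,b<0$ and $\mu>0$, or $ab<0$ and $\mu\in(0,\mu_{\mathrm{es}}^0]$, then $H_{a,b}(\mu)|_{L^{2,\mathrm{es}}(\mathbb T^2)}$ has no eigenvalues above the essential spectrum. (b.ii) If $ab<0$, then for every $\mu>\mu_{\mathrm{es}}^0$ the operator $H_{a,b}(\mu)|_{L^{2,\mathrm{es}}(\mathbb T^2)}$ has a unique eigenvalue $E_{\mathrm{es}}(\mu)>\mathfrak e_{\max}$, and the associated eigenfunction is $$\Psi_\mu^{\mathrm{es}}(p)=\frac{C_\mu^1+C_\mu^2(\cos p_1+\cos p_2)}{E_{\mathrm{es}}(\mu)-\mathfrak e(p)}$$ for some real constants $C_\mu^1,C_\mu^2$. Moreover, $E_{\mathrm{es}}(\cdot)$ is real-analytic, strictly increasing and convex in $(\mu_{\mathrm{es}}^0,+\infty)$. (b.iii) If $a,b>0$, then for every $\mu\in(0,\mu_{\mathrm{es}}^0]$ the operator $H_{a,b}(\mu)|_{L^{2,\mathrm{es}}(\mathbb T^2)}$ has a unique eigenvalue $E_{\mathrm{es}}^{(1)}(\mu)>\mathfrak e_{\max}$, and for every $\mu>\mu_{\mathrm{es}}^0$ it has two eigenvalues (counted with multiplicity) $E_{\mathrm{es}}^{(1)}(\mu),E_{\mathrm{es}}^{(2)}(\mu)>\mathfrak e_{\max}$; the associated eigenfunctions are $$\Psi_\mu^{\mathrm{es},i}(p)=\frac{C_\mu^{1,i}+C_\mu^{2,i}(\cos p_1+\cos p_2)}{E_{\mathrm{es}}^{(i)}(\mu)-\mathfrak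 e(p)},\quad i=1,2,$$ for some real constants $C_\mu^{1,i},C_\mu^{2,i}$. Moreover (with a suitable labelling of the two eigenvalues for $\mu>\mu_{\mathrm{es}}^0$), $E_{\mathrm{es}}^{(1)}(\cdot)$ and $E_{\mathrm{es}}^{(2)}(\cdot)$ are real-analytic and strictly increasing in $(0,+\infty)$ and $(\mu_{\mathrm{es}}^0,+\infty)$, respectively.
   Context: $\mathbb T^2=(-\pi,\pi]^2$ is the two-dimensional torus (dual group of $\mathbb Z^2$) and $\vec\pi=(\pi,\pi)$. Let $\hat{\mathfrak e}\in\ell^1(\mathbb Z^2)$ satisfy $\hat{\mathfrak e}(x)=\overline{\hat{\mathfrak e}(-x)}$ and let $\mathfrak e(p)=\sum_{x\in\mathbb Z^2}\hat{\mathfrak e}(x)e^{\mathrm i(p,x)}$. Standing assumption: $\mathfrak e$ is real-valued, even ($\mathfrak e(-p)=\mathfrak e(p)$), symmetric ($\mathfrak e(p_1,p_2)=\mathfrak e(p_2,p_1)$), has a unique maximum on $\mathbb T^2$, attained at $\vec\pi$ and non-degenerate (negative definite Hessian), and is real-analytic near $\vec\pi$. Put $\mathfrak e_{\min}=\min\mathfrak e$, $\mathfrak e_{\max}=\max\mathfrak e$. For $a,b\in\mathbb R\setminus\{0\}$, $\mu>0$, the bounded self-adjoint operator $H_{a,b}(\mu)$ in $L^2(\mathbb T^2)$ is $$H_{a,b}(\mu)f(p)=\mathfrak e(p)f(p)+\frac{\mu}{4\pi^2}\int_{\mathbb T^2}\Big(a+2b\sum_{i=1}^2\cos(p_i-q_i)\Big)f(q)\,dq.$$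 Its essential spectrum is $[\mathfrak e_{\min},\mathfrak e_{\max}]$; "above the essential spectrum" means in $(\mathfrak e_{\max},+\infty)$. The invariant subspaces $L^{2,\omega}(\mathbb T^2)$, $\omega\in\{\mathrm{os},\mathrm{oa},\mathrm{ea},\mathrm{es}\}$, consist of those $f\in L^2(\mathbb T^2)$ that are (a.e.) odd and symmetric (os), odd and antisymmetric (oa), even and antisymmetric (ea), even and symmetric (es), where odd/even refers to $p\mapsto-p$ and symmetric/antisymmetric means $f(p_1,p_2)=\pm f(p_2,p_1)$. The (finite, positive) numbers $\gamma_\omega$ are $$\gamma_{\mathrm{os}}=\Big(\tfrac1{4\pi^2}\int_{\mathbb T^2}\tfrac{(\sin q_1+\sin q_2)^2dq}{\mathfrak e_{\max}-\mathfrak e(q)}\Big)^{-1},\quad \gamma_{\mathrm{oa}}=\Big(\tfrac1{4\pi^2}\int_{\mathbb T^2}\tfrac{(\sin q_1-\sin q_2)^2dq}{\mathfrak e_{\max}-\mathfrak e(q)}\Big)^{-1},$$ $$\gamma_{\mathrm{ea}}=\Big(\tfrac1{4\pi^2}\int_{\mathbb T^2}\tfrac{(\cos q_1-\cos q_2)^2dq}{\mathfrak e_{\max}-\mathfrak e(q)}\Big)^{-1},\quad \gamma_{\mathrm{es}}=\Big(\tfrac1{4\pi^2}\int_{\mathbb T^2}\tfrac{(\cos q_1+\cos q_2+2)^2dq}{\mathfrak e_{\max}-\mathfrak e(q)}\Big)^{-1}.$$ *)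

theory Defs
  imports "HOL-Analysis.Analysis"
begin

section \<open>The torus and its $L^2$ sectors\<close>

definition torus :: "(real \<times> real) set" where
  "torus = {-pi<..pi} \<times> {-pi<..pi}"

definition torus_measure :: "(real \<times> real) measure" where
  "torus_measure = restrict_space lborel torus"

text \<open>Elements of $L^2$ are represented by functions; two representatives denote the same
  element iff they agree almost everywhere with respect to \<^const>\<open>torus_measure\<close>. All notions
  below are phrased modulo this equality.\<close>

definition L2_torus :: "(real \<times> real \<Rightarrow> complex) set" where
  "L2_torus = {f \<in> borel_measurable torus_measure.
     integrable torus_measure (\<lambda>p. (cmod (f p))\<^sup>2)}"

datatype sector = OS | OA | EA | ES

definition ae_odd :: "(real \<times> real \<Rightarrow> complex) \<Rightarrow> bool" where
  "ae_odd f \<longleftrightarrow> (AE p in torus_measure. f (- p) = - f p)"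

definition ae_even :: "(real \<times> real \<Rightarrow> complex) \<Rightarrow> bool" where
  "ae_even f \<longleftrightarrow> (AE p in torus_measure. f (- p) = f p)"

definition ae_symmetric :: "(real \<times> real \<Rightarrow> complex) \<Rightarrow> bool" where
  "ae_symmetric f \<longleftrightarrow> (AE p in torus_measure. f (fst p, snd p) = f (snd p, fst p))"

definition ae_antisymmetric :: "(real \<times> real \<Rightarrow> complex) \<Rightarrow> bool" where
  "ae_antisymmetric f \<longleftrightarrow> (AE p in torus_measure. f (fst p, snd p) = - f (snd p, fst p))"

fun L2_sector :: "sector \<Rightarrow> (real \<times> real \<Rightarrow> complex) set" where
  "L2_sector OS = {f \<in> L2_torus. ae_odd f \<and> ae_symmetric f}"
| "L2_sector OA = {f \<in> L2_torus. ae_odd f \<and> ae_antisymmetric f}"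
| "L2_sector EA = {f \<in> L2_torus. ae_even f \<and> ae_antisymmetric f}"
| "L2_sector ES = {f \<in> L2_torus. ae_even f \<and> ae_symmetric f}"


section \<open>The dispersion relation\<close>

definition fourier_sum :: "(int \<times> int \<Rightarrow> complex) \<Rightarrow> real \<times> real \<Rightarrow> complex" where
  "fourier_sum ehat p = (\<Sum>\<^sub>\<infinity>x\<in>UNIV. ehat x *
     exp (\<i> * complex_of_real (fst p * of_int (fst x) + snd p * of_int (snd x))))"

definition real_analytic2_at :: "(real \<times> real \<Rightarrow> real) \<Rightarrow> real \<times> real \<Rightarrow> bool" where
  "real_analytic2_at f z \<longleftrightarrow> (\<exists>r>0. \<exists>c :: nat \<times> nat \<Rightarrow> real. \<forall>h k. \<bar>h\<bar> < r \<and> \<bar>k\<bar> < r \<longrightarrow>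
     ((\<lambda>(m, n). c (m, n) * h ^ m * k ^ n) has_sum f (z + (h, k))) UNIV)"

text \<open>Here \<open>g\<close> is the gradient of \<open>f\<close> near \<open>z\<close>, and \<open>A\<close> is the Hessian of \<open>f\<close> at \<open>z\<close> viewed
  as a linear map.\<close>

definition negative_definite_hessian_at :: "(real \<times> real \<Rightarrow> real) \<Rightarrow> real \<times> real \<Rightarrow> bool" where
  "negative_definite_hessian_at f z \<longleftrightarrow>
     (\<exists>g A. (\<forall>\<^sub>F p in nhds z. (f has_derivative (\<lambda>h. g p \<bullet> h)) (at p)) \<and>
            (g has_derivative A) (at z) \<and> (\<forall>h. h \<noteq> 0 \<longrightarrow> A h \<bullet> h < 0))"

definition e_max :: "(real \<times> real \<Rightarrow> real) \<Rightarrow> real" where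
  "e_max e = Sup (e ` torus)"


section \<open>The operator and its eigenvalues in a sector\<close>

definition H_op :: "(real \<times> real \<Rightarrow> real) \<Rightarrow> real \<Rightarrow> real \<Rightarrow> real \<Rightarrow>
    (real \<times> real \<Rightarrow> complex) \<Rightarrow> real \<times> real \<Rightarrow> complex" where
  "H_op e a b \<mu> f p = complex_of_real (e p) * f p +
     complex_of_real (\<mu> / (4 * pi\<^sup>2)) *
       (LINT q|torus_measure.
          complex_of_real (a + 2 * b * (cos (fst p - fst q) + cos (snd p - snd q))) * f q)"

definition eigenspace :: "(real \<times> real \<Rightarrow> real) \<Rightarrow> real \<Rightarrow> real \<Rightarrow> real \<Rightarrow> sector \<Rightarrow> real \<Rightarrow>
    (real \<times> real \<Rightarrow> complex) set" where
  "eigenspace e a b \<mu> \<omega> E =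
     {f \<in> L2_sector \<omega>. AE p in torus_measure. H_op e a b \<mu> f p = complex_of_real E * f p}"

definition eigenfunction :: "(real \<times> real \<Rightarrow> real) \<Rightarrow> real \<Rightarrow> real \<Rightarrow> real \<Rightarrow> sector \<Rightarrow> real \<Rightarrow>
    (real \<times> real \<Rightarrow> complex) \<Rightarrow> bool" where
  "eigenfunction e a b \<mu> \<omega> E f \<longleftrightarrow>
     f \<in> eigenspace e a b \<mu> \<omega> E \<and> \<not> (AE p in torus_measure. f p = 0)"

definition eigenvalues_above :: "(real \<times> real \<Rightarrow> real) \<Rightarrow> real \<Rightarrow> real \<Rightarrow> real \<Rightarrow> sector \<Rightarrow>
    real set" where
  "eigenvalues_above e a b \<mu> \<omega> = {E. e_max e < E \<and> (\<exists>f. eigenfunction e a b \<mu> \<omega> E f)}"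

definition ae_lin_indep :: "(real \<times> real \<Rightarrow> complex) list \<Rightarrow> bool" where
  "ae_lin_indep fs \<longleftrightarrow> (\<forall>c :: nat \<Rightarrow> complex.
     (AE p in torus_measure. (\<Sum>i<length fs. c i * (fs ! i) p) = 0) \<longrightarrow> (\<forall>i<length fs. c i = 0))"

definition ae_spans :: "(real \<times> real \<Rightarrow> complex) list \<Rightarrow> (real \<times> real \<Rightarrow> complex) set \<Rightarrow> bool" where
  "ae_spans fs V \<longleftrightarrow> (\<forall>f\<in>V. \<exists>c :: nat \<Rightarrow> complex.
     AE p in torus_measure. f p = (\<Sum>i<length fs. c i * (fs ! i) p))"

text \<open>The eigenspace of \<open>E\<close>, modulo almost everywhere equality, has complex dimension \<open>n\<close>.\<close>

definition has_multiplicity :: "(real \<times> real \<Rightarrow> real) \<Rightarrow> real \<Rightarrow> real \<Rightarrow> real \<Rightarrow> sector \<Rightarrow> real \<Rightarrow>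
    nat \<Rightarrow> bool" where
  "has_multiplicity e a b \<mu> \<omega> E n \<longleftrightarrow> (\<exists>fs. length fs = n \<and>
     set fs \<subseteq> eigenspace e a b \<mu> \<omega> E \<and> ae_lin_indep fs \<and> ae_spans fs (eigenspace e a b \<mu> \<omega> E))"


section \<open>Thresholds and explicit eigenfunctions\<close>

fun weight :: "sector \<Rightarrow> real \<times> real \<Rightarrow> real" where
  "weight OS p = sin (fst p) + sin (snd p)"
| "weight OA p = sin (fst p) - sin (snd p)"
| "weight EA p = cos (fst p) - cos (snd p)"
| "weight ES p = cos (fst p) + cos (snd p) + 2"

definition gamma :: "(real \<times> real \<Rightarrow> real) \<Rightarrow> sector \<Rightarrow> real" where
  "gamma e \<omega> = inverse (1 / (4 * pi\<^sup>2) *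
     (LINT q|torus_measure. (weight \<omega> q)\<^sup>2 / (e_max e - e q)))"

definition mu0 :: "(real \<times> real \<Rightarrow> real) \<Rightarrow> real \<Rightarrow> real \<Rightarrow> sector \<Rightarrow> real" where
  "mu0 e a b \<omega> =
     (if \<omega> \<noteq> ES then gamma e \<omega> / b
      else if (a + 4 * b) / (a * b) > 0 then (a + 4 * b) / (a * b) * gamma e ES
      else 0)"

text \<open>\<open>Psi\<close> is meant for the sectors \<^const>\<open>OS\<close>, \<^const>\<open>OA\<close> and \<^const>\<open>EA\<close>; the functions for
  \<^const>\<open>ES\<close> are \<open>Psi_es\<close>.\<close>

definition Psi :: "(real \<times> real \<Rightarrow> real) \<Rightarrow> sector \<Rightarrow> real \<Rightarrow> real \<times> real \<Rightarrow> complex" where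
  "Psi e \<omega> E p = complex_of_real (weight \<omega> p / (E - e p))"

definition Psi_es :: "(real \<times> real \<Rightarrow> real) \<Rightarrow> real \<Rightarrow> real \<Rightarrow> real \<Rightarrow> real \<times> real \<Rightarrow> complex" where
  "Psi_es e C1 C2 E p = complex_of_real ((C1 + C2 * (cos (fst p) + cos (snd p))) / (E - e p))"


section \<open>Regularity of eigenvalue curves\<close>

definition real_analytic_on :: "(real \<Rightarrow> real) \<Rightarrow> real set \<Rightarrow> bool" where
  "real_analytic_on f S \<longleftrightarrow> (\<forall>x\<in>S. \<exists>r>0. \<exists>c :: nat \<Rightarrow> real.
     \<forall>y. \<bar>y - x\<bar> < r \<longrightarrow> (\<lambda>n. c n * (y - x) ^ n) sums f y)"

definition strictly_convex_on :: "real set \<Rightarrow> (real \<Rightarrow> real) \<Rightarrow> bool" where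
  "strictly_convex_on S f \<longleftrightarrow> convex S \<and>
     (\<forall>x\<in>S. \<forall>y\<in>S. \<forall>u>0. \<forall>v>0. x \<noteq> y \<and> u + v = 1 \<longrightarrow>
        f (u * x + v * y) < u * f x + v * f y)"

end

theory Submission
  imports Defs "HOL-Complex_Analysis.Complex_Analysis"
begin

text \<open>
  The interaction has finite rank, so above the essential spectrum the eigenvalue problem reduces to
  finitely many scalar equations. In the sectors \<open>OS\<close>, \<open>OA\<close> and \<open>EA\<close> only one function \<open>w\<close>, the weight
  of the sector, survives in the kernel, and \<open>E\<close> is an eigenvalue iff \<open>\<mu> b F(E) = 1\<close>, where \<open>F(E)\<close> is
  the average of \<open>w\<^sup>2 / (E - e)\<close> (\<open>eigenvalues_rank_one\<close>). In the sector \<open>ES\<close> the functions \<open>1\<close> and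
  \<open>cos_sum\<close> survive, and \<open>E\<close> is an eigenvalue iff \<open>1 / \<mu>\<close> is an eigenvalue of \<open>D L(E)\<close>, where
  \<open>D = diag a b\<close> and \<open>L(E)\<close> is the Gram matrix of these two functions with respect to the density
  \<open>1 / (E - e)\<close> (\<open>eigenvalues_ES\<close>). In both cases the curves are inverses \<open>E = M^(-1)\<close> of functions \<open>M\<close>
  that map an energy to the coupling at which it becomes an eigenvalue.

  The critical couplings are the limits of \<open>M(E)\<close> as \<open>E\<close> tends to \<open>m\<close>, the maximal value of \<open>e\<close>. Near
  the point where it is attained, \<open>m - e\<close> is comparable to the squared distance to that point
  (\<open>quadratic_maximum\<close>). Hence averages of functions vanishing there quadratically stay finite, while the average \<open>L\<^sub>0\<close>
  of \<open>1 / (E - e)\<close> diverges because the dimension is two (\<open>not_integrable_inverse_gap\<close>). In the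
  characteristic polynomial of \<open>D L(E)\<close> the divergent \<open>L\<^sub>0\<close> can be isolated, and the sign of its
  coefficient changes exactly at the critical coupling (\<open>charpoly_threshold\<close>, \<open>charpoly_sign_vs_mu0\<close>).

  Convexity is variational. In the rank-one sectors, and in the sector \<open>ES\<close> for \<open>a b < 0\<close>, \<open>M(E)\<close> is
  the minimum over normalised trial functions \<open>h\<close> of the average of \<open>h\<^sup>2 (E - e)\<close>, an affine increasing
  function of \<open>E\<close>. So \<open>M\<close> is increasing and concave, with the optimal \<open>h\<close> providing a supergradient
  (\<open>trial_inequality\<close>, \<open>rank_one_supergradient\<close>, \<open>pos_root_supergradient\<close>), and its inverse is
  increasing and convex. Since a supergradient of a differentiable function is its derivative, \<open>M\<close> has
  positive derivative, and analyticity of the inverse follows from the inverse function theorem.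

  For \<open>a, b > 0\<close> the two eigenvalues of \<open>D L(E)\<close> may cross, and their difference must be chosen as an
  analytic square root of the discriminant, a sum of two squares. It is found by changing the sign
  of the modulus of a holomorphic function at its real zeros of odd order (\<open>analytic_signed_norm\<close>).
  Both branches remain strictly decreasing through the crossings because \<open>- L'(E)\<close> is positive
  definite, and a crossing is precisely an eigenvalue of multiplicity two.
\<close>

section \<open>Real-analytic functions of one variable\<close>

text \<open>Analyticity at a point is encoded by a holomorphic extension instead of a real power series:
  sums, quotients, square roots and inverse functions of analytic functions then come from the
  corresponding facts about holomorphic functions.\<close>

definition real_analytic_at :: "(real \<Rightarrow> real) \<Rightarrow> real \<Rightarrow> bool" where
  "real_analytic_at f x \<longleftrightarrow> (\<exists>F. F analytic_on {of_real x} \<and>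
     (\<forall>\<^sub>F y in nhds x. F (of_real y) = complex_of_real (f y)))"

text \<open>The Taylor coefficients of the extension need not be known to be real: taking real parts of the
  complex Taylor series gives a real one with the same sum, because the sum is real.\<close>

lemma real_analytic_on_if_real_analytic_at:
  assumes "\<And>x. x \<in> S \<Longrightarrow> real_analytic_at f x"
  shows "real_analytic_on f S"
  unfolding real_analytic_on_def
proof
  fix x assume "x \<in> S"
  then obtain F where F: "F analytic_on {of_real x}"
    and ev: "\<forall>\<^sub>F y in nhds x. F (of_real y) = complex_of_real (f y)"
    using assms unfolding real_analytic_at_def by blast
  obtain r1 where r1: "r1 > 0" "F holomorphic_on ball (of_real x) r1"
    using F analytic_at_ball by blast
  obtain r2 where r2: "r2 > 0" "\<And>y. dist y x < r2 \<Longrightarrow> F (of_real y) = complex_of_real (f y)"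
    using ev unfolding eventually_nhds_metric by blast
  define c where "c = (\<lambda>n. Re ((deriv ^^ n) F (of_real x) / fact n))"
  show "\<exists>r>0. \<exists>c. \<forall>y. \<bar>y - x\<bar> < r \<longrightarrow> (\<lambda>n. c n * (y - x) ^ n) sums f y"
  proof (intro exI[of _ "min r1 r2"] conjI exI[of _ c] allI impI)
    fix y assume y: "\<bar>y - x\<bar> < min r1 r2"
    have "complex_of_real y \<in> ball (of_real x) r1"
      using y by (auto simp: dist_real_def abs_minus_commute)
    from holomorphic_power_series[OF r1(2) this]
    have "(\<lambda>n. (deriv ^^ n) F (of_real x) / fact n * (of_real y - of_real x) ^ n) sums F (of_real y)" .
    from sums_Re[OF this]
    have *: "(\<lambda>n. Re ((deriv ^^ n) F (of_real x) / fact n * of_real ((y - x) ^ n))) sums Re (F (of_real y))"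
      by simp
    have "Re (w * of_real t) = Re w * t" for w t by simp
    note * [unfolded this]
    then have "(\<lambda>n. c n * (y - x) ^ n) sums Re (F (of_real y))"
      unfolding c_def .
    moreover have "F (of_real y) = of_real (f y)" using y by (intro r2) (auto simp: dist_real_def)
    ultimately show "(\<lambda>n. c n * (y - x) ^ n) sums f y"
      by simp
  qed (use r1 r2 in auto)
qed

lemma real_analytic_at_cong:
  assumes "real_analytic_at f x" "\<forall>\<^sub>F y in nhds x. f y = g y"
  shows "real_analytic_at g x"
proof -
  obtain F where "F analytic_on {of_real x}" "\<forall>\<^sub>F y in nhds x. F (of_real y) = complex_of_real (f y)"
    using assms(1) unfolding real_analytic_at_def by blast
  then show ?thesis
    using assms(2) unfolding real_analytic_at_def
    by (intro exI[of _ F]) (auto elim: eventually_elim2)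
qed

lemma real_analytic_at_const: "real_analytic_at (\<lambda>_. c) x"
  unfolding real_analytic_at_def by (intro exI[of _ "\<lambda>_. of_real c"]) auto

lemma real_analytic_at_ident: "real_analytic_at (\<lambda>y. y) x"
  unfolding real_analytic_at_def by (intro exI[of _ "\<lambda>z. z"]) auto

lemma real_analytic_at_add:
  assumes "real_analytic_at f x" "real_analytic_at g x"
  shows "real_analytic_at (\<lambda>y. f y + g y) x"
proof -
  obtain F G where "F analytic_on {of_real x}" "\<forall>\<^sub>F y in nhds x. F (of_real y) = complex_of_real (f y)"
    "G analytic_on {of_real x}" "\<forall>\<^sub>F y in nhds x. G (of_real y) = complex_of_real (g y)"
    using assms unfolding real_analytic_at_def by blast
  then show ?thesis unfolding real_analytic_at_def
    by (intro exI[of _ "\<lambda>z. F z + G z"]) (auto intro!: analytic_intros elim: eventually_elim2)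
qed

lemma real_analytic_at_mult:
  assumes "real_analytic_at f x" "real_analytic_at g x"
  shows "real_analytic_at (\<lambda>y. f y * g y) x"
proof -
  obtain F G where "F analytic_on {of_real x}" "\<forall>\<^sub>F y in nhds x. F (of_real y) = complex_of_real (f y)"
    "G analytic_on {of_real x}" "\<forall>\<^sub>F y in nhds x. G (of_real y) = complex_of_real (g y)"
    using assms unfolding real_analytic_at_def by blast
  then show ?thesis unfolding real_analytic_at_def
    by (intro exI[of _ "\<lambda>z. F z * G z"]) (auto intro!: analytic_intros elim: eventually_elim2)
qed

lemma real_analytic_at_compose:
  assumes f: "real_analytic_at f x" and G: "G analytic_on {of_real (f x)}"
    and ev: "\<forall>\<^sub>F y in nhds x. G (of_real (f y)) = complex_of_real (g y)"
  shows "real_analytic_at g x"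
proof -
  obtain F where F: "F analytic_on {of_real x}" "\<forall>\<^sub>F y in nhds x. F (of_real y) = complex_of_real (f y)"
    using f unfolding real_analytic_at_def by blast
  have Fx: "F (of_real x) = of_real (f x)" using eventually_nhds_x_imp_x[OF F(2)] .
  have "(G \<circ> F) analytic_on {of_real x}"
    using F G by (intro analytic_on_compose) (auto simp: Fx)
  then show ?thesis unfolding real_analytic_at_def
    using F(2) ev by (intro exI[of _ "G \<circ> F"]) (auto elim: eventually_elim2)
qed

lemma real_analytic_at_inverse:
  assumes "real_analytic_at f x" "f x \<noteq> 0"
  shows "real_analytic_at (\<lambda>y. inverse (f y)) x"
  by (rule real_analytic_at_compose[OF assms(1), of inverse])
     (use assms(2) in \<open>auto intro!: analytic_intros\<close>)

lemma real_analytic_at_diff: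
  assumes "real_analytic_at f x" "real_analytic_at g x"
  shows "real_analytic_at (\<lambda>y. f y - g y) x"
  using real_analytic_at_add[OF assms(1) real_analytic_at_mult[OF real_analytic_at_const[of "-1"] assms(2)]]
  by simp

lemma real_analytic_at_divide:
  assumes "real_analytic_at f x" "real_analytic_at g x" "g x \<noteq> 0"
  shows "real_analytic_at (\<lambda>y. f y / g y) x"
  using real_analytic_at_mult[OF assms(1) real_analytic_at_inverse[OF assms(2,3)]]
  by (simp add: divide_inverse)

lemma real_analytic_at_power:
  assumes "real_analytic_at f x"
  shows "real_analytic_at (\<lambda>y. f y ^ n) x"
  by (induction n) (auto intro: real_analytic_at_const real_analytic_at_mult assms)

lemma real_analytic_at_isCont:
  assumes "real_analytic_at f x"
  shows "isCont f x"
proof -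
  obtain F where F: "F analytic_on {of_real x}" "\<forall>\<^sub>F y in nhds x. F (of_real y) = complex_of_real (f y)"
    using assms unfolding real_analytic_at_def by blast
  have "isCont F (of_real x)" using F(1) analytic_at_imp_isCont by blast
  moreover have "isCont complex_of_real x" by (simp add: isCont_def tendsto_of_real)
  ultimately have "isCont (\<lambda>y. F (of_real y)) x" by (metis isCont_o2)
  then have "isCont (\<lambda>y. Re (F (of_real y))) x" by (rule continuous_Re)
  moreover have "\<forall>\<^sub>F y in nhds x. Re (F (of_real y)) = f y"
    using F(2) by eventually_elim simp
  ultimately show ?thesis using isCont_cong by metis
qed

lemma real_analytic_at_sqrt:
  assumes "real_analytic_at f x" "f x > 0"
  shows "real_analytic_at (\<lambda>y. sqrt (f y)) x"
proof (rule real_analytic_at_compose[OF assms(1), of csqrt])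
  show "csqrt analytic_on {of_real (f x)}"
    using assms(2) by (intro analytic_on_csqrt' analytic_on_ident) (auto simp: complex_nonpos_Reals_iff)
  have "\<forall>\<^sub>F y in at x. f y > 0"
    using order_tendstoD(1)[OF real_analytic_at_isCont[OF assms(1), unfolded isCont_def]] assms(2) .
  then have "\<forall>\<^sub>F y in nhds x. f y > 0" using assms(2) by (simp add: eventually_nhds_conv_at)
  then show "\<forall>\<^sub>F y in nhds x. csqrt (of_real (f y)) = of_real (sqrt (f y))"
    by eventually_elim (simp add: csqrt_of_real_nonneg)
qed

text \<open>The complex derivative of the extension at the point is the real derivative \<open>d\<close>, hence nonzero, so
  the extension is locally injective and has a holomorphic inverse. Continuity of the real inverse
  \<open>g\<close> keeps its values in the domain of injectivity, which forces \<open>g\<close> to be the restriction of that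
  holomorphic inverse.\<close>

lemma real_analytic_at_inverse_function:
  assumes f: "real_analytic_at f x"
    and d: "(f has_real_derivative d) (at x)" "d \<noteq> 0"
    and g: "isCont g (f x)" "g (f x) = x" "\<forall>\<^sub>F y in nhds (f x). f (g y) = y"
  shows "real_analytic_at g (f x)"
proof -
  obtain F where F: "F analytic_on {of_real x}" "\<forall>\<^sub>F y in nhds x. F (of_real y) = complex_of_real (f y)"
    using f unfolding real_analytic_at_def by blast
  have Fx: "F (of_real x) = of_real (f x)" using eventually_nhds_x_imp_x[OF F(2)] .
  obtain r where r: "r > 0" "F holomorphic_on ball (of_real x) r"
    using F(1) analytic_at_ball by blast
  have "(F has_field_derivative deriv F (of_real x)) (at (of_real x))"
    using r by (intro holomorphic_derivI[of _ "ball (of_real x) r"]) auto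
  then have "((\<lambda>y. F (of_real y)) has_vector_derivative deriv F (of_real x)) (at x)"
    by (intro has_vector_derivative_real_field)
  moreover have "((\<lambda>y. complex_of_real (f y)) has_vector_derivative of_real d) (at x)"
    using d(1) by (intro has_vector_derivative_of_real) (simp add: has_real_derivative_iff_has_vector_derivative)
  from this have "((\<lambda>y. F (of_real y)) has_vector_derivative of_real d) (at x)"
  proof -
    assume *: "((\<lambda>y. complex_of_real (f y)) has_vector_derivative of_real d) (at x)"
    obtain T where "open T" "x \<in> T" "\<And>y. y \<in> T \<Longrightarrow> F (of_real y) = complex_of_real (f y)"
      using F(2) unfolding eventually_nhds by blast
    then show ?thesis
      using has_vector_derivative_transform_within_open[OF *, of T "\<lambda>y. F (of_real y)"] by auto
  qed
  ultimately have "deriv F (of_real x) = of_real d"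
    using vector_derivative_unique_at by blast
  then have dnz: "deriv F (of_real x) \<noteq> 0" using d(2) by simp
  obtain s where s: "s > 0" "ball (complex_of_real x) s \<subseteq> ball (of_real x) r" "inj_on F (ball (of_real x) s)"
    by (rule has_complex_derivative_locally_injective[OF r(2) _ _ dnz]) (use r(1) in \<open>simp_all\<close>)
  have hs: "F holomorphic_on ball (of_real x) s" using r(2) s(2) holomorphic_on_subset by blast
  obtain G where G: "G holomorphic_on (F ` ball (of_real x) s)" "\<And>z. z \<in> ball (of_real x) s \<Longrightarrow> G (F z) = z"
    using holomorphic_has_inverse[OF hs open_ball s(3)] by metis
  have "open (F ` ball (of_real x) s)" using open_mapping_thm3[OF hs _ s(3)] by simp
  moreover have "of_real (f x) \<in> F ` ball (of_real x) s" using Fx s(1) by (auto intro!: image_eqI[of _ F "of_real x"])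
  ultimately have Gan: "G analytic_on {of_real (f x)}" using G(1) analytic_at by blast
  have gl: "filterlim g (nhds x) (nhds (f x))"
    using g(1,2) tendsto_at_iff_tendsto_nhds[of g "f x"] by (simp add: isCont_def)
  have "\<forall>\<^sub>F y in nhds (f x). F (of_real (g y)) = complex_of_real (f (g y))"
    using F(2) gl by (rule eventually_compose_filterlim)
  moreover have "\<forall>\<^sub>F z in nhds x. dist z x < s" using s(1) by (auto simp: eventually_nhds_metric)
  then have "\<forall>\<^sub>F y in nhds (f x). dist (g y) x < s"
    using gl by (rule eventually_compose_filterlim)
  ultimately have "\<forall>\<^sub>F y in nhds (f x). G (of_real y) = complex_of_real (g y)"
    using g(3)
  proof eventually_elim
    case (elim y)
    have "G (F (of_real (g y))) = of_real (g y)" using elim(2) by (intro G(2)) (simp add: dist_commute)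
    then show ?case using elim by simp
  qed
  then show ?thesis using Gan unfolding real_analytic_at_def by blast
qed

section \<open>An analytic square root of a sum of two squares\<close>

text \<open>On the real axis \<open>\<bar>u\<bar>\<^sup>2\<close> is the restriction of the holomorphic function \<open>u z * cnj (u (cnj z))\<close>, and
  it is positive where \<open>u\<close> does not vanish.\<close>

lemma real_analytic_at_norm:
  assumes u: "u analytic_on {of_real x}" "u (of_real x) \<noteq> 0"
  shows "real_analytic_at (\<lambda>y. norm (u (of_real y))) x"
proof -
  obtain r where r: "r > 0" "u holomorphic_on ball (of_real x) r"
    using u(1) analytic_at_ball by blast
  have d: "dist (of_real x) (cnj z) = dist (of_real x) z" for z
    by (metis complex_cnj_complex_of_real complex_cnj_diff complex_mod_cnj dist_norm)
  have "z \<in> cnj ` ball (of_real x) r" if "z \<in> ball (of_real x) r" for z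
    using that d[of z] by (intro image_eqI[of _ cnj "cnj z"]) auto
  then have "cnj ` ball (of_real x) r = ball (of_real x) r"
    by (auto simp: d)
  then have "(cnj \<circ> u \<circ> cnj) holomorphic_on ball (of_real x) r"
    using r by (intro holomorphic_on_compose_cnj_cnj) auto
  then have "(\<lambda>z. cnj (u (cnj z))) analytic_on {of_real x}"
    using r(1) by (auto simp: analytic_at o_def intro!: exI[of _ "ball (of_real x) r"])
  then have G: "(\<lambda>z. u z * cnj (u (cnj z))) analytic_on {of_real x}"
    using u by (intro analytic_intros)
  have "real_analytic_at (\<lambda>y. (norm (u (of_real y)))^2) x"
    unfolding real_analytic_at_def
    by (intro exI[of _ "\<lambda>z. u z * cnj (u (cnj z))"] conjI G always_eventually)
       (simp add: complex_norm_square del: of_real_power)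
  from real_analytic_at_sqrt[OF this] u(2) show ?thesis by simp
qed

text \<open>Rellich's theorem for \<open>2 \<times> 2\<close> matrices in disguise: for \<open>h = p + \<i> q\<close> with \<open>p\<close>, \<open>q\<close> real on the
  real axis, \<open>r\<close> is an analytic square root of \<open>p\<^sup>2 + q\<^sup>2\<close>. The function \<open>\<bar>h\<bar>\<close> itself has a corner at
  every real zero of odd order, so its sign is flipped at each of them; there are only finitely many
  to the left of any point because none of them is close to \<open>m\<close>.\<close>

lemma analytic_signed_norm:
  fixes h :: "complex \<Rightarrow> complex" and m \<delta> :: real
  assumes hol: "h holomorphic_on {z. Re z > m}" and "\<delta> > 0"
    and nz: "\<And>x. m < x \<Longrightarrow> x \<le> m + \<delta> \<Longrightarrow> h (of_real x) \<noteq> 0"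
  obtains r :: "real \<Rightarrow> real" where
    "\<And>x. m < x \<Longrightarrow> real_analytic_at r x"
    "\<And>x. m < x \<Longrightarrow> \<bar>r x\<bar> = norm (h (of_real x))"
    "\<And>x. m < x \<Longrightarrow> x \<le> m + \<delta> \<Longrightarrow> r x > 0"
proof -
  define S where "S = {z::complex. Re z > m}"
  have S: "open S" "connected S"
    unfolding S_def by (auto simp: open_halfspace_Re_gt intro!: convex_connected convex_halfspace_Re_gt)
  have holS: "h holomorphic_on S" using hol by (simp add: S_def)
  have ne: "\<exists>w\<in>S. h w \<noteq> 0"
    using nz[of "m + \<delta>"] \<open>\<delta> > 0\<close> by (intro bexI[of _ "of_real (m + \<delta>)"]) (auto simp: S_def)
  define k where "k = (\<lambda>x. nat (zorder h (of_real x)))"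
  \<comment> \<open>The points where the sign changes: the real zeros of odd order.\<close>
  define Z where "Z = {x. m < x \<and> h (of_real x) = 0 \<and> odd (k x)}"
  define s :: "real \<Rightarrow> real" where "s = (\<lambda>x. (-1) ^ card (Z \<inter> {..<x}))"
  define r where "r = (\<lambda>x. s x * norm (h (of_real x)))"
  have fin: "finite (Z \<inter> {..<x})" for x
  proof -
    have "finite {z \<in> of_real ` {m + \<delta>..x}. h z = 0}"
    proof (cases "h constant_on S")
      case True
      have sub: "complex_of_real ` {m + \<delta>..x} \<subseteq> S" using \<open>\<delta> > 0\<close> by (auto simp: S_def)
      have "{z \<in> of_real ` {m + \<delta>..x}. h z = 0} = {}"
        using True ne sub unfolding constant_on_def by fastforce
      then show ?thesis by (rule ssubst) simp
    next
      case False
      show ?thesis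
    proof (rule holomorphic_compact_finite_zeros[OF holS S])
      show "compact (complex_of_real ` {m + \<delta>..x})"
        by (intro compact_continuous_image continuous_intros) auto
      show "complex_of_real ` {m + \<delta>..x} \<subseteq> S" using \<open>\<delta> > 0\<close> by (auto simp: S_def)
    qed (use False in auto)
    qed
    moreover have "of_real ` (Z \<inter> {..<x}) \<subseteq> {z \<in> of_real ` {m + \<delta>..x}. h z = 0}"
      using nz by (force simp: Z_def)
    ultimately have "finite (complex_of_real ` (Z \<inter> {..<x}))" by (rule rev_finite_subset)
    then show ?thesis by (rule finite_imageD) (auto simp: inj_on_def)
  qed
  have an: "real_analytic_at r x" if x: "m < x" for x
  proof -
    have xS: "of_real x \<in> S" using x by (simp add: S_def)
    define u where "u = zor_poly h (of_real x)"
    obtain \<rho> where \<rho>: "\<rho> > 0" "cball (of_real x) \<rho> \<subseteq> S" "u holomorphic_on cball (of_real x) \<rho>"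
      and fac: "\<And>w. w \<in> cball (of_real x) \<rho> \<Longrightarrow> h w = u w * (w - of_real x) ^ k x \<and> u w \<noteq> 0"
      and ord: "if h (of_real x) = 0 then zorder h (of_real x) > 0 else zorder h (of_real x) = 0"
      using zorder_exist_zero[OF holS S xS ne] unfolding u_def k_def by metis
    have hzero: "h (of_real y) = 0 \<longleftrightarrow> y = x \<and> k x \<noteq> 0" if "\<bar>y - x\<bar> \<le> \<rho>" for y
    proof -
      have "of_real y \<in> cball (complex_of_real x) \<rho>"
        using that by (simp add: dist_real_def abs_minus_commute)
      from fac[OF this] show ?thesis by auto
    qed
    define N where "N = card (Z \<inter> {..<x})"
    \<comment> \<open>The sign jumps at \<open>x\<close> exactly when \<open>k x\<close> is odd, that is, when \<open>\<bar>y - x\<bar> ^ k x\<close> and \<open>(y - x) ^ k x\<close>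
      differ to the left of \<open>x\<close>; the jump compensates for this difference up to the constant \<open>c\<close>.\<close>
    define c :: real where "c = (if odd (k x) then - ((-1) ^ N) else (-1) ^ N)"
    have key: "s y * \<bar>y - x\<bar> ^ k x = c * (y - x) ^ k x" if y: "\<bar>y - x\<bar> < \<rho>" for y
    proof (cases y x rule: linorder_cases)
      case less
      have "Z \<inter> {..<y} = Z \<inter> {..<x}"
        using less y hzero by (force simp: Z_def abs_if)
      then have "s y = (-1) ^ N" by (simp add: s_def N_def)
      moreover have "\<bar>y - x\<bar> ^ k x = (if odd (k x) then - 1 else 1) * (y - x) ^ k x"
        using less power_minus_odd[of "k x" "y - x"] power_minus_even[of "k x" "y - x"] by simp
      ultimately show ?thesis by (simp add: c_def)
    next
      case equal
      show ?thesis
      proof (cases "k x = 0")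
        case True then show ?thesis by (simp add: equal c_def s_def N_def)
      qed (simp add: equal)
    next
      case greater
      have *: "z \<in> Z \<longleftrightarrow> z = x \<and> odd (k x)" if "x \<le> z" "z < y" for z
      proof -
        have "\<bar>z - x\<bar> \<le> \<rho>" using that y by auto
        from hzero[OF this] show ?thesis using x odd_pos[of "k x"] by (auto simp: Z_def)
      qed
      have "Z \<inter> {..<y} = (Z \<inter> {..<x}) \<union> {z. z = x \<and> odd (k x)}"
        using greater * by (auto simp: not_less)
      then have "card (Z \<inter> {..<y}) = N + (if odd (k x) then 1 else 0)"
        using fin[of x] by (auto simp: N_def)
      then have "s y = c" by (auto simp: s_def c_def)
      then show ?thesis using greater by simp
    qed
    have ra: "real_analytic_at (\<lambda>y. c * (y - x) ^ k x * norm (u (of_real y))) x"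
    proof (intro real_analytic_at_mult real_analytic_at_power real_analytic_at_diff
        real_analytic_at_norm real_analytic_at_const real_analytic_at_ident)
      have "u holomorphic_on ball (of_real x) \<rho>" using \<rho>(3) by (rule holomorphic_on_subset) auto
      then show "u analytic_on {of_real x}"
        using \<rho>(1) by (auto simp: analytic_at intro!: exI[of _ "ball (of_real x) \<rho>"])
      show "u (of_real x) \<noteq> 0" using fac[of "of_real x"] \<rho>(1) by simp
    qed
    show ?thesis
    proof (rule real_analytic_at_cong[OF ra])
      have "\<forall>\<^sub>F y in nhds x. dist y x < \<rho>" using \<rho>(1) by (auto simp: eventually_nhds_metric)
      then show "\<forall>\<^sub>F y in nhds x. c * (y - x) ^ k x * norm (u (of_real y)) = r y"
      proof eventually_elim
        case (elim y)
        then have "of_real y \<in> cball (complex_of_real x) \<rho>" by (simp add: dist_real_def abs_minus_commute)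
        from fac[OF this]
        have "norm (h (of_real y)) = norm (u (of_real y)) * \<bar>y - x\<bar> ^ k x"
          by (simp add: norm_mult norm_power flip: of_real_diff)
        then show ?case using key[of y] elim by (simp add: r_def dist_real_def)
      qed
    qed
  qed
  show ?thesis
  proof (rule that[of r])
    fix x assume x: "m < x" "x \<le> m + \<delta>"
    have "Z \<inter> {..<x} = {}" using x nz by (force simp: Z_def)
    then show "r x > 0" using nz[OF x] by (simp add: r_def s_def)
  qed (auto simp: an, simp add: r_def s_def abs_mult)
qed

section \<open>Inverse branches and convexity\<close>

lemma real_analytic_at_imp_DERIV:
  assumes "real_analytic_at f x"
  obtains d where "(f has_real_derivative d) (at x)"
proof -
  obtain F where F: "F analytic_on {of_real x}" "\<forall>\<^sub>F y in nhds x. F (of_real y) = complex_of_real (f y)"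
    using assms unfolding real_analytic_at_def by blast
  have "(F has_field_derivative deriv F (of_real x)) (at (of_real x))"
    using F(1) analytic_on_imp_differentiable_at DERIV_deriv_iff_field_differentiable by blast
  then have "((\<lambda>y. F (of_real y)) has_vector_derivative deriv F (of_real x)) (at x)"
    by (intro has_vector_derivative_real_field)
  then have "((\<lambda>y. Re (F (of_real y))) has_vector_derivative Re (deriv F (of_real x))) (at x)"
    by (rule bounded_linear.has_vector_derivative[OF bounded_linear_Re])
  then have "((\<lambda>y. Re (F (of_real y))) has_real_derivative Re (deriv F (of_real x))) (at x)"
    by (simp add: has_real_derivative_iff_has_vector_derivative)
  moreover have "\<forall>\<^sub>F y in nhds x. Re (F (of_real y)) = f y"
    using F(2) by eventually_elim simp
  ultimately have "(f has_real_derivative Re (deriv F (of_real x))) (at x)"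
    by (subst (asm) DERIV_cong_ev) auto
  then show ?thesis by (rule that)
qed

text \<open>The difference of \<open>M\<close> and its supporting line has a maximum at \<open>x\<close>. The lemma turns the supergradients
  produced by a variational principle into derivatives that are known to be positive.\<close>

lemma supergradient_eq_derivative:
  fixes M :: "real \<Rightarrow> real"
  assumes d: "(M has_real_derivative d) (at x)" and x: "m < x"
    and c: "\<And>y. m < y \<Longrightarrow> M y \<le> M x + c * (y - x)"
  shows "d = c"
proof -
  have "((\<lambda>y. M y - c * y) has_real_derivative d - c) (at x)"
    using d by (auto intro!: derivative_eq_intros)
  then have "d - c = 0"
    by (rule DERIV_local_max[of _ _ _ "x - m"]) (use x c in \<open>force simp: algebra_simps\<close>)+
  then show ?thesis by simp
qed

text \<open>An eigenvalue curve \<open>E\<close> is obtained as the inverse of the function \<open>M\<close> that assigns to an energy the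
  coupling at which this energy becomes an eigenvalue. The conditions \<open>lower\<close>, \<open>low\<close> and \<open>up\<close> say that
  \<open>M\<close> maps \<open>(m, \<infinity>)\<close> onto \<open>(\<mu>\<^sub>0, \<infinity>)\<close>.\<close>

lemma analytic_inverse_branch:
  fixes M :: "real \<Rightarrow> real" and m \<mu>\<^sub>0 :: real
  assumes an: "\<And>x. m < x \<Longrightarrow> real_analytic_at M x"
    and der: "\<And>x. m < x \<Longrightarrow> \<exists>d>0. (M has_real_derivative d) (at x)"
    and lower: "\<And>x. m < x \<Longrightarrow> \<mu>\<^sub>0 < M x"
    and low: "\<And>\<mu>. \<mu>\<^sub>0 < \<mu> \<Longrightarrow> \<exists>x>m. M x \<le> \<mu>"
    and up: "\<And>\<mu>. \<mu>\<^sub>0 < \<mu> \<Longrightarrow> \<exists>x>m. \<mu> \<le> M x"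
  obtains E where "\<And>\<mu>. \<mu>\<^sub>0 < \<mu> \<Longrightarrow> m < E \<mu>" "\<And>\<mu>. \<mu>\<^sub>0 < \<mu> \<Longrightarrow> M (E \<mu>) = \<mu>"
    "\<And>x. m < x \<Longrightarrow> E (M x) = x"
    "real_analytic_on E {\<mu>\<^sub>0<..}" "strict_mono_on {\<mu>\<^sub>0<..} E"
proof -
  have mono: "M x < M y" if "m < x" "x < y" for x y
  proof (rule DERIV_pos_imp_increasing[OF that(2)])
    fix z assume "x \<le> z" "z \<le> y"
    then have "m < z" using that(1) by linarith
    then show "\<exists>d. (M has_real_derivative d) (at z) \<and> 0 < d" using der by blast
  qed
  have mono_iff: "M x < M y \<longleftrightarrow> x < y" if "m < x" "m < y" for x y
    using mono that by (metis less_asym linorder_neqE_linordered_idom)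
  have cont: "isCont M x" if "m < x" for x using an[OF that] real_analytic_at_isCont by blast
  have ex: "\<exists>x. m < x \<and> M x = \<mu>" if \<mu>: "\<mu>\<^sub>0 < \<mu>" for \<mu>
  proof -
    obtain x y where xy: "m < x" "M x \<le> \<mu>" "m < y" "\<mu> \<le> M y" using low[OF \<mu>] up[OF \<mu>] by blast
    then have "x \<le> y" using mono_iff[of y x] by force
    have "\<exists>z\<ge>x. z \<le> y \<and> M z = \<mu>"
      by (rule IVT) (use xy \<open>x \<le> y\<close> cont in simp_all)
    then obtain z where "x \<le> z" "M z = \<mu>" by blast
    then show ?thesis using xy(1) by (intro exI[of _ z]) simp
  qed
  define E where "E = (\<lambda>\<mu>. SOME x. m < x \<and> M x = \<mu>)"
  have E: "m < E \<mu>" "M (E \<mu>) = \<mu>" if "\<mu>\<^sub>0 < \<mu>" for \<mu>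
    using someI_ex[OF ex[OF that]] by (auto simp: E_def)
  have EM: "E (M x) = x" if "m < x" for x
    using E[OF lower[OF that]] mono_iff[of x "E (M x)"] mono_iff[of "E (M x)" x] that
    by (metis less_irrefl linorder_neqE_linordered_idom)
  have "real_analytic_at E \<mu>" if \<mu>: "\<mu>\<^sub>0 < \<mu>" for \<mu>
  proof -
    define x where "x = E \<mu>"
    have x: "m < x" "M x = \<mu>" using E[OF \<mu>] by (auto simp: x_def)
    obtain d where d: "d > 0" "(M has_real_derivative d) (at x)" using der[OF x(1)] by blast
    have "isCont E (M x)"
      by (rule isCont_inverse_function2[of "(m + x) / 2" x "x + 1"]) (use x EM cont in auto)
    moreover have "\<forall>\<^sub>F y in nhds (M x). M (E y) = y"
      using eventually_nhds_in_open[of "{\<mu>\<^sub>0<..}" "M x"] E(2) x(2) \<mu>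
      by (auto elim: eventually_mono)
    ultimately have "real_analytic_at E (M x)"
      using an[OF x(1)] d EM[OF x(1)] by (intro real_analytic_at_inverse_function[of M x d]) auto
    then show ?thesis by (simp add: x)
  qed
  then have "real_analytic_on E {\<mu>\<^sub>0<..}" by (intro real_analytic_on_if_real_analytic_at) auto
  moreover have "strict_mono_on {\<mu>\<^sub>0<..} E"
    by (rule strict_mono_onI) (metis E greaterThan_iff mono_iff)
  ultimately show ?thesis by (intro that[of E]) (use E EM in \<open>simp_all\<close>)
qed

text \<open>The inverse of an increasing concave function is convex. Concavity of \<open>M\<close> is expressed by
  supergradients, the form in which test functions provide it.\<close>

lemma convex_on_inverse_if_supergradient:
  fixes M E :: "real \<Rightarrow> real" and m \<mu>\<^sub>0 :: real
  assumes E: "\<And>\<mu>. \<mu>\<^sub>0 < \<mu> \<Longrightarrow> m < E \<mu>" "\<And>\<mu>. \<mu>\<^sub>0 < \<mu> \<Longrightarrow> M (E \<mu>) = \<mu>"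
    and EM: "\<And>x. m < x \<Longrightarrow> E (M x) = x" and lower: "\<And>x. m < x \<Longrightarrow> \<mu>\<^sub>0 < M x"
    and mono: "strict_mono_on {\<mu>\<^sub>0<..} E"
    and super: "\<And>x. m < x \<Longrightarrow> \<exists>c. \<forall>y>m. M y \<le> M x + c * (y - x)"
  shows "convex_on {\<mu>\<^sub>0<..} E"
proof (rule convex_onI)
  fix t \<mu> \<nu> :: real assume t: "0 < t" "t < 1" and "\<mu> \<in> {\<mu>\<^sub>0<..}" "\<nu> \<in> {\<mu>\<^sub>0<..}"
  then have \<mu>\<nu>: "\<mu>\<^sub>0 < \<mu>" "\<mu>\<^sub>0 < \<nu>" by auto
  define x where "x = (1 - t) * E \<mu> + t * E \<nu>"
  have "0 < (1 - t) * (E \<mu> - m) + t * (E \<nu> - m)" using t E(1) \<mu>\<nu> by (intro add_pos_pos mult_pos_pos) auto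
  then have x: "m < x" by (simp add: x_def algebra_simps)
  obtain c where c: "\<And>y. m < y \<Longrightarrow> M y \<le> M x + c * (y - x)" using super[OF x] by blast
  have "(1 - t) * \<mu> + t * \<nu> \<le> (1 - t) * (M x + c * (E \<mu> - x)) + t * (M x + c * (E \<nu> - x))"
    using t c[of "E \<mu>"] c[of "E \<nu>"] E \<mu>\<nu> by (intro add_mono mult_left_mono) auto
  also have "\<dots> = M x" by (simp add: x_def algebra_simps)
  finally have le: "(1 - t) * \<mu> + t * \<nu> \<le> M x" .
  have "0 < (1 - t) * (\<mu> - \<mu>\<^sub>0) + t * (\<nu> - \<mu>\<^sub>0)" using t \<mu>\<nu> by (intro add_pos_pos mult_pos_pos) auto
  then have "\<mu>\<^sub>0 < (1 - t) * \<mu> + t * \<nu>" by (simp add: algebra_simps)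
  then have "E ((1 - t) * \<mu> + t * \<nu>) \<le> E (M x)"
    using le lower[OF x] mono by (simp add: strict_mono_on_leD)
  then show "E ((1 - t) *\<^sub>R \<mu> + t *\<^sub>R \<nu>) \<le> (1 - t) * E \<mu> + t * E \<nu>"
    by (simp only: EM[OF x] real_scaleR_def) (simp only: x_def)
qed auto

lemma strictly_convex_on_inverse_if_strict_supergradient:
  fixes M E :: "real \<Rightarrow> real" and m \<mu>\<^sub>0 :: real
  assumes E: "\<And>\<mu>. \<mu>\<^sub>0 < \<mu> \<Longrightarrow> m < E \<mu>" "\<And>\<mu>. \<mu>\<^sub>0 < \<mu> \<Longrightarrow> M (E \<mu>) = \<mu>"
    and EM: "\<And>x. m < x \<Longrightarrow> E (M x) = x" and lower: "\<And>x. m < x \<Longrightarrow> \<mu>\<^sub>0 < M x"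
    and mono: "strict_mono_on {\<mu>\<^sub>0<..} E"
    and super: "\<And>x. m < x \<Longrightarrow> \<exists>c. \<forall>y>m. y \<noteq> x \<longrightarrow> M y < M x + c * (y - x)"
  shows "strictly_convex_on {\<mu>\<^sub>0<..} E"
  unfolding strictly_convex_on_def
proof (intro conjI ballI allI impI)
  fix \<mu> \<nu> s t :: real assume "\<mu> \<in> {\<mu>\<^sub>0<..}" "\<nu> \<in> {\<mu>\<^sub>0<..}" and st: "0 < s" "0 < t" and "\<mu> \<noteq> \<nu> \<and> s + t = 1"
  then have \<mu>\<nu>: "\<mu>\<^sub>0 < \<mu>" "\<mu>\<^sub>0 < \<nu>" "\<mu> \<noteq> \<nu>" and s: "s = 1 - t" by auto
  have ne: "E \<mu> \<noteq> E \<nu>" using E(2) \<mu>\<nu> by metis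
  define x where "x = s * E \<mu> + t * E \<nu>"
  have "0 < s * (E \<mu> - m) + t * (E \<nu> - m)" using st E(1) \<mu>\<nu> by (intro add_pos_pos mult_pos_pos) auto
  then have x: "m < x" by (simp add: x_def s algebra_simps)
  obtain c where c: "\<And>y. m < y \<Longrightarrow> y \<noteq> x \<Longrightarrow> M y < M x + c * (y - x)" using super[OF x] by blast
  have "E \<mu> \<noteq> x" "E \<nu> \<noteq> x"
  proof -
    have "E \<mu> - x = t * (E \<mu> - E \<nu>)" "E \<nu> - x = s * (E \<nu> - E \<mu>)" by (auto simp: x_def s algebra_simps)
    then show "E \<mu> \<noteq> x" "E \<nu> \<noteq> x" using st ne by auto
  qed
  then have "s * \<mu> + t * \<nu> < s * (M x + c * (E \<mu> - x)) + t * (M x + c * (E \<nu> - x))"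
    using st c[of "E \<mu>"] c[of "E \<nu>"] E \<mu>\<nu> by (intro add_strict_mono mult_strict_left_mono) auto
  also have "\<dots> = M x" by (simp add: x_def s algebra_simps)
  finally have le: "s * \<mu> + t * \<nu> < M x" .
  have "0 < s * (\<mu> - \<mu>\<^sub>0) + t * (\<nu> - \<mu>\<^sub>0)" using st \<mu>\<nu> by (intro add_pos_pos mult_pos_pos) auto
  then have "\<mu>\<^sub>0 < s * \<mu> + t * \<nu>" by (simp add: s algebra_simps)
  then have "E (s * \<mu> + t * \<nu>) < E (M x)"
    using le lower[OF x] mono by (simp add: strict_mono_on_def)
  then show "E (s * \<mu> + t * \<nu>) < s * E \<mu> + t * E \<nu>"
    by (simp only: EM[OF x]) (simp only: x_def)
qed auto

section \<open>Integration over the torus\<close>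

abbreviation open_square :: "(real \<times> real) set" where
  "open_square \<equiv> {-pi<..<pi} \<times> {-pi<..<pi}"

lemma torus_borel [measurable, simp]: "torus \<in> sets borel"
  unfolding torus_def by (intro borel_Times) auto

lemma open_open_square: "open open_square" by (intro open_Times) auto

lemma space_torus_measure: "space torus_measure = torus"
  by (simp add: torus_measure_def space_restrict_space)

lemma torus_subset_cbox: "torus \<subseteq> cbox (-pi, -pi) (pi, pi)"
  by (auto simp: torus_def cbox_Pair_eq)

lemma finite_measure_torus: "finite_measure torus_measure"
proof
  have "emeasure lborel torus \<le> emeasure lborel (cbox (-pi, -pi) (pi, pi :: real))"
    by (rule emeasure_mono[OF torus_subset_cbox]) auto
  also have "\<dots> < \<infinity>" by (rule emeasure_lborel_cbox_finite)
  finally show "emeasure torus_measure (space torus_measure) \<noteq> \<infinity>"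
    by (simp add: space_torus_measure torus_measure_def emeasure_restrict_space)
qed

lemma AE_torus_iff: "(AE p in torus_measure. P p) \<longleftrightarrow> (AE p in lborel. p \<in> torus \<longrightarrow> P p)"
  unfolding torus_measure_def by (rule AE_restrict_space_iff) auto

lemma AE_torusI: "(\<And>p. p \<in> torus \<Longrightarrow> P p) \<Longrightarrow> AE p in torus_measure. P p"
  by (simp add: AE_torus_iff)

lemma measurable_torus_continuous:
  fixes f :: "real \<times> real \<Rightarrow> 'b::topological_space"
  assumes "continuous_on UNIV f"
  shows "f \<in> borel_measurable torus_measure"
  unfolding torus_measure_def
  by (intro measurable_restrict_space1) (use assms in \<open>simp add: borel_measurable_continuous_onI\<close>)

lemma continuous_bounded_on_torus:
  fixes f :: "real \<times> real \<Rightarrow> 'b::real_normed_vector"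
  assumes "continuous_on UNIV f"
  obtains B where "B > 0" "\<And>p. p \<in> torus \<Longrightarrow> norm (f p) \<le> B"
proof -
  have "compact (f ` cbox (-pi, -pi) (pi, pi))"
    using assms by (intro compact_continuous_image compact_cbox) (auto intro: continuous_on_subset)
  then obtain B where "B > 0" "\<forall>y \<in> f ` cbox (-pi, -pi) (pi, pi). norm y \<le> B"
    using compact_imp_bounded bounded_pos by metis
  then show ?thesis using torus_subset_cbox by (intro that[of B]) auto
qed

lemma integrable_torus_bounded:
  fixes f :: "real \<times> real \<Rightarrow> 'b::{banach, second_countable_topology}"
  assumes "f \<in> borel_measurable torus_measure" "\<And>p. p \<in> torus \<Longrightarrow> norm (f p) \<le> B"
  shows "integrable torus_measure f"
  using assms finite_measure_torus
  by (intro finite_measure.integrable_const_bound[of _ _ B]) (auto simp: AE_torusI)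

lemma integrable_torus_continuous:
  fixes f :: "real \<times> real \<Rightarrow> 'b::{banach, second_countable_topology}"
  assumes "continuous_on UNIV f"
  shows "integrable torus_measure f"
  using continuous_bounded_on_torus[OF assms] measurable_torus_continuous[OF assms]
  by (metis integrable_torus_bounded)

lemma AE_in_open_square: "AE p in torus_measure. p \<in> open_square"
proof -
  have "{pi} \<times> (UNIV :: real set) \<in> null_sets (lborel \<Otimes>\<^sub>M lborel)"
       "(UNIV :: real set) \<times> {pi} \<in> null_sets (lborel \<Otimes>\<^sub>M lborel)"
    by (auto simp: null_sets_def lborel.emeasure_pair_measure_Times)
  then have "AE p in lborel. p \<notin> {pi} \<times> (UNIV :: real set)" "AE p in lborel. p \<notin> (UNIV :: real set) \<times> {pi}"
    by (simp_all only: lborel_prod AE_not_in)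
  then show ?thesis unfolding AE_torus_iff
    by eventually_elim (auto simp: torus_def less_le)
qed

text \<open>Otherwise \<open>f\<close> would be nonzero on a nonempty open subset of the square, which has positive measure.\<close>

lemma AE_torus_continuous_eq_0:
  fixes f :: "real \<times> real \<Rightarrow> 'b::real_normed_vector"
  assumes cont: "continuous_on UNIV f" and ae: "AE p in torus_measure. f p = 0"
    and p: "p \<in> open_square"
  shows "f p = 0"
proof (rule ccontr)
  assume "f p \<noteq> 0"
  define U where "U = open_square \<inter> {x. f x \<noteq> 0}"
  have "open {x. f x \<noteq> 0}" using cont by (intro open_Collect_neq) auto
  then have U: "open U" "p \<in> U" using p \<open>f p \<noteq> 0\<close> open_open_square by (auto simp: U_def)
  have "AE x in lborel. x \<notin> U"
    using ae unfolding AE_torus_iff by eventually_elim (auto simp: U_def torus_def)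
  then have "U \<in> null_sets lborel" using U(1) by (subst AE_iff_null_sets) auto
  then have "negligible U" using U(1) negligible_iff_null_sets null_sets_completionI by blast
  then show False using open_not_negligible U by blast
qed

lemma integral_torus_eq:
  fixes f :: "real \<times> real \<Rightarrow> 'b::{banach, second_countable_topology}"
  assumes "f \<in> borel_measurable torus_measure"
  shows "(LINT q|torus_measure. f q) = (LINT q|lborel. indicator open_square q *\<^sub>R f q)"
    and "(\<lambda>q. indicator open_square q *\<^sub>R f q) \<in> borel_measurable lborel"
proof -
  have m1: "(\<lambda>q. indicator torus q *\<^sub>R f q) \<in> borel_measurable lborel"
    using assms unfolding torus_measure_def by (subst (asm) borel_measurable_restrict_space_iff) auto
  have eq: "indicator open_square q *\<^sub>R f q = indicator open_square q *\<^sub>R (indicator torus q *\<^sub>R f q)" for q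
    by (auto simp: indicator_def torus_def)
  show m2: "(\<lambda>q. indicator open_square q *\<^sub>R f q) \<in> borel_measurable lborel"
    unfolding eq using open_open_square by (intro borel_measurable_scaleR[OF borel_measurable_indicator m1]) auto
  have "(LINT q|torus_measure. f q) = (LINT q|lborel. indicator torus q *\<^sub>R f q)"
    unfolding torus_measure_def by (rule integral_restrict_space) auto
  also have "\<dots> = (LINT q|lborel. indicator open_square q *\<^sub>R f q)"
  proof (rule integral_cong_AE[OF m1 m2])
    show "AE q in lborel. indicator torus q *\<^sub>R f q = indicator open_square q *\<^sub>R f q"
      using AE_in_open_square unfolding AE_torus_iff
      by eventually_elim (auto simp: indicator_def torus_def)
  qed
  finally show "(LINT q|torus_measure. f q) = (LINT q|lborel. indicator open_square q *\<^sub>R f q)" .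
qed

text \<open>The half-open square is not invariant under \<open>p \<mapsto> - p\<close>, but it differs from the invariant open
  square by a null set only.\<close>

lemma integral_torus_involution:
  fixes f :: "real \<times> real \<Rightarrow> 'b::{banach, second_countable_topology}"
  assumes f: "f \<in> borel_measurable torus_measure"
    and T: "T \<in> measurable lborel lborel" "distr lborel lborel T = lborel"
    and sq: "\<And>p. T p \<in> open_square \<longleftrightarrow> p \<in> open_square"
    and g: "AE p in torus_measure. f (T p) = g p" "g \<in> borel_measurable torus_measure"
  shows "(LINT q|torus_measure. g q) = (LINT q|torus_measure. f q)"
proof -
  define F where "F = (\<lambda>q. indicator open_square q *\<^sub>R f q)"
  have F: "F \<in> borel_measurable lborel" using integral_torus_eq(2)[OF f] by (simp add: F_def)
  have "(LINT q|torus_measure. f q) = (LINT q|distr lborel lborel T. F q)"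
    by (simp add: integral_torus_eq(1)[OF f] T F_def)
  also have "\<dots> = (LINT q|lborel. F (T q))" by (rule integral_distr[OF T(1) F])
  also have "\<dots> = (LINT q|lborel. indicator open_square q *\<^sub>R g q)"
  proof (rule integral_cong_AE)
    show "(\<lambda>q. F (T q)) \<in> borel_measurable lborel" using measurable_compose[OF T(1) F] .
    show "AE q in lborel. F (T q) = indicator open_square q *\<^sub>R g q"
      using g(1) unfolding AE_torus_iff
      by eventually_elim (use sq in \<open>auto simp: F_def indicator_def torus_def\<close>)
  qed (use integral_torus_eq(2)[OF g(2)] in auto)
  finally show ?thesis by (simp add: integral_torus_eq(1)[OF g(2)])
qed

lemma lborel_distr_uminus_prod: "distr lborel lborel uminus = (lborel :: (real \<times> real) measure)"
proof -
  have "(lborel :: (real \<times> real) measure) =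
      density (distr lborel borel (\<lambda>x. 0 + (-1 :: real) *\<^sub>R x)) (\<lambda>_. \<bar>-1 :: real\<bar> ^ DIM(real \<times> real))"
    by (rule lborel_affine) auto
  also have "\<dots> = distr lborel borel (\<lambda>x. - x)" by (simp add: density_1)
  also have "\<dots> = distr lborel lborel uminus" by (rule distr_cong) auto
  finally show ?thesis ..
qed

lemma lborel_distr_swap_prod: "distr lborel lborel prod.swap = (lborel :: (real \<times> real) measure)"
proof -
  have "lborel \<Otimes>\<^sub>M lborel = distr (lborel \<Otimes>\<^sub>M lborel) (lborel \<Otimes>\<^sub>M lborel) (\<lambda>(x::real, y::real). (y, x))"
    by (rule lborel_pair.distr_pair_swap)
  then show ?thesis unfolding lborel_prod prod.swap_def by (simp add: case_prod_unfold)
qed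

section \<open>Resolvent averages and their threshold behaviour\<close>

locale dispersion =
  fixes e :: "real \<times> real \<Rightarrow> real" and m :: real
  assumes e_cont: "continuous_on UNIV e"
    and e_le: "\<And>p. e p \<le> m"
    and e_less: "\<And>p. p \<in> open_square \<Longrightarrow> e p < m"
begin

text \<open>The averages \<open>res \<phi>\<close> are the matrix elements of the resolvent of the multiplication operator, which is
  all the spectral problem depends on; \<open>- res2 \<phi>\<close> is the derivative of \<open>res \<phi>\<close>, and \<open>cres \<phi>\<close>, \<open>cres2 \<phi>\<close>
  are the extensions to complex energies.\<close>

definition res :: "(real \<times> real \<Rightarrow> real) \<Rightarrow> real \<Rightarrow> real" where
  "res \<phi> E = 1 / (4 * pi\<^sup>2) * (LINT q|torus_measure. \<phi> q / (E - e q))"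

definition res2 :: "(real \<times> real \<Rightarrow> real) \<Rightarrow> real \<Rightarrow> real" where
  "res2 \<phi> E = 1 / (4 * pi\<^sup>2) * (LINT q|torus_measure. \<phi> q / (E - e q)\<^sup>2)"

definition cres :: "(real \<times> real \<Rightarrow> real) \<Rightarrow> complex \<Rightarrow> complex" where
  "cres \<phi> z = of_real (1 / (4 * pi\<^sup>2)) * (LINT q|torus_measure. of_real (\<phi> q) / (z - of_real (e q)))"

definition cres2 :: "(real \<times> real \<Rightarrow> real) \<Rightarrow> complex \<Rightarrow> complex" where
  "cres2 \<phi> z = of_real (1 / (4 * pi\<^sup>2)) * (LINT q|torus_measure. of_real (\<phi> q) / (z - of_real (e q))\<^sup>2)"

lemma gap_pos: "m < E \<Longrightarrow> 0 < E - e q"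
  using e_le[of q] by linarith

lemma gap_ne: "m < E \<Longrightarrow> E - e q \<noteq> 0"
  using e_le[of q] by linarith

lemma cgap: "m < Re z \<Longrightarrow> Re z - m \<le> norm (z - of_real (e q))"
  using complex_Re_le_cmod[of "z - of_real (e q)"] e_le[of q] by simp

lemma cgap_ne: "m < Re z \<Longrightarrow> z - of_real (e q) \<noteq> 0"
  using cgap[of z q] by auto

lemma continuous_quotient:
  assumes "continuous_on UNIV \<phi>" "m < E"
  shows "continuous_on UNIV (\<lambda>q. \<phi> q / (E - e q))" "continuous_on UNIV (\<lambda>q. \<phi> q / (E - e q)\<^sup>2)"
  using assms gap_ne[OF assms(2)] by (auto intro!: continuous_intros e_cont)

lemma continuous_cquotient:
  assumes "continuous_on UNIV \<phi>" "m < Re z"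
  shows "continuous_on UNIV (\<lambda>q. complex_of_real (\<phi> q) / (z - of_real (e q)))"
    "continuous_on UNIV (\<lambda>q. complex_of_real (\<phi> q) / (z - of_real (e q))\<^sup>2)"
  using assms cgap_ne[OF assms(2)] by (auto intro!: continuous_intros e_cont)

lemmas integrable_quotient = integrable_torus_continuous[OF continuous_quotient(1)]
  integrable_torus_continuous[OF continuous_quotient(2)]

lemma cres_of_real: "cres \<phi> (of_real E) = of_real (res \<phi> E)"
  unfolding cres_def res_def by (simp only: of_real_mult flip: of_real_diff of_real_divide integral_complex_of_real)

lemma cres2_of_real: "cres2 \<phi> (of_real E) = of_real (res2 \<phi> E)"
  unfolding cres2_def res2_def
  by (simp only: of_real_mult flip: of_real_diff of_real_divide of_real_power integral_complex_of_real)

text \<open>The second-order remainder of \<open>1 / (w - e q)\<close> at \<open>w = z\<close> is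
  \<open>(w - z)\<^sup>2 / ((w - e q) (z - e q)\<^sup>2)\<close>, which is bounded by a constant times \<open>(w - z)\<^sup>2\<close> uniformly in \<open>q\<close>
  while \<open>w\<close> stays at distance \<open>\<delta>\<close> from the half-plane \<open>Re \<le> m\<close>.\<close>

lemma cres_has_derivative:
  assumes \<phi>: "continuous_on UNIV \<phi>" and z: "m < Re z"
  shows "(cres \<phi> has_field_derivative - cres2 \<phi> z) (at z)"
proof -
  define I where "I = (\<lambda>z. LINT q|torus_measure. complex_of_real (\<phi> q) / (z - of_real (e q)))"
  define J where "J = (LINT q|torus_measure. complex_of_real (\<phi> q) / (z - of_real (e q))\<^sup>2)"
  define \<delta> where "\<delta> = (Re z - m) / 2"
  have \<delta>: "\<delta> > 0" using z by (simp add: \<delta>_def)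
  obtain B where B: "B > 0" "\<And>p. p \<in> torus \<Longrightarrow> norm (\<phi> p) \<le> B"
    using continuous_bounded_on_torus[OF \<phi>] by blast
  define K where "K = (B / \<delta> ^ 3) * measure torus_measure (space torus_measure)"
  have bound: "norm ((I w - I z) / (w - z) + J) \<le> norm (w - z) * K" if w: "norm (w - z) < \<delta>" "w \<noteq> z" for w
  proof -
    have Rew: "Re w - m \<ge> \<delta>"
      using abs_Re_le_cmod[of "w - z"] w unfolding \<delta>_def by (simp; argo)
    then have wm: "m < Re w" using \<delta> by linarith
    have eq: "I w - I z + (w - z) * J
        = (LINT q|torus_measure. (w - z)\<^sup>2 * (of_real (\<phi> q) / ((w - of_real (e q)) * (z - of_real (e q))\<^sup>2)))"
    proof -
      have *: "of_real (\<phi> q) / (w - of_real (e q)) - of_real (\<phi> q) / (z - of_real (e q))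
            + (w - z) * (of_real (\<phi> q) / (z - of_real (e q))\<^sup>2)
          = (w - z)\<^sup>2 * (of_real (\<phi> q) / ((w - of_real (e q)) * (z - of_real (e q))\<^sup>2))" for q
        using cgap_ne[OF wm, of q] cgap_ne[OF z, of q]
        by (simp add: divide_simps power2_eq_square) (simp add: algebra_simps)
      show ?thesis unfolding I_def J_def *[symmetric]
        using integrable_torus_continuous[OF continuous_cquotient(1)[OF \<phi> wm]]
          integrable_torus_continuous[OF continuous_cquotient(1)[OF \<phi> z]]
          integrable_torus_continuous[OF continuous_cquotient(2)[OF \<phi> z]]
        by (simp only: Bochner_Integration.integral_add Bochner_Integration.integral_diff Bochner_Integration.integrable_diff integrable_mult_right integral_mult_right_zero)
    qed
    have "norm (I w - I z + (w - z) * J) \<le> (LINT q|torus_measure. norm (w - z) ^ 2 * (B / \<delta> ^ 3))"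
      unfolding eq
    proof (rule Bochner_Integration.integral_norm_bound_integral)
      show "integrable torus_measure
         (\<lambda>q. (w - z)\<^sup>2 * (of_real (\<phi> q) / ((w - of_real (e q)) * (z - of_real (e q))\<^sup>2)))"
        using cgap_ne[OF wm] cgap_ne[OF z]
        by (intro integrable_torus_continuous) (auto intro!: continuous_intros e_cont \<phi>)
      show "integrable torus_measure (\<lambda>q. norm (w - z) ^ 2 * (B / \<delta> ^ 3))"
        by (intro integrable_torus_continuous) (auto intro!: continuous_intros)
      fix q assume "q \<in> space torus_measure"
      then have q: "q \<in> torus" by (simp add: space_torus_measure)
      have "\<delta> \<le> norm (w - of_real (e q))" "\<delta> \<le> norm (z - of_real (e q))"
        using cgap[OF wm, of q] cgap[OF z, of q] Rew \<delta> by (auto simp: \<delta>_def)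
      then have "\<delta> * \<delta> ^ 2 \<le> norm (w - of_real (e q)) * norm (z - of_real (e q)) ^ 2"
        using \<delta> by (intro mult_mono power_mono) auto
      then have "\<bar>\<phi> q\<bar> / (norm (w - of_real (e q)) * norm (z - of_real (e q)) ^ 2) \<le> B / \<delta> ^ 3"
        using B(2)[OF q] B(1) \<delta> by (intro frac_le) (auto simp: power3_eq_cube power2_eq_square mult.assoc)
      then have "norm (w - z) ^ 2 * (\<bar>\<phi> q\<bar> / (norm (w - of_real (e q)) * norm (z - of_real (e q)) ^ 2))
          \<le> norm (w - z) ^ 2 * (B / \<delta> ^ 3)"
        by (intro mult_left_mono) auto
      then show "norm ((w - z)\<^sup>2 * (of_real (\<phi> q) / ((w - of_real (e q)) * (z - of_real (e q))\<^sup>2)))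
          \<le> norm (w - z) ^ 2 * (B / \<delta> ^ 3)"
        by (simp add: norm_mult norm_divide norm_power)
    qed
    also have "\<dots> = norm (w - z) * (norm (w - z) * K)" by (simp add: K_def power2_eq_square mult.assoc)
    finally have "norm (w - z) * norm ((I w - I z) / (w - z) + J) \<le> norm (w - z) * (norm (w - z) * K)"
      using w(2) by (simp add: norm_mult[symmetric] distrib_left)
    then show ?thesis using w(2) by simp
  qed
  have "((\<lambda>w. (I w - I z) / (w - z) + J) \<longlongrightarrow> 0) (at z)"
  proof (rule Lim_null_comparison)
    have "\<forall>\<^sub>F w in at z. w \<noteq> z \<and> norm (w - z) < \<delta>"
      using \<delta> by (auto simp: eventually_at dist_norm intro!: exI[of _ \<delta>])
    then show "\<forall>\<^sub>F w in at z. norm ((I w - I z) / (w - z) + J) \<le> norm (w - z) * K"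
      by eventually_elim (use bound in auto)
    show "((\<lambda>w. norm (w - z) * K) \<longlongrightarrow> 0) (at z)" by (auto intro!: tendsto_eq_intros)
  qed
  from tendsto_diff[OF this tendsto_const[of J]]
  have "(I has_field_derivative - J) (at z)" by (simp add: has_field_derivative_iff)
  from DERIV_cmult[OF this, of "of_real (1 / (4 * pi\<^sup>2))"]
  show ?thesis by (simp add: cres_def[abs_def] cres2_def I_def J_def)
qed

lemma cres_holomorphic:
  assumes "continuous_on UNIV \<phi>"
  shows "cres \<phi> holomorphic_on {z. Re z > m}"
  using cres_has_derivative[OF assms]
  by (subst holomorphic_on_open) (auto simp: open_halfspace_Re_gt)

lemma res_analytic:
  assumes "continuous_on UNIV \<phi>" "m < E"
  shows "real_analytic_at (res \<phi>) E"
  unfolding real_analytic_at_def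
proof (intro exI[of _ "cres \<phi>"] conjI)
  show "cres \<phi> analytic_on {of_real E}"
    using cres_holomorphic[OF assms(1)] assms(2)
    by (auto simp: analytic_at open_halfspace_Re_gt intro!: exI[of _ "{z. Re z > m}"])
qed (simp add: cres_of_real)

lemma res_DERIV:
  assumes "continuous_on UNIV \<phi>" "m < E"
  shows "(res \<phi> has_real_derivative - res2 \<phi> E) (at E)"
proof -
  have "(cres \<phi> has_field_derivative - cres2 \<phi> (of_real E)) (at (of_real E))"
    using assms by (intro cres_has_derivative) auto
  then have "((\<lambda>y. cres \<phi> (of_real y)) has_vector_derivative - cres2 \<phi> (of_real E)) (at E)"
    by (intro has_vector_derivative_real_field)
  then have "((\<lambda>y. Re (cres \<phi> (of_real y))) has_vector_derivative Re (- cres2 \<phi> (of_real E))) (at E)"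
    by (rule bounded_linear.has_vector_derivative[OF bounded_linear_Re])
  then show ?thesis
    by (simp add: has_real_derivative_iff_has_vector_derivative cres_of_real cres2_of_real)
qed

lemma res_linear:
  assumes "continuous_on UNIV \<phi>" "continuous_on UNIV \<psi>" "m < E"
  shows "res (\<lambda>q. x * \<phi> q + y * \<psi> q) E = x * res \<phi> E + y * res \<psi> E"
    and "res2 (\<lambda>q. x * \<phi> q + y * \<psi> q) E = x * res2 \<phi> E + y * res2 \<psi> E"
proof -
  note int = integrable_quotient[OF assms(1,3)] integrable_quotient[OF assms(2,3)]
  have "(x * \<phi> q + y * \<psi> q) / (E - e q) = x * (\<phi> q / (E - e q)) + y * (\<psi> q / (E - e q))"
    "(x * \<phi> q + y * \<psi> q) / (E - e q)\<^sup>2 = x * (\<phi> q / (E - e q)\<^sup>2) + y * (\<psi> q / (E - e q)\<^sup>2)" for q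
    by (simp_all add: add_divide_distrib)
  then show "res (\<lambda>q. x * \<phi> q + y * \<psi> q) E = x * res \<phi> E + y * res \<psi> E"
    "res2 (\<lambda>q. x * \<phi> q + y * \<psi> q) E = x * res2 \<phi> E + y * res2 \<psi> E"
    using int by (simp_all only: res_def res2_def Bochner_Integration.integral_add integrable_mult_right integral_mult_right_zero)
      (simp_all add: algebra_simps)
qed

lemma integral_torus_pos:
  fixes f :: "real \<times> real \<Rightarrow> real"
  assumes "continuous_on UNIV f" "\<And>q. 0 \<le> f q" "p \<in> open_square" "f p \<noteq> 0"
  shows "0 < (LINT q|torus_measure. f q)"
proof -
  have int: "integrable torus_measure f" by (rule integrable_torus_continuous[OF assms(1)])
  have "(LINT q|torus_measure. f q) \<noteq> 0"
    using AE_torus_continuous_eq_0[OF assms(1) _ assms(3)] assms(2,4)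
    by (subst integral_nonneg_eq_0_iff_AE[OF int]) auto
  moreover have "0 \<le> (LINT q|torus_measure. f q)" using assms(2) by simp
  ultimately show ?thesis by linarith
qed

lemma res_pos:
  assumes "continuous_on UNIV \<phi>" "m < E" "\<And>q. 0 \<le> \<phi> q" "p \<in> open_square" "\<phi> p \<noteq> 0"
  shows "0 < res \<phi> E" "0 < res2 \<phi> E"
proof -
  have "0 < (LINT q|torus_measure. \<phi> q / (E - e q))"
    using gap_pos[OF assms(2)] gap_ne[OF assms(2), of p] assms less_imp_le[OF gap_pos[OF assms(2)]]
    by (intro integral_torus_pos[of _ p] continuous_quotient) auto
  moreover have "0 < (LINT q|torus_measure. \<phi> q / (E - e q)\<^sup>2)"
    using gap_ne[OF assms(2), of p] assms
    by (intro integral_torus_pos[of _ p] continuous_quotient) auto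
  ultimately show "0 < res \<phi> E" "0 < res2 \<phi> E" by (auto simp: res_def res2_def)
qed

lemma res_strict_antimono:
  assumes "continuous_on UNIV \<phi>" "\<And>q. 0 \<le> \<phi> q" "p \<in> open_square" "\<phi> p \<noteq> 0" "m < E" "E < E'"
  shows "res \<phi> E' < res \<phi> E"
proof (rule DERIV_neg_imp_decreasing[OF assms(6)])
  fix x assume "E \<le> x" "x \<le> E'"
  then have "m < x" using assms(5) by linarith
  then show "\<exists>y. (res \<phi> has_real_derivative y) (at x) \<and> y < 0"
    using res_DERIV[OF assms(1)] res_pos(2)[OF assms(1) _ assms(2-4)] by (intro exI[of _ "- res2 \<phi> x"]) auto
qed

lemma res_small:
  assumes "continuous_on UNIV \<phi>" "\<epsilon> > 0"
  obtains E\<^sub>0 where "m < E\<^sub>0" "\<And>E. E\<^sub>0 \<le> E \<Longrightarrow> \<bar>res \<phi> E\<bar> < \<epsilon>"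
proof -
  obtain B where B: "B > 0" "\<And>p. p \<in> torus \<Longrightarrow> norm (\<phi> p) \<le> B"
    using continuous_bounded_on_torus[OF assms(1)] by blast
  define K where "K = 1 / (4 * pi\<^sup>2) * (B * measure torus_measure (space torus_measure))"
  have K: "0 \<le> K" using B(1) by (simp add: K_def)
  show ?thesis
  proof (rule that[of "m + (K / \<epsilon> + 1)"])
    fix E assume E: "m + (K / \<epsilon> + 1) \<le> E"
    have "0 \<le> K / \<epsilon>" using K assms(2) by simp
    then have Em: "m < E" "E - m > K / \<epsilon>" using E by linarith+
    have "norm (LINT q|torus_measure. \<phi> q / (E - e q)) \<le> (\<integral>q. B / (E - m) \<partial>torus_measure)"
    proof (rule Bochner_Integration.integral_norm_bound_integral)
      fix q assume "q \<in> space torus_measure"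
      then have "\<bar>\<phi> q\<bar> \<le> B" using B(2) by (simp add: space_torus_measure)
      then have "\<bar>\<phi> q\<bar> / (E - e q) \<le> B / (E - m)" using e_le[of q] Em B(1) by (intro frac_le) auto
      then show "norm (\<phi> q / (E - e q)) \<le> B / (E - m)" using gap_pos[OF Em(1), of q] by simp
    qed (use integrable_quotient(1)[OF assms(1) Em(1)] in \<open>auto intro!: integrable_torus_continuous continuous_intros\<close>)
    then have "1 / (4 * pi\<^sup>2) * \<bar>LINT q|torus_measure. \<phi> q / (E - e q)\<bar>
        \<le> 1 / (4 * pi\<^sup>2) * (LINT q|torus_measure. B / (E - m))"
      by (intro mult_left_mono) auto
    then have "\<bar>res \<phi> E\<bar> \<le> K / (E - m)"
      by (simp add: res_def K_def abs_mult mult.commute[of B])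
    also have "\<dots> < \<epsilon>" using Em assms(2) by (simp add: field_simps)
    finally show "\<bar>res \<phi> E\<bar> < \<epsilon>" .
  next
    show "m < m + (K / \<epsilon> + 1)" using K assms(2) by (simp add: add_nonneg_pos)
  qed
qed

text \<open>All one-sided limits at the threshold \<open>m\<close> are taken along this sequence, so that the convergence
  theorems for sequences of integrals apply; monotonicity in \<open>E\<close> covers the energies in between.\<close>

definition approach :: "nat \<Rightarrow> real" where "approach n = m + 1 / real (Suc n)"

lemma approach_gt: "m < approach n" by (simp add: approach_def)

lemma approach_tendsto: "approach \<longlonglongrightarrow> m"
  using tendsto_add[OF tendsto_const[of m] lim_inverse_n'[THEN LIMSEQ_Suc]] by (simp add: approach_def[abs_def])

lemma approach_decseq: "i \<le> j \<Longrightarrow> approach j \<le> approach i"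
  by (simp add: approach_def field_simps)

text \<open>A numerator that vanishes at the maximum at least as fast as \<open>m - e\<close> makes the quotients
  \<open>\<phi> q / (E - e q)\<close> bounded uniformly in \<open>E \<ge> m\<close>, so dominated convergence applies. At \<open>E = m\<close> the
  value \<open>0\<close> of the quotient at the maximum itself is harmless.\<close>

lemma
  assumes \<phi>: "continuous_on UNIV \<phi>" and nonneg: "\<And>q. 0 \<le> \<phi> q"
    and bound: "\<And>q. q \<in> torus \<Longrightarrow> \<phi> q \<le> K * (m - e q)"
  shows res_tendsto_threshold: "(\<lambda>n. res \<phi> (approach n)) \<longlonglongrightarrow> res \<phi> m"
    and res_le_threshold: "m < E \<Longrightarrow> res \<phi> E \<le> res \<phi> m"
proof -
  have meas: "(\<lambda>q. \<phi> q / (E - e q)) \<in> borel_measurable torus_measure" for E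
    using measurable_torus_continuous[OF \<phi>] measurable_torus_continuous[OF e_cont] by simp
  have AE_lt: "AE q in torus_measure. e q < m"
    using AE_in_open_square by eventually_elim (rule e_less)
  have q_le: "\<phi> q / (E - e q) \<le> \<phi> q / (m - e q)" if "e q < m" "m \<le> E" for q E
    using that nonneg[of q] by (intro frac_le) auto
  have bd: "\<phi> q / (m - e q) \<le> K" if "e q < m" "q \<in> torus" for q
    using bound[OF that(2)] that(1) by (simp add: divide_le_eq)
  have AE_bd: "AE q in torus_measure. norm (\<phi> q / (E - e q)) \<le> K" if "m \<le> E" for E
    using AE_lt AE_space[of torus_measure] unfolding space_torus_measure
  proof eventually_elim
    case (elim q)
    have "0 \<le> \<phi> q / (E - e q)" using nonneg[of q] elim that by simp
    then show ?case using q_le[OF elim(1) that] bd[OF elim] by (simp only: real_norm_def abs_of_nonneg)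
  qed
  have intK: "integrable torus_measure (\<lambda>_. K)" by (intro integrable_torus_continuous) auto
  have int_m: "integrable torus_measure (\<lambda>q. \<phi> q / (m - e q))"
    by (rule Bochner_Integration.integrable_bound[OF intK meas]) (use AE_bd[of m] in \<open>auto elim!: eventually_mono\<close>)
  have "(\<lambda>n. LINT q|torus_measure. \<phi> q / (approach n - e q)) \<longlonglongrightarrow> (LINT q|torus_measure. \<phi> q / (m - e q))"
  proof (rule integral_dominated_convergence[where w = "\<lambda>_. K", OF meas meas intK])
    show "AE q in torus_measure. (\<lambda>n. \<phi> q / (approach n - e q)) \<longlonglongrightarrow> \<phi> q / (m - e q)"
      using AE_lt by eventually_elim (auto intro!: tendsto_intros approach_tendsto)
    show "AE q in torus_measure. norm (\<phi> q / (approach n - e q)) \<le> K" for n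
      using AE_bd[of "approach n"] approach_gt[of n] by simp
  qed
  then show "(\<lambda>n. res \<phi> (approach n)) \<longlonglongrightarrow> res \<phi> m"
    unfolding res_def by (rule tendsto_mult_left)
  assume E: "m < E"
  have "(LINT q|torus_measure. \<phi> q / (E - e q)) \<le> (LINT q|torus_measure. \<phi> q / (m - e q))"
    using AE_lt by (intro integral_mono_AE integrable_quotient(1)[OF \<phi> E] int_m)
      (auto elim!: eventually_mono intro!: q_le simp: E less_imp_le)
  then show "res \<phi> E \<le> res \<phi> m" unfolding res_def by (intro mult_left_mono) auto
qed

lemma res_less_threshold:
  assumes "continuous_on UNIV \<phi>" "\<And>q. 0 \<le> \<phi> q" "\<And>q. q \<in> torus \<Longrightarrow> \<phi> q \<le> K * (m - e q)"
    "p \<in> open_square" "\<phi> p \<noteq> 0" "m < E"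
  shows "res \<phi> E < res \<phi> m"
proof -
  have "res \<phi> E < res \<phi> ((m + E) / 2)" using assms by (intro res_strict_antimono[of _ p]) auto
  also have "\<dots> \<le> res \<phi> m" using assms by (intro res_le_threshold[of _ K]) auto
  finally show ?thesis .
qed

text \<open>If the increasing sequence of integrals were bounded, monotone convergence would make \<open>1 / (m - e)\<close>
  integrable.\<close>

lemma res_unbounded:
  assumes div: "\<not> integrable torus_measure (\<lambda>q. 1 / (m - e q))"
  shows "filterlim (\<lambda>n. res (\<lambda>_. 1) (approach n)) at_top sequentially"
proof -
  define f where "f = (\<lambda>n. LINT q|torus_measure. 1 / (approach n - e q))"
  have int: "integrable torus_measure (\<lambda>q. 1 / (approach n - e q))" for n
    by (rule integrable_quotient(1)[OF continuous_on_const approach_gt])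
  have le: "1 / (approach i - e q) \<le> 1 / (approach j - e q)" if "i \<le> j" for i j q
    using approach_decseq[OF that] gap_pos[OF approach_gt, of j q] by (intro frac_le) auto
  have inc: "incseq f"
    unfolding f_def by (intro incseq_SucI integral_mono int le) auto
  have "\<not> bdd_above (range f)"
  proof
    assume bdd: "bdd_above (range f)"
    have "integrable torus_measure (\<lambda>q. 1 / (m - e q))"
    proof (rule integrable_monotone_convergence[OF int])
      show "AE q in torus_measure. mono (\<lambda>n. 1 / (approach n - e q))"
        by (intro AE_torusI monoI le)
      show "AE q in torus_measure. (\<lambda>n. 1 / (approach n - e q)) \<longlonglongrightarrow> 1 / (m - e q)"
        using AE_in_open_square by eventually_elim (use e_less in \<open>force intro!: tendsto_intros approach_tendsto\<close>)
      show "(\<lambda>n. LINT q|torus_measure. 1 / (approach n - e q)) \<longlonglongrightarrow> (SUP n. f n)"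
        using LIMSEQ_incseq_SUP[OF bdd inc] by (simp add: f_def)
      show "(\<lambda>q. 1 / (m - e q)) \<in> borel_measurable torus_measure"
        using measurable_torus_continuous[OF e_cont] by simp
    qed
    then show False using div by simp
  qed
  have "filterlim f at_top sequentially"
    unfolding filterlim_at_top
  proof
    fix Z
    obtain n where "f n > Z" using \<open>\<not> bdd_above (range f)\<close> by (auto simp: bdd_above_def not_le)
    then show "\<forall>\<^sub>F n in sequentially. Z \<le> f n"
      using inc unfolding eventually_sequentially by (meson incseqD less_imp_le order_trans)
  qed
  then have "filterlim (\<lambda>n. 1 / (4 * pi\<^sup>2) * f n) at_top sequentially"
    by (rule filterlim_tendsto_pos_mult_at_top[OF tendsto_const, rotated]) simp
  then show ?thesis by (simp add: res_def f_def)
qed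

end

section \<open>Reduction of the eigenvalue equation\<close>

abbreviation cos_sum :: "real \<times> real \<Rightarrow> real" where
  "cos_sum p \<equiv> cos (fst p) + cos (snd p)"

text \<open>Pairing without complex conjugation; the weights are real.\<close>

definition moment :: "(real \<times> real \<Rightarrow> real) \<Rightarrow> (real \<times> real \<Rightarrow> complex) \<Rightarrow> complex" where
  "moment w f = (LINT q|torus_measure. of_real (w q) * f q)"

lemma continuous_weight: "continuous_on UNIV (weight \<omega>)"
  by (cases \<omega>) (auto intro!: continuous_intros simp: weight.simps[abs_def] fun_eq_iff)

lemma L2_torus_continuous: "continuous_on UNIV f \<Longrightarrow> f \<in> L2_torus"
  unfolding L2_torus_def
  by (auto intro!: measurable_torus_continuous integrable_torus_continuous continuous_intros)

lemma moment_integrable: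
  assumes f: "f \<in> L2_torus" and w: "continuous_on UNIV w"
  shows "integrable torus_measure (\<lambda>q. of_real (w q) * f q)"
proof -
  obtain B where B: "B > 0" "\<And>p. p \<in> torus \<Longrightarrow> norm (w p) \<le> B"
    using continuous_bounded_on_torus[OF w] by blast
  have m: "f \<in> borel_measurable torus_measure" and i: "integrable torus_measure (\<lambda>p. (cmod (f p))\<^sup>2)"
    using f by (auto simp: L2_torus_def)
  have "integrable torus_measure (\<lambda>q. B * (1 + (cmod (f q))\<^sup>2))"
    using i integrable_torus_continuous[OF continuous_on_const, of "1 :: real"]
    by (intro integrable_mult_right Bochner_Integration.integrable_add)
  then show ?thesis
  proof (rule Bochner_Integration.integrable_bound)
    show "AE q in torus_measure. norm (of_real (w q) * f q) \<le> norm (B * (1 + (cmod (f q))\<^sup>2))"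
    proof (rule AE_torusI)
      fix q assume q: "q \<in> torus"
      have "cmod (f q) \<le> 1 + (cmod (f q))\<^sup>2"
        using zero_le_power2[of "cmod (f q) - 1 / 2"] unfolding power2_diff by (simp add: power2_eq_square)
      then have "\<bar>w q\<bar> * cmod (f q) \<le> B * (1 + (cmod (f q))\<^sup>2)"
        using B(1) B(2)[OF q] by (intro mult_mono) auto
      then show "norm (of_real (w q) * f q) \<le> norm (B * (1 + (cmod (f q))\<^sup>2))"
        using B(1) by (simp add: norm_mult abs_mult)
    qed
  qed (use m measurable_torus_continuous[OF w] in simp)
qed

text \<open>An integral that changes sign under a measure-preserving substitution vanishes.\<close>

lemma moment_eq_0_involution:
  assumes f: "f \<in> L2_torus" and w: "continuous_on UNIV w"
    and T: "T \<in> measurable lborel lborel" "distr lborel lborel T = lborel"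
    and sq: "\<And>p. T p \<in> open_square \<longleftrightarrow> p \<in> open_square"
    and ae: "AE p in torus_measure. of_real (w (T p)) * f (T p) = - (of_real (w p) * f p)"
  shows "moment w f = 0"
proof -
  have m: "(\<lambda>q. of_real (w q) * f q) \<in> borel_measurable torus_measure"
    using moment_integrable[OF f w] by auto
  have "(LINT q|torus_measure. - (of_real (w q) * f q)) = moment w f"
    unfolding moment_def using m by (intro integral_torus_involution[OF m T sq ae]) auto
  then show ?thesis by (simp add: moment_def)
qed

lemma moment_eq_0_parity:
  assumes f: "f \<in> L2_torus" and w: "continuous_on UNIV w"
    and par: "ae_odd f \<and> (\<forall>p. w (- p) = w p) \<or> ae_even f \<and> (\<forall>p. w (- p) = - w p)"
  shows "moment w f = 0"
proof (rule moment_eq_0_involution[OF f w])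
  show "uminus \<in> measurable lborel lborel" by simp
  show "AE p in torus_measure. of_real (w (- p)) * f (- p) = - (of_real (w p) * f p)"
    using par unfolding ae_odd_def ae_even_def by (auto elim!: eventually_mono)
qed (auto simp: lborel_distr_uminus_prod)

lemma moment_eq_0_swap:
  assumes f: "f \<in> L2_torus" and w: "continuous_on UNIV w"
    and par: "ae_symmetric f \<and> (\<forall>p. w (prod.swap p) = - w p) \<or> ae_antisymmetric f \<and> (\<forall>p. w (prod.swap p) = w p)"
  shows "moment w f = 0"
proof (rule moment_eq_0_involution[OF f w])
  show "prod.swap \<in> measurable lborel (lborel :: (real \<times> real) measure)"
    unfolding prod.swap_def by (simp add: borel_prod[symmetric] measurable_lborel1)
  show "AE p in torus_measure. of_real (w (prod.swap p)) * f (prod.swap p) = - (of_real (w p) * f p)"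
    using par
  proof
    assume *: "ae_symmetric f \<and> (\<forall>p. w (prod.swap p) = - w p)"
    then have "AE p in torus_measure. f (fst p, snd p) = f (snd p, fst p)" by (simp add: ae_symmetric_def)
    then show ?thesis
    proof eventually_elim
      case (elim p)
      have "f (prod.swap p) = f p" using elim by (metis prod.swap_def prod.collapse)
      moreover have "w (prod.swap p) = - w p" using * by blast
      ultimately show ?case by (simp only: of_real_minus mult_minus_left)
    qed
  next
    assume *: "ae_antisymmetric f \<and> (\<forall>p. w (prod.swap p) = w p)"
    then have "AE p in torus_measure. f (fst p, snd p) = - f (snd p, fst p)" by (simp add: ae_antisymmetric_def)
    then show ?thesis
    proof eventually_elim
      case (elim p)
      have "f (prod.swap p) = - f p" using elim by (metis prod.swap_def prod.collapse add.inverse_inverse)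
      moreover have "w (prod.swap p) = w p" using * by blast
      ultimately show ?case by (simp only: mult_minus_right)
    qed
  qed
qed (auto simp: lborel_distr_swap_prod)

text \<open>By the addition theorem the interaction kernel is the sum of \<open>a\<close> and \<open>b\<close> times four products
  \<open>w p * w q\<close>, with \<open>w\<close> running through \<open>cos_sum\<close> and the weights of the sectors \<open>EA\<close>, \<open>OS\<close>, \<open>OA\<close>. Each of
  these functions has a definite parity and a definite behaviour under the swap, so that in a given
  sector most moments vanish.\<close>

lemma H_op_moments:
  assumes f: "f \<in> L2_torus"
  shows "H_op e a b \<mu> f p = of_real (e p) * f p + of_real (\<mu> / (4 * pi\<^sup>2)) *
    (of_real a * moment (\<lambda>_. 1) f + of_real b * (of_real (cos_sum p) * moment cos_sum f +
      of_real (weight EA p) * moment (weight EA) f + of_real (weight OS p) * moment (weight OS) f +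
      of_real (weight OA p) * moment (weight OA) f))"
proof -
  have int: "integrable torus_measure (\<lambda>q. of_real (w q) * f q)" if "continuous_on UNIV w" for w
    by (rule moment_integrable[OF f that])
  have i1: "integrable torus_measure (\<lambda>q. of_real 1 * f q)" by (rule int) auto
  have ic: "integrable torus_measure (\<lambda>q. of_real (cos_sum q) * f q)" by (rule int) (auto intro!: continuous_intros)
  have iw: "integrable torus_measure (\<lambda>q. of_real (weight \<omega> q) * f q)" for \<omega>
    by (rule int[OF continuous_weight])
  have "complex_of_real (a + 2 * b * (cos (fst p - fst q) + cos (snd p - snd q))) * f q
     = of_real a * (of_real 1 * f q) + of_real b * (of_real (cos_sum p) * (of_real (cos_sum q) * f q)
       + of_real (weight EA p) * (of_real (weight EA q) * f q) + of_real (weight OS p) * (of_real (weight OS q) * f q)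
       + of_real (weight OA p) * (of_real (weight OA q) * f q))" for q
  proof -
    have "a + 2 * b * (cos (fst p - fst q) + cos (snd p - snd q))
      = a * 1 + b * (cos_sum p * cos_sum q + weight EA p * weight EA q + weight OS p * weight OS q
         + weight OA p * weight OA q)"
      by (simp add: cos_diff) algebra
    then have "complex_of_real (a + 2 * b * (cos (fst p - fst q) + cos (snd p - snd q)))
      = of_real a * of_real 1 + of_real b * (of_real (cos_sum p) * of_real (cos_sum q)
        + of_real (weight EA p) * of_real (weight EA q) + of_real (weight OS p) * of_real (weight OS q)
         + of_real (weight OA p) * of_real (weight OA q))"
      by (simp only: of_real_add of_real_mult)
    then show ?thesis by (simp only: distrib_right distrib_left mult.assoc)
  qed
  then show ?thesis
    unfolding H_op_def moment_def using i1 ic iw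
    by (simp only: Bochner_Integration.integral_add Bochner_Integration.integrable_add
        integrable_mult_right integral_mult_right_zero)
qed

lemma L2_sectorD: "f \<in> L2_sector \<omega> \<Longrightarrow> f \<in> L2_torus"
  by (cases \<omega>) auto

lemma cos_sum_continuous: "continuous_on UNIV cos_sum"
  by (intro continuous_intros)

lemma H_op_rank_one:
  assumes "\<omega> \<noteq> ES" "f \<in> L2_sector \<omega>"
  shows "H_op e a b \<mu> f p = of_real (e p) * f p +
    of_real (\<mu> / (4 * pi\<^sup>2)) * (of_real b * (of_real (weight \<omega> p) * moment (weight \<omega>) f))"
proof -
  have f: "f \<in> L2_torus" using assms(2) by (rule L2_sectorD)
  note z = moment_eq_0_parity[OF f] moment_eq_0_swap[OF f]
  note c = continuous_weight cos_sum_continuous continuous_on_const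
  show ?thesis
  proof (cases \<omega>)
    case OS
    then have "ae_odd f" "ae_symmetric f" using assms(2) by auto
    then have "moment (\<lambda>_. 1) f = 0" "moment cos_sum f = 0" "moment (weight EA) f = 0"
      by (intro z(1) c; simp)+
    moreover have "moment (weight OA) f = 0"
      using \<open>ae_symmetric f\<close> by (intro z(2) c) simp
    ultimately show ?thesis by (simp add: H_op_moments[OF f] OS del: weight.simps)
  next
    case OA
    then have "ae_odd f" "ae_antisymmetric f" using assms(2) by auto
    then have "moment (\<lambda>_. 1) f = 0" "moment cos_sum f = 0" "moment (weight EA) f = 0"
      by (intro z(1) c; simp)+
    moreover have "moment (weight OS) f = 0"
      using \<open>ae_antisymmetric f\<close> by (intro z(2) c) (simp add: add.commute)
    ultimately show ?thesis by (simp add: H_op_moments[OF f] OA del: weight.simps)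
  next
    case EA
    then have "ae_even f" "ae_antisymmetric f" using assms(2) by auto
    then have "moment (\<lambda>_. 1) f = 0" "moment cos_sum f = 0"
      by (intro z(2) c; simp add: add.commute)+
    moreover have "moment (weight OS) f = 0" "moment (weight OA) f = 0"
      using \<open>ae_even f\<close> by (intro z(1) c; simp)+
    ultimately show ?thesis by (simp add: H_op_moments[OF f] EA del: weight.simps)
  qed (use assms in auto)
qed

lemma H_op_ES:
  assumes "f \<in> L2_sector ES"
  shows "H_op e a b \<mu> f p = of_real (e p) * f p + of_real (\<mu> / (4 * pi\<^sup>2)) *
    (of_real a * moment (\<lambda>_. 1) f + of_real b * (of_real (cos_sum p) * moment cos_sum f))"
proof -
  have f: "f \<in> L2_torus" using assms by (rule L2_sectorD)
  note z = moment_eq_0_parity[OF f] moment_eq_0_swap[OF f]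
  have "ae_even f" "ae_symmetric f" using assms by auto
  then have "moment (weight OS) f = 0" "moment (weight OA) f = 0"
    by (intro z(1) continuous_weight; simp)+
  moreover have "moment (weight EA) f = 0"
    using \<open>ae_symmetric f\<close> by (intro z(2) continuous_weight) simp
  ultimately show ?thesis by (simp add: H_op_moments[OF f] del: weight.simps)
qed

lemma moment_cong_AE:
  assumes "AE p in torus_measure. f p = g p" "f \<in> borel_measurable torus_measure" "g \<in> borel_measurable torus_measure"
    "continuous_on UNIV w"
  shows "moment w f = moment w g"
  unfolding moment_def using assms measurable_torus_continuous[OF assms(4)]
  by (intro integral_cong_AE) (auto elim!: eventually_mono)

lemma ae_lin_indep_singleton:
  "ae_lin_indep [f] \<longleftrightarrow> \<not> (AE p in torus_measure. f p = 0)"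
proof
  assume "ae_lin_indep [f]"
  then have "(AE p in torus_measure. 1 * f p = 0) \<longrightarrow> (1::complex) = 0"
    unfolding ae_lin_indep_def by (elim allE[of _ "\<lambda>_. 1"]) (auto dest: spec[of _ 0])
  then show "\<not> (AE p in torus_measure. f p = 0)" by simp
next
  assume *: "\<not> (AE p in torus_measure. f p = 0)"
  show "ae_lin_indep [f]"
    unfolding ae_lin_indep_def
  proof (intro allI impI)
    fix c :: "nat \<Rightarrow> complex" and i assume "AE p in torus_measure. (\<Sum>i<length [f]. c i * ([f] ! i) p) = 0" and i: "i < length [f]"
    then have "AE p in torus_measure. c 0 * f p = 0" by simp
    then have "c 0 = 0" using * by (auto elim: eventually_mono)
    then show "c i = 0" using i by simp
  qed
qed

lemma ae_lin_indep_pairI: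
  assumes "\<And>c d. AE p in torus_measure. c * f p + d * g p = 0 \<Longrightarrow> c = 0 \<and> d = 0"
  shows "ae_lin_indep [f, g]"
  unfolding ae_lin_indep_def
proof (intro allI impI)
  fix c :: "nat \<Rightarrow> complex" and i assume "AE p in torus_measure. (\<Sum>i<length [f, g]. c i * ([f, g] ! i) p) = 0" and i: "i < length [f, g]"
  then have "AE p in torus_measure. c 0 * f p + c 1 * g p = 0" by (simp add: lessThan_Suc add.commute)
  from assms[OF this] show "c i = 0" using i by (cases i) auto
qed

text \<open>A vanishing combination \<open>c f + d g\<close> is mapped by the operator to \<open>c E f + d E' g\<close>, which vanishes as well;
  eliminating \<open>g\<close> or \<open>f\<close> leaves \<open>(E - E') c f = 0\<close> and \<open>(E' - E) d g = 0\<close>.\<close>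

lemma ae_lin_indep_distinct_eigenvalues:
  assumes "eigenfunction e a b \<mu> \<omega> E f" "eigenfunction e a b \<mu> \<omega> E' g" "E \<noteq> E'"
  shows "ae_lin_indep [f, g]"
proof (rule ae_lin_indep_pairI)
  fix c d assume ae: "AE p in torus_measure. c * f p + d * g p = 0"
  have f: "f \<in> L2_torus" "AE p in torus_measure. H_op e a b \<mu> f p = of_real E * f p" "\<not> (AE p in torus_measure. f p = 0)"
    and g: "g \<in> L2_torus" "AE p in torus_measure. H_op e a b \<mu> g p = of_real E' * g p" "\<not> (AE p in torus_measure. g p = 0)"
    using assms by (auto simp: eigenfunction_def eigenspace_def dest: L2_sectorD)
  have mom: "c * moment w f + d * moment w g = 0" if w: "continuous_on UNIV w" for w
  proof -
    have "c * moment w f + d * moment w g = moment w (\<lambda>p. c * f p + d * g p)"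
      using moment_integrable[OF f(1) w] moment_integrable[OF g(1) w]
      unfolding moment_def by (simp add: distrib_left mult.left_commute[of "of_real _"])
    also have "\<dots> = moment w (\<lambda>_. 0)"
      using f(1) g(1) by (intro moment_cong_AE[OF ae _ _ w]) (auto simp: L2_torus_def)
    finally show ?thesis by (simp add: moment_def)
  qed
  have H: "c * H_op e a b \<mu> f p + d * H_op e a b \<mu> g p = of_real (e p) * (c * f p + d * g p)" for p
  proof -
    have "c * H_op e a b \<mu> f p + d * H_op e a b \<mu> g p = of_real (e p) * (c * f p + d * g p) +
      of_real (\<mu> / (4 * pi\<^sup>2)) * (of_real a * (c * moment (\<lambda>_. 1) f + d * moment (\<lambda>_. 1) g)
       + of_real b * (of_real (cos_sum p) * (c * moment cos_sum f + d * moment cos_sum g)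
       + of_real (weight EA p) * (c * moment (weight EA) f + d * moment (weight EA) g)
       + of_real (weight OS p) * (c * moment (weight OS) f + d * moment (weight OS) g)
       + of_real (weight OA p) * (c * moment (weight OA) f + d * moment (weight OA) g)))"
      unfolding H_op_moments[OF f(1)] H_op_moments[OF g(1)] by algebra
    then show ?thesis by (simp only: mom continuous_weight cos_sum_continuous continuous_on_const) simp
  qed
  have "AE p in torus_measure. c * (of_real E * f p) + d * (of_real E' * g p) = 0"
    using f(2) g(2) ae
  proof eventually_elim
    case (elim p)
    then show ?case using H[of p] by simp
  qed
  then have 2: "AE p in torus_measure. (of_real (E - E') * c) * f p = 0 \<and> (of_real (E' - E) * d) * g p = 0"
    using ae
  proof eventually_elim
    case (elim p)
    have "(of_real (E - E') * c) * f p = c * (of_real E * f p) + d * (of_real E' * g p) - of_real E' * (c * f p + d * g p)"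
      "(of_real (E' - E) * d) * g p = c * (of_real E * f p) + d * (of_real E' * g p) - of_real E * (c * f p + d * g p)"
      by (simp_all add: algebra_simps)
    then show ?case using elim by simp
  qed
  show "c = 0 \<and> d = 0"
  proof (intro conjI; rule ccontr)
    assume "c \<noteq> 0" then show False using 2 f(3) assms(3) by (auto elim!: eventually_mono)
  next
    assume "d \<noteq> 0" then show False using 2 g(3) assms(3) by (auto elim!: eventually_mono)
  qed
qed

locale torus_dispersion = dispersion +
  assumes e_corner: "e (pi, pi) = m"
    and e_even: "\<And>p. e (- p) = e p"
    and e_swap: "\<And>p. e (prod.swap p) = e p"
begin

lemma e_max_eq: "e_max e = m"
  unfolding e_max_def
proof (rule cSup_eq_maximum)
  show "m \<in> e ` torus" using e_corner by (auto simp: torus_def intro!: image_eqI[of _ e "(pi, pi)"])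
qed (use e_le in auto)

lemma weight_nonzero: "(pi / 2, pi / 6) \<in> open_square" "weight \<omega> (pi / 2, pi / 6) \<noteq> 0"
  using pi_gt_zero by (simp, cases \<omega>) (auto simp: sin_30 cos_30 add_nonneg_eq_0_iff)

lemma continuous_Psi: "m < E \<Longrightarrow> continuous_on UNIV (Psi e \<omega> E)"
  unfolding Psi_def using gap_ne by (auto intro!: continuous_intros e_cont continuous_weight)

lemma Psi_in_sector:
  assumes "m < E" "\<omega> \<noteq> ES" shows "Psi e \<omega> E \<in> L2_sector \<omega>"
proof -
  have "Psi e \<omega> E \<in> L2_torus" using continuous_Psi[OF assms(1)] by (rule L2_torus_continuous)
  moreover have "e (snd p, fst p) = e (fst p, snd p)" for p using e_swap[of p] by (simp add: prod.swap_def)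
  ultimately show ?thesis using assms(2)
    by (cases \<omega>) (auto simp: ae_odd_def ae_even_def ae_symmetric_def ae_antisymmetric_def Psi_def e_even
        add.commute divide_simps intro!: AE_I2)
qed

lemma Psi_not_AE_0: assumes "m < E" shows "\<not> (AE p in torus_measure. Psi e \<omega> E p = 0)"
proof
  assume "AE p in torus_measure. Psi e \<omega> E p = 0"
  from AE_torus_continuous_eq_0[OF continuous_Psi[OF assms] this weight_nonzero(1)]
  show False using weight_nonzero(2)[of \<omega>] gap_ne[OF assms, of "(pi / 2, pi / 6)"] by (simp add: Psi_def)
qed

lemma moment_quotient:
  "moment w (\<lambda>p. of_real (\<phi> p / (E - e p))) = of_real (4 * pi\<^sup>2 * res (\<lambda>p. w p * \<phi> p) E)"
proof -
  have "moment w (\<lambda>p. of_real (\<phi> p / (E - e p))) = (LINT q|torus_measure. of_real (w q * \<phi> q / (E - e q)))"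
    unfolding moment_def by (simp flip: of_real_mult)
  also have "\<dots> = of_real (4 * pi\<^sup>2 * res (\<lambda>p. w p * \<phi> p) E)"
    unfolding integral_complex_of_real res_def by simp
  finally show ?thesis .
qed

lemma moment_Psi: "moment (weight \<omega>) (Psi e \<omega> E) = of_real (4 * pi\<^sup>2 * res (\<lambda>p. (weight \<omega> p)\<^sup>2) E)"
  unfolding Psi_def moment_quotient power2_eq_square ..

text \<open>Dividing the eigenvalue equation by \<open>E - e\<close> shows that \<open>f\<close> is a multiple of \<open>Psi\<close>; pairing the result
  with the weight gives the scalar consistency condition on the multiple.\<close>

lemma eigenspace_rank_oneD:
  assumes "f \<in> eigenspace e a b \<mu> \<omega> E" "\<omega> \<noteq> ES" "m < E"
  obtains \<kappa> where "AE p in torus_measure. f p = \<kappa> * Psi e \<omega> E p"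
    "\<kappa> = \<kappa> * of_real (\<mu> * b * res (\<lambda>p. (weight \<omega> p)\<^sup>2) E)"
proof -
  have f: "f \<in> L2_sector \<omega>" "AE p in torus_measure. H_op e a b \<mu> f p = of_real E * f p"
    using assms(1) by (auto simp: eigenspace_def)
  define \<kappa> where "\<kappa> = of_real (\<mu> * b / (4 * pi\<^sup>2)) * moment (weight \<omega>) f"
  have ae: "AE p in torus_measure. f p = \<kappa> * Psi e \<omega> E p"
    using f(2)
  proof eventually_elim
    case (elim p)
    have "of_real (E - e p) * f p = \<kappa> * of_real (weight \<omega> p)"
      using elim unfolding H_op_rank_one[OF assms(2) f(1)] by (simp add: \<kappa>_def algebra_simps)
    then show ?case using gap_ne[OF assms(3), of p] by (simp add: Psi_def field_simps)
  qed
  have "moment (weight \<omega>) f = moment (weight \<omega>) (\<lambda>p. \<kappa> * Psi e \<omega> E p)"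
    using L2_sectorD[OF f(1)] measurable_torus_continuous[OF continuous_Psi[OF assms(3)]]
    by (intro moment_cong_AE[OF ae _ _ continuous_weight]) (auto simp: L2_torus_def)
  also have "\<dots> = \<kappa> * moment (weight \<omega>) (Psi e \<omega> E)"
    unfolding moment_def by (simp add: mult.left_commute[of "of_real _"])
  finally have "\<kappa> = of_real (\<mu> * b / (4 * pi\<^sup>2)) * (\<kappa> * of_real (4 * pi\<^sup>2 * res (\<lambda>p. (weight \<omega> p)\<^sup>2) E))"
    by (simp only: moment_Psi) (simp only: \<kappa>_def)
  also have "\<dots> = \<kappa> * of_real (\<mu> * b * res (\<lambda>p. (weight \<omega> p)\<^sup>2) E)" by simp
  finally show ?thesis by (rule that[OF ae])
qed

lemma Psi_eigenfunction:
  assumes "\<omega> \<noteq> ES" "m < E" "\<mu> * b * res (\<lambda>p. (weight \<omega> p)\<^sup>2) E = 1"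
  shows "eigenfunction e a b \<mu> \<omega> E (Psi e \<omega> E)"
proof -
  have "H_op e a b \<mu> (Psi e \<omega> E) p = of_real E * Psi e \<omega> E p" for p
  proof -
    have "H_op e a b \<mu> (Psi e \<omega> E) p = of_real (e p * (weight \<omega> p / (E - e p))
        + \<mu> * b * res (\<lambda>p. (weight \<omega> p)\<^sup>2) E * weight \<omega> p)"
      unfolding H_op_rank_one[OF assms(1) Psi_in_sector[OF assms(2,1)]] moment_Psi
      by (simp add: Psi_def)
    also have "\<dots> = of_real (E * (weight \<omega> p / (E - e p)))"
      unfolding assms(3) using gap_ne[OF assms(2), of p] by (simp add: field_simps)
    finally show ?thesis by (simp add: Psi_def)
  qed
  then show ?thesis
    using Psi_in_sector[OF assms(2,1)] Psi_not_AE_0[OF assms(2)]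
    by (simp add: eigenfunction_def eigenspace_def)
qed

lemma eigenvalues_rank_one:
  assumes "\<omega> \<noteq> ES"
  shows "eigenvalues_above e a b \<mu> \<omega> = {E. m < E \<and> \<mu> * b * res (\<lambda>p. (weight \<omega> p)\<^sup>2) E = 1}"
proof -
  have "\<mu> * b * res (\<lambda>p. (weight \<omega> p)\<^sup>2) E = 1" if E: "m < E" and ef: "eigenfunction e a b \<mu> \<omega> E f" for E f
  proof -
    have f: "f \<in> eigenspace e a b \<mu> \<omega> E" "\<not> (AE p in torus_measure. f p = 0)"
      using ef by (auto simp: eigenfunction_def)
    obtain \<kappa> where \<kappa>: "AE p in torus_measure. f p = \<kappa> * Psi e \<omega> E p"
      "\<kappa> = \<kappa> * of_real (\<mu> * b * res (\<lambda>p. (weight \<omega> p)\<^sup>2) E)"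
      using eigenspace_rank_oneD[OF f(1) assms E] by blast
    have "\<kappa> \<noteq> 0" using \<kappa>(1) f(2) by auto
    then have "complex_of_real (\<mu> * b * res (\<lambda>p. (weight \<omega> p)\<^sup>2) E) = 1" using \<kappa>(2) by (metis mult_cancel_left1)
    then show ?thesis by (simp only: of_real_eq_1_iff)
  qed
  then show ?thesis
    using Psi_eigenfunction[OF assms] unfolding eigenvalues_above_def e_max_eq by blast
qed

lemma multiplicity_rank_one:
  assumes "\<omega> \<noteq> ES" "m < E" "\<mu> * b * res (\<lambda>p. (weight \<omega> p)\<^sup>2) E = 1"
  shows "has_multiplicity e a b \<mu> \<omega> E 1"
  unfolding has_multiplicity_def
proof (intro exI[of _ "[Psi e \<omega> E]"] conjI)
  show "ae_lin_indep [Psi e \<omega> E]" using Psi_not_AE_0[OF assms(2)] by (simp add: ae_lin_indep_singleton)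
  show "set [Psi e \<omega> E] \<subseteq> eigenspace e a b \<mu> \<omega> E"
    using Psi_eigenfunction[OF assms] by (simp add: eigenfunction_def)
  show "ae_spans [Psi e \<omega> E] (eigenspace e a b \<mu> \<omega> E)"
    unfolding ae_spans_def
  proof
    fix f assume "f \<in> eigenspace e a b \<mu> \<omega> E"
    then obtain \<kappa> where "AE p in torus_measure. f p = \<kappa> * Psi e \<omega> E p"
      using eigenspace_rank_oneD assms(1,2) by metis
    then show "\<exists>c. AE p in torus_measure. f p = (\<Sum>i<length [Psi e \<omega> E]. c i * ([Psi e \<omega> E] ! i) p)"
      by (intro exI[of _ "\<lambda>_. \<kappa>"]) simp
  qed
qed simp

end

section \<open>The secular equation of the even symmetric sector\<close>

text \<open>Eigenfunctions in the sector \<open>ES\<close> can be chosen with real constants because of this fact: their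
  coefficients form the complex kernel of a real matrix, and that kernel has a real basis.\<close>

lemma singular_symmetric_system:
  fixes A B D :: real
  assumes "A * D = B\<^sup>2" "A \<noteq> 0 \<or> D \<noteq> 0"
  obtains x\<^sub>0 y\<^sub>0 :: real where "x\<^sub>0 \<noteq> 0 \<or> y\<^sub>0 \<noteq> 0" "A * x\<^sub>0 + B * y\<^sub>0 = 0" "B * x\<^sub>0 + D * y\<^sub>0 = 0"
    "\<forall>x y :: complex. of_real A * x + of_real B * y = 0 \<longrightarrow> of_real B * x + of_real D * y = 0 \<longrightarrow>
       (\<exists>c. x = c * of_real x\<^sub>0 \<and> y = c * of_real y\<^sub>0)"
proof (cases "A = 0")
  case True
  then have B: "B = 0" and D: "D \<noteq> 0" using assms by auto
  show ?thesis by (rule that[of 1 0]) (use True B D in auto)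
next
  case False
  show ?thesis
  proof (rule that[of "- B" A])
    show "B * - B + D * A = 0" using assms(1) by (simp add: power2_eq_square mult.commute)
    show "\<forall>x y :: complex. of_real A * x + of_real B * y = 0 \<longrightarrow> of_real B * x + of_real D * y = 0 \<longrightarrow>
       (\<exists>c. x = c * of_real (- B) \<and> y = c * of_real A)"
    proof (intro allI impI)
      fix x y :: complex assume "of_real A * x + of_real B * y = 0"
      then have "x = - (of_real B * y) / of_real A"
        using False by (simp add: field_simps eq_neg_iff_add_eq_0)
      then show "\<exists>c. x = c * of_real (- B) \<and> y = c * of_real A"
        using False by (intro exI[of _ "y / of_real A"]) simp
    qed
  qed (use False in auto)
qed

context torus_dispersion
begin

abbreviation L\<^sub>0 :: "real \<Rightarrow> real" where "L\<^sub>0 \<equiv> res (\<lambda>_. 1)"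
abbreviation L\<^sub>1 :: "real \<Rightarrow> real" where "L\<^sub>1 \<equiv> res cos_sum"
abbreviation L\<^sub>2 :: "real \<Rightarrow> real" where "L\<^sub>2 \<equiv> res (\<lambda>p. (cos_sum p)\<^sup>2)"

lemma continuous_Psi_es: "m < E \<Longrightarrow> continuous_on UNIV (Psi_es e x y E)"
  unfolding Psi_es_def using gap_ne by (auto intro!: continuous_intros e_cont)

lemma Psi_es_in_sector: assumes "m < E" shows "Psi_es e x y E \<in> L2_sector ES"
proof -
  have "Psi_es e x y E \<in> L2_torus" using continuous_Psi_es[OF assms] by (rule L2_torus_continuous)
  moreover have "e (snd p, fst p) = e (fst p, snd p)" for p using e_swap[of p] by (simp add: prod.swap_def)
  ultimately show ?thesis
    by (auto simp: ae_even_def ae_symmetric_def Psi_es_def e_even add.commute intro!: AE_I2)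
qed

lemma Psi_es_AE_0:
  assumes "m < E" "AE p in torus_measure. Psi_es e x y E p = 0"
  shows "x = 0 \<and> y = 0"
proof -
  have "x + y * cos_sum p = 0" if "p \<in> open_square" for p
  proof -
    have "complex_of_real ((x + y * cos_sum p) / (E - e p)) = 0"
      using AE_torus_continuous_eq_0[OF continuous_Psi_es[OF assms(1)] assms(2) that] by (simp only: Psi_es_def)
    then show ?thesis unfolding of_real_eq_0_iff using gap_ne[OF assms(1), of p] by simp
  qed
  from this[of "(0, 0)"] this[of "(pi / 2, pi / 2)"] show ?thesis by simp
qed

lemma Psi_es_split:
  "Psi_es e x y E p = of_real x * of_real (1 / (E - e p)) + of_real y * of_real (cos_sum p / (E - e p))"
  by (simp only: Psi_es_def add_divide_distrib[of x] times_divide_eq_right mult_1_right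
      flip: of_real_add of_real_mult)

lemma moment_combination:
  assumes "m < E" "continuous_on UNIV w"
  shows "moment w (\<lambda>p. x * of_real (1 / (E - e p)) + y * of_real (cos_sum p / (E - e p)))
    = of_real (4 * pi\<^sup>2) * (x * of_real (res w E) + y * of_real (res (\<lambda>p. w p * cos_sum p) E))"
proof -
  have c: "(\<lambda>p. complex_of_real (1 / (E - e p))) \<in> L2_torus" "(\<lambda>p. complex_of_real (cos_sum p / (E - e p))) \<in> L2_torus"
    using gap_ne[OF assms(1)] by (intro L2_torus_continuous; auto intro!: continuous_intros e_cont)+
  have "moment w (\<lambda>p. x * of_real (1 / (E - e p)) + y * of_real (cos_sum p / (E - e p)))
     = (LINT p|torus_measure. x * (of_real (w p) * of_real (1 / (E - e p))) + y * (of_real (w p) * of_real (cos_sum p / (E - e p))))"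
    unfolding moment_def by (simp add: algebra_simps)
  also have "\<dots> = x * moment w (\<lambda>p. of_real (1 / (E - e p))) + y * moment w (\<lambda>p. of_real (cos_sum p / (E - e p)))"
    unfolding moment_def using moment_integrable[OF c(1) assms(2)] moment_integrable[OF c(2) assms(2)]
    by (simp only: Bochner_Integration.integral_add integrable_mult_right integral_mult_right_zero)
  finally show ?thesis unfolding moment_quotient by (simp add: algebra_simps)
qed

text \<open>Dividing the eigenvalue equation by \<open>E - e\<close> exhibits \<open>f\<close> as \<open>(x + y cos_sum) / (E - e)\<close>; taking the moments
  of this formula against \<open>1\<close> and \<open>cos_sum\<close> closes the system for \<open>x\<close> and \<open>y\<close>.\<close>

lemma eigenspace_ESD:
  assumes "f \<in> eigenspace e a b \<mu> ES E" "m < E"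
  obtains x y :: complex where
    "AE p in torus_measure. f p = x * of_real (1 / (E - e p)) + y * of_real (cos_sum p / (E - e p))"
    "x = of_real (\<mu> * a) * (x * of_real (L\<^sub>0 E) + y * of_real (L\<^sub>1 E))"
    "y = of_real (\<mu> * b) * (x * of_real (L\<^sub>1 E) + y * of_real (L\<^sub>2 E))"
proof -
  have f: "f \<in> L2_sector ES" "AE p in torus_measure. H_op e a b \<mu> f p = of_real E * f p"
    using assms(1) by (auto simp: eigenspace_def)
  define x where "x = of_real (\<mu> * a / (4 * pi\<^sup>2)) * moment (\<lambda>_. 1) f"
  define y where "y = of_real (\<mu> * b / (4 * pi\<^sup>2)) * moment cos_sum f"
  let ?g = "\<lambda>p. x * of_real (1 / (E - e p)) + y * of_real (cos_sum p / (E - e p))"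
  have ae: "AE p in torus_measure. f p = ?g p"
    using f(2)
  proof eventually_elim
    case (elim p)
    have "of_real (E - e p) * f p = x + y * of_real (cos_sum p)"
    proof -
      have "x + y * of_real (cos_sum p) = of_real (\<mu> / (4 * pi\<^sup>2)) *
          (of_real a * moment (\<lambda>_. 1) f + of_real b * (of_real (cos_sum p) * moment cos_sum f))"
        unfolding x_def y_def by (simp only: of_real_divide of_real_mult divide_inverse distrib_left ac_simps)
      then have "of_real E * f p = of_real (e p) * f p + (x + y * of_real (cos_sum p))"
        using elim unfolding H_op_ES[OF f(1)] by metis
      then show ?thesis by (simp only: of_real_diff left_diff_distrib add_diff_cancel_left')
    qed
    moreover have "complex_of_real (E - e p) \<noteq> 0" using gap_ne[OF assms(2), of p] of_real_eq_0_iff by blast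
    ultimately have "f p = (x + y * of_real (cos_sum p)) / of_real (E - e p)"
      by (metis nonzero_mult_div_cancel_left)
    then show ?case
      by (simp only: of_real_divide of_real_1 add_divide_distrib[of x] times_divide_eq_right mult_1_right)
  qed
  have g: "continuous_on UNIV ?g" using gap_ne[OF assms(2)] by (auto intro!: continuous_intros e_cont)
  have mom: "moment w f = of_real (4 * pi\<^sup>2) * (x * of_real (res w E) + y * of_real (res (\<lambda>p. w p * cos_sum p) E))"
    if w: "continuous_on UNIV w" for w
    unfolding moment_combination[OF assms(2) w, symmetric]
    using L2_sectorD[OF f(1)] measurable_torus_continuous[OF g]
    by (intro moment_cong_AE[OF ae _ _ w]) (auto simp: L2_torus_def)
  have 1: "x = of_real (\<mu> * a) * (x * of_real (L\<^sub>0 E) + y * of_real (L\<^sub>1 E))"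
    using x_def mom[of "\<lambda>_. 1"] by (simp add: mult.assoc)
  have 2: "y = of_real (\<mu> * b) * (x * of_real (L\<^sub>1 E) + y * of_real (L\<^sub>2 E))"
    using y_def mom[OF cos_sum_continuous] by (simp add: power2_eq_square mult.assoc)
  show ?thesis by (rule that[OF ae 1 2])
qed

lemma Psi_es_in_eigenspace:
  assumes "m < E"
    and x: "x = \<mu> * a * (x * L\<^sub>0 E + y * L\<^sub>1 E)" and y: "y = \<mu> * b * (x * L\<^sub>1 E + y * L\<^sub>2 E)"
  shows "Psi_es e x y E \<in> eigenspace e a b \<mu> ES E"
proof -
  have mom: "moment w (Psi_es e x y E) = of_real (4 * pi\<^sup>2 * (x * res w E + y * res (\<lambda>p. w p * cos_sum p) E))"
    if w: "continuous_on UNIV w" for w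
    unfolding Psi_es_split[abs_def] moment_combination[OF assms(1) w] by simp
  have "H_op e a b \<mu> (Psi_es e x y E) p = of_real E * Psi_es e x y E p" for p
  proof -
    have "H_op e a b \<mu> (Psi_es e x y E) p = of_real (e p * ((x + y * cos_sum p) / (E - e p))
        + (\<mu> * a * (x * L\<^sub>0 E + y * L\<^sub>1 E) + \<mu> * b * (x * L\<^sub>1 E + y * L\<^sub>2 E) * cos_sum p))"
      unfolding H_op_ES[OF Psi_es_in_sector[OF assms(1)]] mom[OF continuous_on_const] mom[OF cos_sum_continuous]
      by (simp add: Psi_es_def power2_eq_square algebra_simps)
    also have "\<dots> = of_real (e p * ((x + y * cos_sum p) / (E - e p)) + (x + y * cos_sum p))"
      unfolding x[symmetric] y[symmetric] ..
    also have "e p * ((x + y * cos_sum p) / (E - e p)) + (x + y * cos_sum p) = E * ((x + y * cos_sum p) / (E - e p))"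
      using gap_ne[OF assms(1), of p] by (simp add: field_simps)
    also have "of_real \<dots> = of_real E * Psi_es e x y E p" by (simp only: Psi_es_def of_real_mult)
    finally show ?thesis .
  qed
  then show ?thesis using Psi_es_in_sector[OF assms(1)] by (simp add: eigenspace_def)
qed

lemma Psi_es_eigenfunction:
  assumes "m < E" "x \<noteq> 0 \<or> y \<noteq> 0"
    "x = \<mu> * a * (x * L\<^sub>0 E + y * L\<^sub>1 E)" "y = \<mu> * b * (x * L\<^sub>1 E + y * L\<^sub>2 E)"
  shows "eigenfunction e a b \<mu> ES E (Psi_es e x y E)"
  using Psi_es_in_eigenspace[OF assms(1,3,4)] Psi_es_AE_0[OF assms(1)] assms(2)
  unfolding eigenfunction_def by blast

text \<open>The determinant of the symmetric form of the system for the coefficients, written in terms of the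
  inverse coupling \<open>k = 1 / \<mu>\<close>.\<close>

definition secular :: "real \<Rightarrow> real \<Rightarrow> real \<Rightarrow> real \<Rightarrow> real" where
  "secular a b k E = (k / a - L\<^sub>0 E) * (k / b - L\<^sub>2 E) - (L\<^sub>1 E)\<^sup>2"

context
  fixes a b \<mu> E :: real
  assumes a: "a \<noteq> 0" and b: "b \<noteq> 0" and \<mu>: "0 < \<mu>" and E: "m < E"
begin

lemma system_iff:
  fixes x y :: complex
  shows "x = of_real (\<mu> * a) * (x * of_real (L\<^sub>0 E) + y * of_real (L\<^sub>1 E)) \<longleftrightarrow>
      of_real (1 / \<mu> / a - L\<^sub>0 E) * x + of_real (- L\<^sub>1 E) * y = 0"
    "y = of_real (\<mu> * b) * (x * of_real (L\<^sub>1 E) + y * of_real (L\<^sub>2 E)) \<longleftrightarrow>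
      of_real (- L\<^sub>1 E) * x + of_real (1 / \<mu> / b - L\<^sub>2 E) * y = 0"
proof -
  have "of_real (1 / \<mu> / a - L\<^sub>0 E) * x + of_real (- L\<^sub>1 E) * y
      = (x - of_real (\<mu> * a) * (x * of_real (L\<^sub>0 E) + y * of_real (L\<^sub>1 E))) / of_real (\<mu> * a)"
    "of_real (- L\<^sub>1 E) * x + of_real (1 / \<mu> / b - L\<^sub>2 E) * y
      = (y - of_real (\<mu> * b) * (x * of_real (L\<^sub>1 E) + y * of_real (L\<^sub>2 E))) / of_real (\<mu> * b)"
    using a b \<mu> by (simp_all add: field_simps)
  then show "x = of_real (\<mu> * a) * (x * of_real (L\<^sub>0 E) + y * of_real (L\<^sub>1 E)) \<longleftrightarrow>
      of_real (1 / \<mu> / a - L\<^sub>0 E) * x + of_real (- L\<^sub>1 E) * y = 0"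
    "y = of_real (\<mu> * b) * (x * of_real (L\<^sub>1 E) + y * of_real (L\<^sub>2 E)) \<longleftrightarrow>
      of_real (- L\<^sub>1 E) * x + of_real (1 / \<mu> / b - L\<^sub>2 E) * y = 0"
    using a b \<mu> by (simp_all only: divide_eq_0_iff of_real_eq_0_iff mult_eq_0_iff right_minus_eq) auto
qed

lemma system_iff_real:
  shows "x = \<mu> * a * (x * L\<^sub>0 E + y * L\<^sub>1 E) \<longleftrightarrow> (1 / \<mu> / a - L\<^sub>0 E) * x + (- L\<^sub>1 E) * y = 0"
    "y = \<mu> * b * (x * L\<^sub>1 E + y * L\<^sub>2 E) \<longleftrightarrow> (- L\<^sub>1 E) * x + (1 / \<mu> / b - L\<^sub>2 E) * y = 0"
proof -
  have "(1 / \<mu> / a - L\<^sub>0 E) * x + (- L\<^sub>1 E) * y = (x - \<mu> * a * (x * L\<^sub>0 E + y * L\<^sub>1 E)) / (\<mu> * a)"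
    "(- L\<^sub>1 E) * x + (1 / \<mu> / b - L\<^sub>2 E) * y = (y - \<mu> * b * (x * L\<^sub>1 E + y * L\<^sub>2 E)) / (\<mu> * b)"
    using a b \<mu> by (simp_all add: field_simps)
  then show "x = \<mu> * a * (x * L\<^sub>0 E + y * L\<^sub>1 E) \<longleftrightarrow> (1 / \<mu> / a - L\<^sub>0 E) * x + (- L\<^sub>1 E) * y = 0"
    "y = \<mu> * b * (x * L\<^sub>1 E + y * L\<^sub>2 E) \<longleftrightarrow> (- L\<^sub>1 E) * x + (1 / \<mu> / b - L\<^sub>2 E) * y = 0"
    using a b \<mu> by auto
qed

lemma secular_if_eigenvalue:
  assumes "eigenfunction e a b \<mu> ES E f"
  shows "secular a b (1 / \<mu>) E = 0"
proof -
  have f: "f \<in> eigenspace e a b \<mu> ES E" "\<not> (AE p in torus_measure. f p = 0)"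
    using assms by (auto simp: eigenfunction_def)
  obtain x y where ae: "AE p in torus_measure. f p = x * of_real (1 / (E - e p)) + y * of_real (cos_sum p / (E - e p))"
    and xy: "x = of_real (\<mu> * a) * (x * of_real (L\<^sub>0 E) + y * of_real (L\<^sub>1 E))"
      "y = of_real (\<mu> * b) * (x * of_real (L\<^sub>1 E) + y * of_real (L\<^sub>2 E))"
    by (rule eigenspace_ESD[OF f(1) E])
  define A where "A = complex_of_real (1 / \<mu> / a - L\<^sub>0 E)"
  define B where "B = complex_of_real (- L\<^sub>1 E)"
  define D where "D = complex_of_real (1 / \<mu> / b - L\<^sub>2 E)"
  have s: "A * x + B * y = 0" "B * x + D * y = 0" using xy unfolding system_iff A_def B_def D_def by auto
  have "(A * D - B\<^sup>2) * x = D * (A * x + B * y) - B * (B * x + D * y)"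
    "(A * D - B\<^sup>2) * y = A * (B * x + D * y) - B * (A * x + B * y)"
    by (simp_all add: power2_eq_square algebra_simps)
  then have "(A * D - B\<^sup>2) * x = 0" "(A * D - B\<^sup>2) * y = 0" by (simp_all add: s)
  moreover have "\<not> (x = 0 \<and> y = 0)" using ae f(2) by auto
  ultimately have "A * D - B\<^sup>2 = 0" by auto
  then have "complex_of_real (secular a b (1 / \<mu>) E) = 0"
    by (simp add: A_def B_def D_def secular_def)
  then show ?thesis by (simp only: of_real_eq_0_iff)
qed

text \<open>The multiplicity is the dimension of the kernel of the \<open>2 \<times> 2\<close> matrix, which is one unless the matrix
  is zero; a singular symmetric matrix with vanishing diagonal is zero.\<close>

lemma simple_ES_eigenvalue:
  assumes sec: "secular a b (1 / \<mu>) E = 0" and ne: "1 / \<mu> / a \<noteq> L\<^sub>0 E \<or> 1 / \<mu> / b \<noteq> L\<^sub>2 E"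
  shows "has_multiplicity e a b \<mu> ES E 1" "\<exists>x y. eigenfunction e a b \<mu> ES E (Psi_es e x y E)"
proof -
  have "(1 / \<mu> / a - L\<^sub>0 E) * (1 / \<mu> / b - L\<^sub>2 E) = (- L\<^sub>1 E)\<^sup>2" using sec by (simp add: secular_def)
  moreover have "1 / \<mu> / a - L\<^sub>0 E \<noteq> 0 \<or> 1 / \<mu> / b - L\<^sub>2 E \<noteq> 0" using ne by auto
  ultimately obtain x\<^sub>0 y\<^sub>0 where xy: "x\<^sub>0 \<noteq> 0 \<or> y\<^sub>0 \<noteq> 0"
    "(1 / \<mu> / a - L\<^sub>0 E) * x\<^sub>0 + (- L\<^sub>1 E) * y\<^sub>0 = 0" "(- L\<^sub>1 E) * x\<^sub>0 + (1 / \<mu> / b - L\<^sub>2 E) * y\<^sub>0 = 0"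
    and uniq: "\<forall>x y :: complex. of_real (1 / \<mu> / a - L\<^sub>0 E) * x + of_real (- L\<^sub>1 E) * y = 0 \<longrightarrow>
      of_real (- L\<^sub>1 E) * x + of_real (1 / \<mu> / b - L\<^sub>2 E) * y = 0 \<longrightarrow>
       (\<exists>c. x = c * of_real x\<^sub>0 \<and> y = c * of_real y\<^sub>0)"
    by (rule singular_symmetric_system)
  have ef: "eigenfunction e a b \<mu> ES E (Psi_es e x\<^sub>0 y\<^sub>0 E)"
    using xy by (intro Psi_es_eigenfunction[OF E]) (auto simp only: system_iff_real)
  then show "\<exists>x y. eigenfunction e a b \<mu> ES E (Psi_es e x y E)" by blast
  show "has_multiplicity e a b \<mu> ES E 1"
    unfolding has_multiplicity_def
  proof (intro exI[of _ "[Psi_es e x\<^sub>0 y\<^sub>0 E]"] conjI)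
    show "ae_lin_indep [Psi_es e x\<^sub>0 y\<^sub>0 E]" "set [Psi_es e x\<^sub>0 y\<^sub>0 E] \<subseteq> eigenspace e a b \<mu> ES E"
      using ef by (auto simp: ae_lin_indep_singleton eigenfunction_def)
    show "ae_spans [Psi_es e x\<^sub>0 y\<^sub>0 E] (eigenspace e a b \<mu> ES E)"
      unfolding ae_spans_def
    proof
      fix f assume f: "f \<in> eigenspace e a b \<mu> ES E"
      obtain x y where ae: "AE p in torus_measure. f p = x * of_real (1 / (E - e p)) + y * of_real (cos_sum p / (E - e p))"
        and s: "x = of_real (\<mu> * a) * (x * of_real (L\<^sub>0 E) + y * of_real (L\<^sub>1 E))"
          "y = of_real (\<mu> * b) * (x * of_real (L\<^sub>1 E) + y * of_real (L\<^sub>2 E))"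
        by (rule eigenspace_ESD[OF f E])
      obtain c where c: "x = c * of_real x\<^sub>0" "y = c * of_real y\<^sub>0"
        using uniq s[unfolded system_iff] by blast
      have "AE p in torus_measure. f p = c * Psi_es e x\<^sub>0 y\<^sub>0 E p"
        using ae by eventually_elim (simp only: Psi_es_split c distrib_left mult.assoc)
      then show "\<exists>d. AE p in torus_measure. f p = (\<Sum>i<length [Psi_es e x\<^sub>0 y\<^sub>0 E]. d i * ([Psi_es e x\<^sub>0 y\<^sub>0 E] ! i) p)"
        by (intro exI[of _ "\<lambda>_. c"]) simp
    qed
  qed simp
qed

lemma double_ES_eigenvalue:
  assumes "1 / \<mu> / a = L\<^sub>0 E" "1 / \<mu> / b = L\<^sub>2 E" "L\<^sub>1 E = 0"
  shows "eigenfunction e a b \<mu> ES E (Psi_es e 1 0 E)" "eigenfunction e a b \<mu> ES E (Psi_es e 0 1 E)"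
    "ae_lin_indep [Psi_es e 1 0 E, Psi_es e 0 1 E]" "has_multiplicity e a b \<mu> ES E 2"
proof -
  show ef: "eigenfunction e a b \<mu> ES E (Psi_es e 1 0 E)" "eigenfunction e a b \<mu> ES E (Psi_es e 0 1 E)"
  proof -
    have "1 = \<mu> * a * L\<^sub>0 E" "1 = \<mu> * b * L\<^sub>2 E" using a b \<mu> by (simp_all flip: assms(1,2))
    then show "eigenfunction e a b \<mu> ES E (Psi_es e 1 0 E)" "eigenfunction e a b \<mu> ES E (Psi_es e 0 1 E)"
      by (intro Psi_es_eigenfunction[OF E]; simp add: assms(3))+
  qed
  show li: "ae_lin_indep [Psi_es e 1 0 E, Psi_es e 0 1 E]"
  proof (rule ae_lin_indep_pairI)
    fix c d assume ae: "AE p in torus_measure. c * Psi_es e 1 0 E p + d * Psi_es e 0 1 E p = 0"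
    have re: "of_real (Re (c * Psi_es e 1 0 E p + d * Psi_es e 0 1 E p)) = Psi_es e (Re c) (Re d) E p"
      and im: "of_real (Im (c * Psi_es e 1 0 E p + d * Psi_es e 0 1 E p)) = Psi_es e (Im c) (Im d) E p" for p
    proof -
      have R: "Re (z * of_real t) = Re z * t" "Im (z * of_real t) = Im z * t" for z t by simp_all
      show "of_real (Re (c * Psi_es e 1 0 E p + d * Psi_es e 0 1 E p)) = Psi_es e (Re c) (Re d) E p"
        "of_real (Im (c * Psi_es e 1 0 E p + d * Psi_es e 0 1 E p)) = Psi_es e (Im c) (Im d) E p"
        unfolding Psi_es_def plus_complex.sel R
        by (rule arg_cong[where f = of_real], simp add: add_divide_distrib distrib_left)+
    qed
    have "AE p in torus_measure. Psi_es e (Re c) (Re d) E p = 0"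
      using ae
    proof eventually_elim
      case (elim p)
      then show ?case unfolding re[symmetric] by simp
    qed
    then have "Re c = 0 \<and> Re d = 0" by (rule Psi_es_AE_0[OF E])
    moreover have "AE p in torus_measure. Psi_es e (Im c) (Im d) E p = 0"
      using ae
    proof eventually_elim
      case (elim p)
      then show ?case unfolding im[symmetric] by simp
    qed
    then have "Im c = 0 \<and> Im d = 0" by (rule Psi_es_AE_0[OF E])
    ultimately show "c = 0 \<and> d = 0" by (simp add: complex_eq_iff)
  qed
  show "has_multiplicity e a b \<mu> ES E 2"
    unfolding has_multiplicity_def
  proof (intro exI[of _ "[Psi_es e 1 0 E, Psi_es e 0 1 E]"] conjI li)
    show "set [Psi_es e 1 0 E, Psi_es e 0 1 E] \<subseteq> eigenspace e a b \<mu> ES E"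
      using ef by (auto simp: eigenfunction_def)
    show "ae_spans [Psi_es e 1 0 E, Psi_es e 0 1 E] (eigenspace e a b \<mu> ES E)"
      unfolding ae_spans_def
    proof
      fix f assume f: "f \<in> eigenspace e a b \<mu> ES E"
      obtain x y where ae: "AE p in torus_measure. f p = x * of_real (1 / (E - e p)) + y * of_real (cos_sum p / (E - e p))"
        by (rule eigenspace_ESD[OF f E])
      show "\<exists>c. AE p in torus_measure. f p = (\<Sum>i<length [Psi_es e 1 0 E, Psi_es e 0 1 E]. c i * ([Psi_es e 1 0 E, Psi_es e 0 1 E] ! i) p)"
        using ae by (intro exI[of _ "\<lambda>i. if i = 0 then x else y"]) (simp add: lessThan_Suc Psi_es_split add.commute)
    qed
  qed simp
qed

end

lemma eigenvalues_ES:
  assumes "a \<noteq> 0" "b \<noteq> 0" "0 < \<mu>"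
  shows "eigenvalues_above e a b \<mu> ES = {E. m < E \<and> secular a b (1 / \<mu>) E = 0}"
proof -
  have "\<exists>f. eigenfunction e a b \<mu> ES E f" if E: "m < E" and sec: "secular a b (1 / \<mu>) E = 0" for E
  proof (cases "1 / \<mu> / a = L\<^sub>0 E \<and> 1 / \<mu> / b = L\<^sub>2 E")
    case True
    then have "L\<^sub>1 E = 0" using sec by (simp add: secular_def)
    then show ?thesis using double_ES_eigenvalue(1)[OF assms E] True by blast
  next
    case False
    then show ?thesis using simple_ES_eigenvalue(2)[OF assms E sec] by blast
  qed
  then show ?thesis
    using secular_if_eigenvalue[OF assms] unfolding eigenvalues_above_def e_max_eq by blast
qed

end

section \<open>The dispersion relation near its maximum\<close>

lemma continuous_fourier_sum:
  assumes "(\<lambda>x. cmod (ehat x)) summable_on UNIV"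
  shows "continuous_on UNIV (fourier_sum ehat)"
  unfolding fourier_sum_def
proof (rule uniform_limit_theorem)
  show "uniform_limit UNIV
     (\<lambda>X p. \<Sum>x\<in>X. ehat x * exp (\<i> * complex_of_real (fst p * of_int (fst x) + snd p * of_int (snd x))))
     (\<lambda>p. \<Sum>\<^sub>\<infinity>x. ehat x * exp (\<i> * complex_of_real (fst p * of_int (fst x) + snd p * of_int (snd x))))
     (finite_subsets_at_top UNIV)"
    using assms by (intro Weierstrass_m_test_general) (auto simp: norm_mult)
  show "\<forall>\<^sub>F X in finite_subsets_at_top UNIV. continuous_on UNIV
     (\<lambda>p. \<Sum>x\<in>X. ehat x * exp (\<i> * complex_of_real (fst p * of_int (fst x) + snd p * of_int (snd x))))"
    by (intro always_eventually allI continuous_intros)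
qed simp

lemma fourier_sum_periodic:
  "fourier_sum ehat (fst p + 2 * pi * of_int j, snd p + 2 * pi * of_int k) = fourier_sum ehat p"
proof -
  have "exp (\<i> * complex_of_real ((fst p + 2 * pi * of_int j) * of_int (fst x) + (snd p + 2 * pi * of_int k) * of_int (snd x)))
      = exp (\<i> * complex_of_real (fst p * of_int (fst x) + snd p * of_int (snd x)))" for x :: "int \<times> int"
  proof -
    have "\<i> * complex_of_real ((fst p + 2 * pi * of_int j) * of_int (fst x) + (snd p + 2 * pi * of_int k) * of_int (snd x))
      = \<i> * complex_of_real (fst p * of_int (fst x) + snd p * of_int (snd x))
        + \<i> * (of_int (j * fst x + k * snd x) * (of_real pi * 2))"
      by (simp add: algebra_simps)
    then show ?thesis by (simp only: exp_plus_2pin)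
  qed
  then show ?thesis by (simp only: fourier_sum_def fst_conv snd_conv)
qed

lemma angle_representative:
  fixes \<theta> :: real
  obtains n :: int where "- pi < \<theta> + 2 * pi * of_int n" "\<theta> + 2 * pi * of_int n \<le> pi"
proof (rule that[of "- \<lceil>(\<theta> - pi) / (2 * pi)\<rceil>"])
  define n where "n = \<lceil>(\<theta> - pi) / (2 * pi)\<rceil>"
  have n: "of_int n - 1 < (\<theta> - pi) / (2 * pi)" "(\<theta> - pi) / (2 * pi) \<le> of_int n"
    unfolding n_def using ceiling_correct by blast+
  have p: "0 < 2 * pi" using pi_gt_zero by simp
  have "(of_int n - 1) * (2 * pi) < \<theta> - pi" "\<theta> - pi \<le> of_int n * (2 * pi)"
    using n by (simp_all only: pos_less_divide_eq[OF p] pos_divide_le_eq[OF p])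
  then show "- pi < \<theta> + 2 * pi * of_int (- n)" "\<theta> + 2 * pi * of_int (- n) \<le> pi"
    by (simp_all add: n_def algebra_simps)
qed

lemma negative_definite_bound:
  fixes A :: "real \<times> real \<Rightarrow> real \<times> real"
  assumes A: "bounded_linear A" and neg: "\<And>h. h \<noteq> 0 \<Longrightarrow> A h \<bullet> h < 0"
  obtains \<alpha> where "\<alpha> > 0" "\<And>h. A h \<bullet> h \<le> - \<alpha> * (norm h)\<^sup>2"
proof -
  have lin: "linear A" using A bounded_linear.linear by blast
  have cont: "continuous_on (sphere 0 1) (\<lambda>h. A h \<bullet> h)"
    using linear_continuous_on[OF A] by (intro continuous_intros)
  have "sphere (0 :: real \<times> real) 1 \<noteq> {}" by simp
  then obtain h\<^sub>0 where h\<^sub>0: "h\<^sub>0 \<in> sphere 0 1" "\<And>h. h \<in> sphere 0 1 \<Longrightarrow> A h \<bullet> h \<le> A h\<^sub>0 \<bullet> h\<^sub>0"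
    using continuous_attains_sup[OF compact_sphere _ cont] by blast
  show ?thesis
  proof (rule that[of "- (A h\<^sub>0 \<bullet> h\<^sub>0)"])
    show "0 < - (A h\<^sub>0 \<bullet> h\<^sub>0)" using neg[of h\<^sub>0] h\<^sub>0(1) by (cases "h\<^sub>0 = 0") simp_all
    fix h
    show "A h \<bullet> h \<le> - (- (A h\<^sub>0 \<bullet> h\<^sub>0)) * (norm h)\<^sup>2"
    proof (cases "h = 0")
      case False
      have "A ((1 / norm h) *\<^sub>R h) \<bullet> ((1 / norm h) *\<^sub>R h) \<le> A h\<^sub>0 \<bullet> h\<^sub>0"
        using False by (intro h\<^sub>0(2)) simp
      then have "(A h \<bullet> h) / (norm h)\<^sup>2 \<le> A h\<^sub>0 \<bullet> h\<^sub>0"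
        by (simp add: linear_scale[OF lin] power2_eq_square)
      then show ?thesis using False by (simp add: pos_divide_le_eq)
    qed (simp add: linear_0[OF lin])
  qed
qed

text \<open>Along the segment from \<open>z\<close> to \<open>z + h\<close> the gradient at \<open>z + t h\<close> is \<open>t A h\<close> up to an error
  \<open>(\<alpha> / 2) t \<bar>h\<bar>\<close>, because the gradient vanishes at the maximum. Hence the slope lies between
  \<open>- 2 C t \<bar>h\<bar>\<^sup>2\<close> and \<open>- 2 c t \<bar>h\<bar>\<^sup>2\<close>, and adding the matching parabola in \<open>t\<close> yields monotone functions
  on \<open>[0, 1]\<close>.\<close>

lemma quadratic_maximum:
  fixes f :: "real \<times> real \<Rightarrow> real"
  assumes hess: "negative_definite_hessian_at f z" and max: "\<And>p. f p \<le> f z"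
  obtains r c C where "r > 0" "c > 0" "C > 0"
    "\<And>h. norm h < r \<Longrightarrow> c * (norm h)\<^sup>2 \<le> f z - f (z + h)"
    "\<And>h. norm h < r \<Longrightarrow> f z - f (z + h) \<le> C * (norm h)\<^sup>2"
proof -
  obtain g A where ev: "\<forall>\<^sub>F p in nhds z. (f has_derivative (\<lambda>h. g p \<bullet> h)) (at p)"
    and gA: "(g has_derivative A) (at z)" and neg: "\<And>h. h \<noteq> 0 \<Longrightarrow> A h \<bullet> h < 0"
    using hess unfolding negative_definite_hessian_at_def by blast
  have A: "bounded_linear A" using gA by (rule has_derivative_bounded_linear)
  have lin: "linear A" using A bounded_linear.linear by blast
  obtain \<alpha> where \<alpha>: "\<alpha> > 0" "\<And>h. A h \<bullet> h \<le> - \<alpha> * (norm h)\<^sup>2"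
    using negative_definite_bound[OF A neg] by blast
  obtain \<beta> where \<beta>: "\<beta> > 0" "\<And>h. norm (A h) \<le> \<beta> * norm h" using linear_bounded_pos[OF lin] by blast
  have "(f has_derivative (\<lambda>h. g z \<bullet> h)) (at z)" using eventually_nhds_x_imp_x[OF ev] .
  then have "(\<lambda>h. g z \<bullet> h) = (\<lambda>_. 0)"
    using max by (intro differential_zero_maxmin[of z UNIV f]) auto
  then have gz: "g z = 0" by (metis inner_eq_zero_iff)
  obtain r1 where r1: "r1 > 0" "\<And>p. dist p z < r1 \<Longrightarrow> (f has_derivative (\<lambda>h. g p \<bullet> h)) (at p)"
    using ev unfolding eventually_nhds_metric by blast
  have "\<alpha> / 2 > 0" using \<alpha>(1) by simp
  then obtain r2 where r2: "r2 > 0"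
    "\<And>y. norm (y - z) < r2 \<Longrightarrow> norm (g y - g z - A (y - z)) \<le> \<alpha> / 2 * norm (y - z)"
    using gA unfolding has_derivative_at_alt by blast
  define r where "r = min r1 r2"
  define c where "c = \<alpha> / 4"
  define C where "C = (\<beta> + \<alpha> / 2) / 2"
  have slope: "- (2 * C) * t * (norm h)\<^sup>2 \<le> g (z + t *\<^sub>R h) \<bullet> h" "g (z + t *\<^sub>R h) \<bullet> h \<le> - (2 * c) * t * (norm h)\<^sup>2"
    and diff: "((\<lambda>t. f (z + t *\<^sub>R h)) has_real_derivative g (z + t *\<^sub>R h) \<bullet> h) (at t)"
    if h: "norm h < r" and t: "0 \<le> t" "t \<le> 1" for h t
  proof -
    have "t * norm h \<le> 1 * norm h" using t by (intro mult_right_mono) auto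
    then have n: "norm (t *\<^sub>R h) < r" using h t by simp
    have Lin: "A (t *\<^sub>R h) \<bullet> h = t * (A h \<bullet> h)" by (simp add: linear_scale[OF lin])
    have "norm (g (z + t *\<^sub>R h) - A (t *\<^sub>R h)) \<le> \<alpha> / 2 * (t * norm h)"
      using r2(2)[of "z + t *\<^sub>R h"] n t by (simp add: r_def gz)
    then have "\<bar>(g (z + t *\<^sub>R h) - A (t *\<^sub>R h)) \<bullet> h\<bar> \<le> \<alpha> / 2 * (t * norm h) * norm h"
      by (intro order.trans[OF Cauchy_Schwarz_ineq2] mult_right_mono) auto
    then have err: "\<bar>g (z + t *\<^sub>R h) \<bullet> h - t * (A h \<bullet> h)\<bar> \<le> \<alpha> / 2 * t * (norm h)\<^sup>2"
      by (simp add: inner_diff_left Lin power2_eq_square mult.assoc)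
    have "\<bar>A h \<bullet> h\<bar> \<le> \<beta> * norm h * norm h"
      by (intro order.trans[OF Cauchy_Schwarz_ineq2] mult_right_mono \<beta>) auto
    then have "- \<beta> * (norm h)\<^sup>2 \<le> A h \<bullet> h" by (simp add: power2_eq_square abs_le_iff)
    then have lo: "t * (- \<beta> * (norm h)\<^sup>2) \<le> t * (A h \<bullet> h)" using t by (intro mult_left_mono) auto
    have hi: "t * (A h \<bullet> h) \<le> t * (- \<alpha> * (norm h)\<^sup>2)" using \<alpha>(2) t by (intro mult_left_mono) auto
    show "- (2 * C) * t * (norm h)\<^sup>2 \<le> g (z + t *\<^sub>R h) \<bullet> h"
    proof -
      have "- (2 * C) * t * (norm h)\<^sup>2 = t * (- \<beta> * (norm h)\<^sup>2) - \<alpha> / 2 * t * (norm h)\<^sup>2"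
        by (simp add: C_def field_simps)
      then show ?thesis using err lo by linarith
    qed
    show "g (z + t *\<^sub>R h) \<bullet> h \<le> - (2 * c) * t * (norm h)\<^sup>2"
    proof -
      have "- (2 * c) * t * (norm h)\<^sup>2 = t * (- \<alpha> * (norm h)\<^sup>2) + \<alpha> / 2 * t * (norm h)\<^sup>2"
        by (simp add: c_def field_simps)
      then show ?thesis using err hi by linarith
    qed
    have fd: "(f has_derivative (\<lambda>v. g (z + t *\<^sub>R h) \<bullet> v)) (at (z + t *\<^sub>R h))"
      using n by (intro r1(2)) (simp add: r_def dist_norm)
    have "((\<lambda>t. z + t *\<^sub>R h) has_derivative (\<lambda>s. s *\<^sub>R h)) (at t)"
      by (auto intro!: derivative_eq_intros)
    from has_derivative_compose[OF this fd]
    show "((\<lambda>t. f (z + t *\<^sub>R h)) has_real_derivative g (z + t *\<^sub>R h) \<bullet> h) (at t)"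
      by (simp add: has_field_derivative_def mult_commute_abs)
  qed
  show ?thesis
  proof (rule that[of r c C])
    show "r > 0" "c > 0" "C > 0" using r1 r2 \<alpha> \<beta> by (auto simp: r_def c_def C_def)
    fix h :: "real \<times> real" assume h: "norm h < r"
    have "f (z + 1 *\<^sub>R h) + c * 1\<^sup>2 * (norm h)\<^sup>2 \<le> f (z + 0 *\<^sub>R h) + c * 0\<^sup>2 * (norm h)\<^sup>2"
    proof (rule DERIV_nonpos_imp_nonincreasing[of 0 1 "\<lambda>t. f (z + t *\<^sub>R h) + c * t\<^sup>2 * (norm h)\<^sup>2"])
      fix t :: real assume t: "0 \<le> t" "t \<le> 1"
      have "((\<lambda>t. f (z + t *\<^sub>R h) + c * t\<^sup>2 * (norm h)\<^sup>2) has_real_derivative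
          g (z + t *\<^sub>R h) \<bullet> h + 2 * c * t * (norm h)\<^sup>2) (at t)"
        using diff[OF h t] by (auto intro!: derivative_eq_intros)
      moreover have "g (z + t *\<^sub>R h) \<bullet> h + 2 * c * t * (norm h)\<^sup>2 \<le> 0" using slope(2)[OF h t] by simp
      ultimately show "\<exists>y. ((\<lambda>t. f (z + t *\<^sub>R h) + c * t\<^sup>2 * (norm h)\<^sup>2) has_real_derivative y) (at t) \<and> y \<le> 0" by blast
    qed simp
    then show "c * (norm h)\<^sup>2 \<le> f z - f (z + h)" by simp
    have "f (z + 0 *\<^sub>R h) + C * 0\<^sup>2 * (norm h)\<^sup>2 \<le> f (z + 1 *\<^sub>R h) + C * 1\<^sup>2 * (norm h)\<^sup>2"
    proof (rule DERIV_nonneg_imp_nondecreasing[of 0 1 "\<lambda>t. f (z + t *\<^sub>R h) + C * t\<^sup>2 * (norm h)\<^sup>2"])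
      fix t :: real assume t: "0 \<le> t" "t \<le> 1"
      have "((\<lambda>t. f (z + t *\<^sub>R h) + C * t\<^sup>2 * (norm h)\<^sup>2) has_real_derivative
          g (z + t *\<^sub>R h) \<bullet> h + 2 * C * t * (norm h)\<^sup>2) (at t)"
        using diff[OF h t] by (auto intro!: derivative_eq_intros)
      moreover have "0 \<le> g (z + t *\<^sub>R h) \<bullet> h + 2 * C * t * (norm h)\<^sup>2" using slope(1)[OF h t] by simp
      ultimately show "\<exists>y. ((\<lambda>t. f (z + t *\<^sub>R h) + C * t\<^sup>2 * (norm h)\<^sup>2) has_real_derivative y) (at t) \<and> 0 \<le> y" by blast
    qed simp
    then show "f z - f (z + h) \<le> C * (norm h)\<^sup>2" by simp
  qed
qed

text \<open>What the spectral analysis uses of the nondegenerate maximum: the weights are dominated by the gap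
  \<open>m - e\<close> (so their resolvent averages stay finite at the threshold), and the inverse gap itself is
  not integrable.\<close>

locale threshold_dispersion = torus_dispersion +
  assumes weight_sq_bound: "\<And>\<omega>. \<exists>K. \<forall>p. (weight \<omega> p)\<^sup>2 \<le> K * (m - e p)"
    and weight_ES_bound: "\<exists>K. \<forall>p. weight ES p \<le> K * (m - e p)"
    and not_integrable_threshold: "\<not> integrable torus_measure (\<lambda>q. 1 / (m - e q))"

text \<open>The four corners of the torus represent the same point. Shifting to the square \<open>[0, 2 pi]\<^sup>2\<close> makes
  the maximum an interior point: near it the quadratic bounds apply, and on the rest of that compact
  square the gap has a positive minimum.\<close>

lemma periodic_domination:
  fixes e \<phi> :: "real \<times> real \<Rightarrow> real"
  assumes cont: "continuous_on UNIV e"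
    and per: "\<And>p j k. e (fst p + 2 * pi * of_int j, snd p + 2 * pi * of_int k) = e p"
    and per': "\<And>p j k. \<phi> (fst p + 2 * pi * of_int j, snd p + 2 * pi * of_int k) = \<phi> p"
    and less: "\<And>p. p \<in> torus \<Longrightarrow> p \<noteq> (pi, pi) \<Longrightarrow> e p < e (pi, pi)"
    and "c > 0" "r > 0" and low: "\<And>h. norm h < r \<Longrightarrow> c * (norm h)\<^sup>2 \<le> e (pi, pi) - e ((pi, pi) + h)"
    and "D \<ge> 0" and \<phi>: "\<And>h. \<phi> ((pi, pi) + h) \<le> D * (norm h)\<^sup>2"
    and "B \<ge> 0" and B: "\<And>p. \<phi> p \<le> B"
  shows "\<exists>K. \<forall>p. \<phi> p \<le> K * (e (pi, pi) - e p)"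
proof -
  define S where "S = cbox (0, 0) (2 * pi, 2 * pi) - ball (pi, pi) r"
  have le: "e p \<le> e (pi, pi)" and eqD: "e p = e (pi, pi) \<Longrightarrow>
      \<exists>j k. p = (pi + 2 * pi * of_int j, pi + 2 * pi * of_int k)" for p
  proof -
    obtain j where j: "- pi < fst p + 2 * pi * of_int j" "fst p + 2 * pi * of_int j \<le> pi" by (rule angle_representative)
    obtain k where k: "- pi < snd p + 2 * pi * of_int k" "snd p + 2 * pi * of_int k \<le> pi" by (rule angle_representative)
    define q where "q = (fst p + 2 * pi * of_int j, snd p + 2 * pi * of_int k)"
    have q: "q \<in> torus" "e q = e p" using j k per by (auto simp: q_def torus_def)
    show "e p \<le> e (pi, pi)" using less[OF q(1)] q(2) by (cases "q = (pi, pi)") auto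
    assume "e p = e (pi, pi)"
    then have "q = (pi, pi)" using less[OF q(1)] q(2) by force
    then have "fst p = pi + 2 * pi * of_int (- j)" "snd p = pi + 2 * pi * of_int (- k)"
      by (simp_all add: q_def algebra_simps)
    then show "\<exists>j k. p = (pi + 2 * pi * of_int j, pi + 2 * pi * of_int k)" by (metis prod.collapse)
  qed
  have lessS: "e p < e (pi, pi)" if "p \<in> S" for p
  proof (rule ccontr)
    assume "\<not> e p < e (pi, pi)"
    then obtain j k :: int where p: "p = (pi + 2 * pi * of_int j, pi + 2 * pi * of_int k)"
      using le[of p] eqD[of p] by force
    have "0 = j" if "0 \<le> pi + 2 * pi * of_int j" "pi + 2 * pi * of_int j \<le> 2 * pi" for j :: int
    proof -
      have "pi * (- 1) \<le> pi * (2 * of_int j)" "pi * (2 * of_int j) \<le> pi * 1" using that by (simp_all add: algebra_simps)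
      then have "- 1 \<le> 2 * real_of_int j" "2 * real_of_int j \<le> 1"
        by (simp_all only: mult_le_cancel_left_pos[OF pi_gt_zero])
      then show ?thesis by linarith
    qed
    then have "p = (pi, pi)" using \<open>p \<in> S\<close> by (auto simp: p S_def cbox_Pair_eq)
    then show False using \<open>p \<in> S\<close> \<open>r > 0\<close> by (simp add: S_def)
  qed
  have "compact S" unfolding S_def by (intro compact_diff compact_cbox open_ball)
  have "\<exists>d>0. \<forall>p\<in>S. d \<le> e (pi, pi) - e p"
  proof (cases "S = {}")
    case False
    have "continuous_on S (\<lambda>p. e (pi, pi) - e p)" using cont by (intro continuous_intros continuous_on_subset[OF cont]) auto
    then obtain p\<^sub>0 where "p\<^sub>0 \<in> S" "\<forall>p\<in>S. e (pi, pi) - e p\<^sub>0 \<le> e (pi, pi) - e p"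
      using continuous_attains_inf[OF \<open>compact S\<close> False] by blast
    then show ?thesis using lessS[of p\<^sub>0] by (intro exI[of _ "e (pi, pi) - e p\<^sub>0"]) auto
  qed (auto intro: exI[of _ 1])
  then obtain d where d: "d > 0" "\<And>p. p \<in> S \<Longrightarrow> d \<le> e (pi, pi) - e p" by blast
  define K where "K = D / c + B / d"
  show ?thesis
  proof (intro exI[of _ K] allI)
    fix p :: "real \<times> real"
    obtain j where j: "- pi < (fst p - pi) + 2 * pi * of_int j" "(fst p - pi) + 2 * pi * of_int j \<le> pi" by (rule angle_representative)
    obtain k where k: "- pi < (snd p - pi) + 2 * pi * of_int k" "(snd p - pi) + 2 * pi * of_int k \<le> pi" by (rule angle_representative)
    define q where "q = (fst p + 2 * pi * of_int j, snd p + 2 * pi * of_int k)"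
    have q: "q \<in> cbox (0, 0) (2 * pi, 2 * pi)" "e q = e p" "\<phi> q = \<phi> p"
      using j k per per' by (auto simp: q_def cbox_Pair_eq)
    have nn: "0 \<le> e (pi, pi) - e q" using le[of q] by simp
    have "\<phi> q \<le> K * (e (pi, pi) - e q)"
    proof (cases "q \<in> S")
      case True
      have "\<phi> q \<le> B / d * d" using B d(1) by simp
      also have "\<dots> \<le> B / d * (e (pi, pi) - e q)" using d True \<open>B \<ge> 0\<close> by (intro mult_left_mono) auto
      also have "\<dots> \<le> K * (e (pi, pi) - e q)" using nn \<open>D \<ge> 0\<close> \<open>c > 0\<close> by (intro mult_right_mono) (auto simp: K_def)
      finally show ?thesis .
    next
      case False
      define h where "h = q - (pi, pi)"
      have h: "norm h < r" "q = (pi, pi) + h" using False q(1) by (auto simp: S_def h_def dist_norm norm_minus_commute)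
      have "\<phi> q \<le> D / c * (c * (norm h)\<^sup>2)" using \<phi>[of h] h(2) \<open>c > 0\<close> by simp
      also have "\<dots> \<le> D / c * (e (pi, pi) - e q)"
        unfolding h(2) using low[OF h(1)] \<open>D \<ge> 0\<close> \<open>c > 0\<close> by (intro mult_left_mono) auto
      also have "\<dots> \<le> K * (e (pi, pi) - e q)" using nn \<open>B \<ge> 0\<close> d(1) by (intro mult_right_mono) (auto simp: K_def)
      finally show ?thesis .
    qed
    then show "\<phi> p \<le> K * (e (pi, pi) - e p)" using q by simp
  qed
qed

lemma one_minus_cos_le: "1 - cos x \<le> x\<^sup>2 / 2" for x :: real
proof -
  have "1 - cos x = 2 * (sin (x / 2))\<^sup>2" using cos_double_sin[of "x / 2"] by simp
  also have "(sin (x / 2))\<^sup>2 \<le> (x / 2)\<^sup>2" using abs_sin_x_le_abs_x[of "x / 2"] by (simp only: abs_le_square_iff)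
  finally show ?thesis by (simp add: power2_eq_square)
qed

lemma weight_periodic: "weight \<omega> (fst p + 2 * pi * of_int j, snd p + 2 * pi * of_int k) = weight \<omega> p"
proof -
  have "sin (x + 2 * pi * of_int n) = sin x" "cos (x + 2 * pi * of_int n) = cos x" for x and n :: int
    by (simp_all add: sin_add cos_add)
  then show ?thesis by (cases \<omega>) auto
qed

lemma weight_ES_near_corner: "weight ES ((pi, pi) + h) \<le> 1 * (norm h)\<^sup>2"
proof -
  have "weight ES ((pi, pi) + h) = (1 - cos (fst h)) + (1 - cos (snd h))" by (simp add: cos_add)
  also have "\<dots> \<le> (fst h)\<^sup>2 / 2 + (snd h)\<^sup>2 / 2" using one_minus_cos_le add_mono by blast
  also have "\<dots> \<le> (fst h)\<^sup>2 + (snd h)\<^sup>2"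
    using zero_le_power2[of "fst h"] zero_le_power2[of "snd h"] by linarith
  also have "\<dots> = (norm h)\<^sup>2" by (simp add: norm_prod_def)
  finally show ?thesis by simp
qed

lemma weight_ES_range: "0 \<le> weight ES p" "weight ES p \<le> 4"
  using cos_ge_minus_one[of "fst p"] cos_ge_minus_one[of "snd p"] cos_le_one[of "fst p"] cos_le_one[of "snd p"]
  by (simp_all only: weight.simps)

lemma weight_near_corner:
  assumes "\<omega> \<noteq> ES" shows "(weight \<omega> ((pi, pi) + h))\<^sup>2 \<le> 2 * (norm h)\<^sup>2"
proof -
  have cosdiff: "\<bar>cos x - cos y\<bar> \<le> \<bar>x\<bar> + \<bar>y\<bar>" for x y :: real
  proof -
    have "cos x - cos y = 2 * sin ((x + y) / 2) * sin ((y - x) / 2)" by (rule cos_diff_cos)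
    then have "\<bar>cos x - cos y\<bar> = 2 * \<bar>sin ((x + y) / 2)\<bar> * \<bar>sin ((y - x) / 2)\<bar>" by (simp add: abs_mult)
    also have "\<dots> \<le> 2 * 1 * \<bar>(y - x) / 2\<bar>" by (intro mult_mono abs_sin_x_le_abs_x) auto
    finally show ?thesis by simp
  qed
  have "\<bar>weight \<omega> ((pi, pi) + h)\<bar> \<le> \<bar>fst h\<bar> + \<bar>snd h\<bar>"
    using abs_sin_x_le_abs_x[of "fst h"] abs_sin_x_le_abs_x[of "snd h"] cosdiff[of "snd h" "fst h"] assms
    by (cases \<omega>) (simp_all add: sin_add cos_add; arith)+
  then have "(weight \<omega> ((pi, pi) + h))\<^sup>2 \<le> (\<bar>fst h\<bar> + \<bar>snd h\<bar>)\<^sup>2"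
    by (metis abs_ge_zero abs_of_nonneg add_nonneg_nonneg abs_le_square_iff)
  also have "\<dots> \<le> 2 * ((fst h)\<^sup>2 + (snd h)\<^sup>2)"
    using zero_le_power2[of "\<bar>fst h\<bar> - \<bar>snd h\<bar>"] by (simp add: power2_sum power2_diff)
  also have "\<dots> = 2 * (norm h)\<^sup>2" by (simp add: norm_prod_def)
  finally show ?thesis .
qed

lemma weight_sq_le: "(weight \<omega> p)\<^sup>2 \<le> 16"
proof -
  have "\<bar>weight \<omega> p\<bar> \<le> \<bar>4\<bar>"
    using abs_sin_le_one[of "fst p"] abs_sin_le_one[of "snd p"] abs_cos_le_one[of "fst p"] abs_cos_le_one[of "snd p"]
    by (cases \<omega>) (simp_all del: abs_sin_le_one abs_cos_le_one; arith)+
  then show ?thesis unfolding abs_le_square_iff by simp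
qed

text \<open>A scaling argument replaces the logarithmic divergence. On the square \<open>Q n\<close> of side \<open>s n\<close> at the corner
  the function \<open>1 / (m - e)\<close> is at least \<open>1 / (2 C s\<^sup>2)\<close>, so its integral over \<open>Q n\<close> is at least \<open>1 / (2 C)\<close>,
  although these integrals would tend to zero with the size of the square if the function were
  integrable.\<close>

lemma not_integrable_inverse_gap:
  fixes e :: "real \<times> real \<Rightarrow> real"
  assumes cont: "continuous_on UNIV e" and less: "\<And>p. p \<in> open_square \<Longrightarrow> e p < m"
    and "r > 0" "C > 0" and up: "\<And>h. norm h < r \<Longrightarrow> m - e ((pi, pi) + h) \<le> C * (norm h)\<^sup>2"
  shows "\<not> integrable torus_measure (\<lambda>q. 1 / (m - e q))"
proof
  assume int: "integrable torus_measure (\<lambda>q. 1 / (m - e q))"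
  define s\<^sub>0 where "s\<^sub>0 = min (r / 2) pi"
  define s where "s = (\<lambda>n. s\<^sub>0 / real (Suc n))"
  define Q where "Q = (\<lambda>n. {pi - s n<..<pi} \<times> {pi - s n<..<pi})"
  have s\<^sub>0: "s\<^sub>0 > 0" "s\<^sub>0 \<le> r / 2" "s\<^sub>0 \<le> pi" using \<open>r > 0\<close> by (auto simp: s\<^sub>0_def)
  have s: "0 < s n" "s n \<le> s\<^sub>0" for n
    using s\<^sub>0(1) by (auto simp: s_def divide_le_eq mult_le_cancel_left1)
  have s_lim: "s \<longlonglongrightarrow> 0"
    using tendsto_mult_left[OF lim_inverse_n'[THEN LIMSEQ_Suc], of s\<^sub>0] by (simp add: s_def[abs_def])
  have Qsub: "Q n \<subseteq> open_square" for n
  proof -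
    have "- pi < pi - s n" using s(2)[of n] s\<^sub>0(3) pi_gt_zero by linarith
    then show ?thesis by (auto simp: Q_def)
  qed
  have Qopen: "open (Q n)" for n unfolding Q_def by (intro open_Times) auto
  have measQ: "measure torus_measure (Q n) = s n * s n" for n
  proof -
    have "Q n \<subseteq> torus" using Qsub[of n] by (auto simp: torus_def)
    then have "emeasure torus_measure (Q n) = emeasure lborel (Q n)"
      unfolding torus_measure_def by (intro emeasure_restrict_space) auto
    also have "\<dots> = emeasure (lborel \<Otimes>\<^sub>M lborel) (Q n)" by (simp add: lborel_prod)
    also have "\<dots> = ennreal (s n) * ennreal (s n)"
      unfolding Q_def using s(1)[of n] by (subst lborel.emeasure_pair_measure_Times) auto
    finally show ?thesis using s(1)[of n] by (simp add: measure_def ennreal_mult[symmetric])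
  qed
  have Qsets: "Q n \<in> sets torus_measure" for n
  proof -
    have "Q n \<subseteq> torus" using Qsub[of n] by (auto simp: torus_def)
    then show ?thesis using Qopen[of n] unfolding torus_measure_def by (subst sets_restrict_space_iff) auto
  qed
  have lower: "1 / (2 * C) \<le> (LINT q|torus_measure. indicator (Q n) q *\<^sub>R (1 / (m - e q)))" for n
  proof -
    have "1 / (2 * C) = (1 / (2 * C * (s n)\<^sup>2)) * measure torus_measure (Q n)"
      using s(1)[of n] by (simp add: measQ power2_eq_square)
    also have "\<dots> = (LINT q|torus_measure. indicator (Q n) q *\<^sub>R (1 / (2 * C * (s n)\<^sup>2)))"
      using Qsets[of n] sets.sets_into_space[OF Qsets[of n]] by (simp add: Int_absorb2)
    also have "\<dots> \<le> (LINT q|torus_measure. indicator (Q n) q *\<^sub>R (1 / (m - e q)))"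
    proof (rule integral_mono)
      show "integrable torus_measure (\<lambda>q. indicator (Q n) q *\<^sub>R (1 / (m - e q)))"
        using int Qsets[of n] by (rule integrable_mult_indicator[rotated])
      show "integrable torus_measure (\<lambda>q. indicator (Q n) q *\<^sub>R (1 / (2 * C * (s n)\<^sup>2)))"
        using Qsets[of n] by (intro integrable_mult_indicator integrable_torus_continuous) auto
      fix q
      show "indicator (Q n) q *\<^sub>R (1 / (2 * C * (s n)\<^sup>2)) \<le> indicator (Q n) q *\<^sub>R (1 / (m - e q))"
      proof (cases "q \<in> Q n")
        case True
        define h where "h = q - (pi, pi)"
        have h: "\<bar>fst h\<bar> \<le> s n" "\<bar>snd h\<bar> \<le> s n" using True by (auto simp: Q_def h_def)
        have "(norm h)\<^sup>2 = (fst h)\<^sup>2 + (snd h)\<^sup>2" by (simp add: norm_prod_def)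
        also have "\<dots> \<le> (s n)\<^sup>2 + (s n)\<^sup>2" using h s(1)[of n] by (intro add_mono) (auto simp flip: abs_le_square_iff)
        finally have n2: "(norm h)\<^sup>2 \<le> 2 * (s n)\<^sup>2" by simp
        also have "\<dots> \<le> 2 * (r / 2)\<^sup>2" using s[of n] s\<^sub>0 by (intro mult_left_mono power_mono) auto
        also have "\<dots> < r\<^sup>2" using \<open>r > 0\<close> by (simp add: power2_eq_square)
        finally have "norm h < r" using \<open>r > 0\<close> by (metis norm_ge_zero power_less_imp_less_base less_imp_le)
        from up[OF this] have "m - e q \<le> C * (norm h)\<^sup>2" by (simp add: h_def)
        also have "\<dots> \<le> C * (2 * (s n)\<^sup>2)" using n2 \<open>C > 0\<close> by (intro mult_left_mono) auto
        finally have "m - e q \<le> 2 * C * (s n)\<^sup>2" by simp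
        moreover have "0 < m - e q" using less Qsub[of n] True by force
        ultimately have "1 / (2 * C * (s n)\<^sup>2) \<le> 1 / (m - e q)" by (intro divide_left_mono) auto
        then show ?thesis using True by simp
      qed simp
    qed
    finally show ?thesis .
  qed
  have "(\<lambda>n. LINT q|torus_measure. indicator (Q n) q *\<^sub>R (1 / (m - e q))) \<longlonglongrightarrow> (LINT q|torus_measure. 0)"
  proof (rule integral_dominated_convergence[where w = "\<lambda>q. norm (1 / (m - e q))"])
    show "integrable torus_measure (\<lambda>q. norm (1 / (m - e q)))" using int by (rule integrable_norm)
    show "(\<lambda>q. indicator (Q n) q *\<^sub>R (1 / (m - e q))) \<in> borel_measurable torus_measure" for n
      using int Qsets[of n] by (intro borel_measurable_scaleR borel_measurable_indicator) auto
    show "AE q in torus_measure. (\<lambda>n. indicator (Q n) q *\<^sub>R (1 / (m - e q))) \<longlonglongrightarrow> 0"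
    proof (rule AE_I2)
      fix q :: "real \<times> real"
      have "\<forall>\<^sub>F n in sequentially. q \<notin> Q n"
      proof (cases "fst q < pi")
        case True
        then have "\<forall>\<^sub>F n in sequentially. s n < pi - fst q" using order_tendstoD(2)[OF s_lim] by simp
        then show ?thesis by eventually_elim (auto simp: Q_def)
      next
        case False
        then show ?thesis by (intro always_eventually) (auto simp: Q_def)
      qed
      then have "\<forall>\<^sub>F n in sequentially. indicator (Q n) q *\<^sub>R (1 / (m - e q)) = 0" by eventually_elim simp
      then show "(\<lambda>n. indicator (Q n) q *\<^sub>R (1 / (m - e q))) \<longlonglongrightarrow> 0" by (rule tendsto_eventually)
    qed
    show "AE q in torus_measure. norm (indicator (Q n) q *\<^sub>R (1 / (m - e q))) \<le> norm (1 / (m - e q))" for n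
      by (rule AE_I2) (auto simp: indicator_def)
  qed auto
  then have "1 / (2 * C) \<le> 0" using lower by (intro LIMSEQ_le_const) auto
  then show False using \<open>C > 0\<close> by simp
qed

lemma threshold_dispersion_if_nondegenerate_maximum:
  fixes ehat :: "int \<times> int \<Rightarrow> complex" and e :: "real \<times> real \<Rightarrow> real"
  assumes l1: "(\<lambda>x. cmod (ehat x)) summable_on UNIV"
    and fourier: "\<And>p. complex_of_real (e p) = fourier_sum ehat p"
    and even: "\<And>p. e (- p) = e p" and sym: "\<And>p1 p2. e (p1, p2) = e (p2, p1)"
    and less: "\<And>p. p \<in> torus \<Longrightarrow> p \<noteq> (pi, pi) \<Longrightarrow> e p < e (pi, pi)"
    and hess: "negative_definite_hessian_at e (pi, pi)"
  shows "threshold_dispersion e (e (pi, pi))"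
proof -
  have "continuous_on UNIV (\<lambda>p. Re (fourier_sum ehat p))"
    by (intro continuous_intros continuous_fourier_sum l1)
  then have cont: "continuous_on UNIV e" by (simp flip: fourier)
  have per: "e (fst p + 2 * pi * of_int j, snd p + 2 * pi * of_int k) = e p" for p j k
    using fourier_sum_periodic[of ehat p j k] by (simp only: of_real_eq_iff flip: fourier)
  have le: "e p \<le> e (pi, pi)" for p
  proof -
    obtain j where j: "- pi < fst p + 2 * pi * of_int j" "fst p + 2 * pi * of_int j \<le> pi" by (rule angle_representative)
    obtain k where k: "- pi < snd p + 2 * pi * of_int k" "snd p + 2 * pi * of_int k \<le> pi" by (rule angle_representative)
    define q where "q = (fst p + 2 * pi * of_int j, snd p + 2 * pi * of_int k)"
    have q: "q \<in> torus" "e q = e p" using j k per by (auto simp: q_def torus_def)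
    show "e p \<le> e (pi, pi)" using less[OF q(1)] q(2) by (cases "q = (pi, pi)") auto
  qed
  have less': "e p < e (pi, pi)" if "p \<in> open_square" for p
    using that by (intro less) (auto simp: torus_def)
  obtain r c C where q: "r > 0" "c > 0" "C > 0"
    and low: "\<And>h. norm h < r \<Longrightarrow> c * (norm h)\<^sup>2 \<le> e (pi, pi) - e ((pi, pi) + h)"
    and up: "\<And>h. norm h < r \<Longrightarrow> e (pi, pi) - e ((pi, pi) + h) \<le> C * (norm h)\<^sup>2"
    using quadratic_maximum[OF hess le] by metis
  have ES: "\<exists>K. \<forall>p. weight ES p \<le> K * (e (pi, pi) - e p)"
    by (rule periodic_domination[OF cont per weight_periodic less q(2,1) low _ weight_ES_near_corner _ weight_ES_range(2)]) auto
  have "\<exists>K. \<forall>p. (weight \<omega> p)\<^sup>2 \<le> K * (e (pi, pi) - e p)" for \<omega>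
  proof (cases "\<omega> = ES")
    case False
    show ?thesis
      by (rule periodic_domination[OF cont per _ less q(2,1) low _ weight_near_corner[OF False] _ weight_sq_le])
         (auto simp: weight_periodic)
  next
    case True
    obtain K where K: "\<And>p. weight ES p \<le> K * (e (pi, pi) - e p)" using ES by blast
    have "(weight ES p)\<^sup>2 \<le> 4 * K * (e (pi, pi) - e p)" for p
    proof -
      have "(weight ES p)\<^sup>2 \<le> 4 * weight ES p"
        unfolding power2_eq_square by (intro mult_right_mono weight_ES_range)
      also have "\<dots> \<le> 4 * (K * (e (pi, pi) - e p))" using K[of p] by (intro mult_left_mono) auto
      finally show ?thesis by simp
    qed
    then show ?thesis using True by blast
  qed
  moreover have "\<not> integrable torus_measure (\<lambda>q. 1 / (e (pi, pi) - e q))"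
    by (rule not_integrable_inverse_gap[OF cont less' q(1,3) up])
  ultimately show ?thesis
    using cont le less' even sym ES by unfold_locales (auto simp: prod.swap_def simp del: split_paired_All)
qed

section \<open>The rank-one sectors\<close>

context dispersion
begin

lemma res_tendsto_0: assumes "continuous_on UNIV \<phi>" shows "(res \<phi> \<longlongrightarrow> 0) at_top"
proof (rule tendstoI)
  fix \<epsilon> :: real assume "\<epsilon> > 0"
  then obtain E\<^sub>0 where "\<And>E. E\<^sub>0 \<le> E \<Longrightarrow> \<bar>res \<phi> E\<bar> < \<epsilon>" using res_small[OF assms] by metis
  then show "\<forall>\<^sub>F E in at_top. dist (res \<phi> E) 0 < \<epsilon>" by (auto simp: eventually_at_top_linorder)
qed

text \<open>The engine behind monotonicity and concavity. The difference of the two sides is the average of the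
  square \<open>(\<phi> (E' - e) / (E - e) - \<psi>)\<^sup>2 / (E' - e)\<close>; in other words, \<open>\<phi> / (E - e)\<close> serves as a trial
  function for the variational problem at the energy \<open>E'\<close>, and \<open>\<psi>\<close> plays the role of a dual vector.\<close>

lemma
  assumes \<phi>: "continuous_on UNIV \<phi>" and \<psi>: "continuous_on UNIV \<psi>" and E: "m < E" "m < E'"
  shows trial_inequality:
      "2 * res (\<lambda>q. \<phi> q * \<psi> q) E
        \<le> res (\<lambda>q. (\<phi> q)\<^sup>2) E + (E' - E) * res2 (\<lambda>q. (\<phi> q)\<^sup>2) E + res (\<lambda>q. (\<psi> q)\<^sup>2) E'"
    and trial_inequality_strict: "p \<in> open_square \<Longrightarrow> \<phi> p * (E' - e p) \<noteq> \<psi> p * (E - e p) \<Longrightarrow>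
      2 * res (\<lambda>q. \<phi> q * \<psi> q) E
        < res (\<lambda>q. (\<phi> q)\<^sup>2) E + (E' - E) * res2 (\<lambda>q. (\<phi> q)\<^sup>2) E + res (\<lambda>q. (\<psi> q)\<^sup>2) E'"
proof -
  define f where "f = (\<lambda>q. (\<phi> q * (E' - e q) / (E - e q) - \<psi> q)\<^sup>2 / (E' - e q))"
  have c: "continuous_on UNIV (\<lambda>q. (\<phi> q)\<^sup>2)" "continuous_on UNIV (\<lambda>q. (\<psi> q)\<^sup>2)" "continuous_on UNIV (\<lambda>q. \<phi> q * \<psi> q)"
    by (intro continuous_intros \<phi> \<psi>)+
  have f: "f q = (\<phi> q)\<^sup>2 / (E - e q) + (E' - E) * ((\<phi> q)\<^sup>2 / (E - e q)\<^sup>2) + (\<psi> q)\<^sup>2 / (E' - e q)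
      - 2 * (\<phi> q * \<psi> q / (E - e q))" for q
  proof -
    define x where "x = E - e q"
    define y where "y = E' - e q"
    have xy: "x \<noteq> 0" "y \<noteq> 0" "E' - E = y - x" using gap_ne E by (auto simp: x_def y_def)
    have "(\<phi> q * y / x - \<psi> q)\<^sup>2 / y = (\<phi> q)\<^sup>2 / x + (y - x) * ((\<phi> q)\<^sup>2 / x\<^sup>2) + (\<psi> q)\<^sup>2 / y - 2 * (\<phi> q * \<psi> q / x)"
      using xy(1,2) by (simp add: power2_eq_square field_simps)
    then show ?thesis unfolding f_def xy(3) by (simp only: x_def y_def)
  qed
  have ring: "c * (A + \<Delta> * B + C - 2 * D) = c * A + \<Delta> * (c * B) + c * C - 2 * (c * D)" for c A \<Delta> B C D :: real
    by (simp add: algebra_simps)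
  have eq: "1 / (4 * pi\<^sup>2) * (LINT q|torus_measure. f q)
     = res (\<lambda>q. (\<phi> q)\<^sup>2) E + (E' - E) * res2 (\<lambda>q. (\<phi> q)\<^sup>2) E + res (\<lambda>q. (\<psi> q)\<^sup>2) E' - 2 * res (\<lambda>q. \<phi> q * \<psi> q) E"
    unfolding f res_def res2_def
    using integrable_quotient[OF c(1) E(1)] integrable_quotient[OF c(2) E(2)] integrable_quotient[OF c(3) E(1)]
    by (simp only: Bochner_Integration.integral_add Bochner_Integration.integral_diff Bochner_Integration.integrable_add
        Bochner_Integration.integrable_diff integrable_mult_right integral_mult_right_zero ring)
  have nn: "0 \<le> f q" for q using gap_pos[OF E(2), of q] by (simp add: f_def)
  then have "0 \<le> 1 / (4 * pi\<^sup>2) * (LINT q|torus_measure. f q)" by simp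
  then show "2 * res (\<lambda>q. \<phi> q * \<psi> q) E
        \<le> res (\<lambda>q. (\<phi> q)\<^sup>2) E + (E' - E) * res2 (\<lambda>q. (\<phi> q)\<^sup>2) E + res (\<lambda>q. (\<psi> q)\<^sup>2) E'"
    unfolding eq by simp
  assume p: "p \<in> open_square" "\<phi> p * (E' - e p) \<noteq> \<psi> p * (E - e p)"
  have "continuous_on UNIV f" unfolding f_def using gap_ne E by (auto intro!: continuous_intros e_cont \<phi> \<psi>)
  moreover have "f p \<noteq> 0" using p(2) gap_ne[OF E(1), of p] gap_ne[OF E(2), of p] by (simp add: f_def field_simps)
  ultimately have "0 < (LINT q|torus_measure. f q)" using nn p(1) by (intro integral_torus_pos)
  then have "0 < 1 / (4 * pi\<^sup>2) * (LINT q|torus_measure. f q)" using pi_gt_zero by simp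
  then show "2 * res (\<lambda>q. \<phi> q * \<psi> q) E
        < res (\<lambda>q. (\<phi> q)\<^sup>2) E + (E' - E) * res2 (\<lambda>q. (\<phi> q)\<^sup>2) E + res (\<lambda>q. (\<psi> q)\<^sup>2) E'"
    unfolding eq by simp
qed

end

context threshold_dispersion
begin

text \<open>Strict convexity needs that \<open>e\<close> is not constant where the weight does not vanish. The path
  \<open>t \<mapsto> (pi - t, pi - t / 2)\<close> avoids the zeros of the weights and runs into the maximum, so a constant
  value would have to be \<open>m\<close>, which is not attained inside the square.\<close>

lemma weight_nonzero_gap_varies:
  assumes "\<omega> \<noteq> ES"
  shows "\<exists>p\<in>open_square. weight \<omega> p \<noteq> 0 \<and> e p \<noteq> c"
proof (rule ccontr)
  assume "\<not> ?thesis"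
  then have const: "\<And>p. p \<in> open_square \<Longrightarrow> weight \<omega> p \<noteq> 0 \<Longrightarrow> e p = c" by blast
  define \<gamma> where "\<gamma> = (\<lambda>t::real. (pi - t, pi - t / 2))"
  have \<gamma>: "\<gamma> t \<in> open_square" "weight \<omega> (\<gamma> t) \<noteq> 0" if t: "0 < t" "t < pi / 2" for t
  proof -
    show "\<gamma> t \<in> open_square" using t by (auto simp: \<gamma>_def)
    have "sin (t / 2) < sin t" using t by (intro sin_monotone_2pi) auto
    moreover have "0 < sin (t / 2)" using t by (intro sin_gt_zero) auto
    moreover have "cos t < cos (t / 2)" using t by (intro cos_monotone_0_pi) auto
    ultimately show "weight \<omega> (\<gamma> t) \<noteq> 0" using assms by (cases \<omega>) (auto simp: \<gamma>_def)
  qed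
  have "((\<lambda>t. e (\<gamma> t)) \<longlongrightarrow> e (\<gamma> 0)) (at_right 0)"
  proof -
    have "continuous_on UNIV (\<lambda>t. e (\<gamma> t))" unfolding \<gamma>_def
      by (intro continuous_on_compose2[OF e_cont] continuous_intros) auto
    then have "isCont (\<lambda>t. e (\<gamma> t)) 0" by (simp add: continuous_on_eq_continuous_at)
    then show ?thesis unfolding isCont_def by (rule tendsto_within_subset) simp
  qed
  moreover have "\<forall>\<^sub>F t in at_right 0. e (\<gamma> t) = c"
    using eventually_at_right_less[of 0] eventually_at_right_real[of 0 "pi / 2"]
    by (rule eventually_elim2) (use \<gamma> const in auto)
  then have "((\<lambda>t. e (\<gamma> t)) \<longlongrightarrow> c) (at_right 0)" by (rule tendsto_eventually)
  ultimately have "e (\<gamma> 0) = c" by (rule tendsto_unique[rotated]) simp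
  then have cm: "c = m" using e_corner by (simp add: \<gamma>_def)
  have one: "(1 :: real) < pi / 2" using pi_gt3 by linarith
  note \<gamma>1 = \<gamma>[OF zero_less_one one]
  have "e (\<gamma> 1) = c" "e (\<gamma> 1) < m" by (rule const[OF \<gamma>1] e_less[OF \<gamma>1(1)])+
  then show False using cm by simp
qed

lemma gamma_eq: "gamma e \<omega> = 1 / res (\<lambda>p. (weight \<omega> p)\<^sup>2) m"
  unfolding gamma_def e_max_eq res_def by (simp add: inverse_eq_divide)

lemma weight_sq:
  shows weight_sq_cont: "continuous_on UNIV (\<lambda>p. (weight \<omega> p)\<^sup>2)"
    and res_weight_pos: "m < E \<Longrightarrow> 0 < res (\<lambda>p. (weight \<omega> p)\<^sup>2) E" "m < E \<Longrightarrow> 0 < res2 (\<lambda>p. (weight \<omega> p)\<^sup>2) E"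
    and res_weight_less: "m < E \<Longrightarrow> res (\<lambda>p. (weight \<omega> p)\<^sup>2) E < res (\<lambda>p. (weight \<omega> p)\<^sup>2) m"
    and res_weight_tendsto: "(\<lambda>n. res (\<lambda>p. (weight \<omega> p)\<^sup>2) (approach n)) \<longlonglongrightarrow> res (\<lambda>p. (weight \<omega> p)\<^sup>2) m"
    and res_weight_threshold_pos: "0 < res (\<lambda>p. (weight \<omega> p)\<^sup>2) m"
proof -
  show c: "continuous_on UNIV (\<lambda>p. (weight \<omega> p)\<^sup>2)" by (intro continuous_intros continuous_weight)
  have nz: "(weight \<omega> (pi / 2, pi / 6))\<^sup>2 \<noteq> 0" using weight_nonzero by simp
  note wn = weight_nonzero(1)
  show pos: "0 < res (\<lambda>p. (weight \<omega> p)\<^sup>2) E" "0 < res2 (\<lambda>p. (weight \<omega> p)\<^sup>2) E" if "m < E" for E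
    using res_pos[OF c that _ wn nz] by auto
  obtain K where K: "\<And>p. (weight \<omega> p)\<^sup>2 \<le> K * (m - e p)" using weight_sq_bound by blast
  show less: "res (\<lambda>p. (weight \<omega> p)\<^sup>2) E < res (\<lambda>p. (weight \<omega> p)\<^sup>2) m" if "m < E" for E
    using res_less_threshold[OF c _ K wn nz that] by auto
  show "(\<lambda>n. res (\<lambda>p. (weight \<omega> p)\<^sup>2) (approach n)) \<longlonglongrightarrow> res (\<lambda>p. (weight \<omega> p)\<^sup>2) m"
    using res_tendsto_threshold[OF c _ K] by auto
  show "0 < res (\<lambda>p. (weight \<omega> p)\<^sup>2) m"
    using pos(1)[of "m + 1"] less[of "m + 1"] by simp
qed

lemma rank_one_no_eigenvalues:
  assumes "\<omega> \<noteq> ES" and "(b < 0 \<and> \<mu> > 0) \<or> (b > 0 \<and> \<mu> \<in> {0<..mu0 e a b \<omega>})"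
  shows "eigenvalues_above e a b \<mu> \<omega> = {}"
proof -
  have "\<mu> * b * res (\<lambda>p. (weight \<omega> p)\<^sup>2) E \<noteq> 1" if E: "m < E" for E
    using assms(2)
  proof
    assume "b < 0 \<and> \<mu> > 0"
    then have "\<mu> * b < 0" by (simp add: mult_pos_neg)
    then have "\<mu> * b * res (\<lambda>p. (weight \<omega> p)\<^sup>2) E < 0" by (rule mult_neg_pos[OF _ res_weight_pos(1)[OF E]])
    then show ?thesis by linarith
  next
    assume b: "b > 0 \<and> \<mu> \<in> {0<..mu0 e a b \<omega>}"
    then have "\<mu> * b * res (\<lambda>p. (weight \<omega> p)\<^sup>2) E < \<mu> * b * res (\<lambda>p. (weight \<omega> p)\<^sup>2) m"
      using res_weight_less[OF E] by (intro mult_strict_left_mono) auto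
    also have "\<dots> \<le> mu0 e a b \<omega> * b * res (\<lambda>p. (weight \<omega> p)\<^sup>2) m"
      using b res_weight_threshold_pos by (intro mult_right_mono) (auto simp: less_imp_le)
    also have "\<dots> = 1"
      using b assms(1) res_weight_threshold_pos[of \<omega>] by (simp add: mu0_def gamma_eq)
    finally show ?thesis by simp
  qed
  then show ?thesis unfolding eigenvalues_rank_one[OF assms(1)] by auto
qed

text \<open>The trial inequality with \<open>\<phi> = w\<close> and \<open>\<psi> = s w\<close>; the factor \<open>s = F E / F E'\<close> is the optimal one. Equality
  would force \<open>(E' - e) / (E - e)\<close> to be constant where \<open>w\<close> does not vanish.\<close>

lemma rank_one_supergradient:
  assumes \<omega>: "\<omega> \<noteq> ES" and E: "m < E" "m < E'" "E' \<noteq> E" and b: "b > 0"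
  defines "F \<equiv> res (\<lambda>p. (weight \<omega> p)\<^sup>2)"
  shows "1 / (b * F E') < 1 / (b * F E) + res2 (\<lambda>p. (weight \<omega> p)\<^sup>2) E / (b * (F E)\<^sup>2) * (E' - E)"
proof -
  define G where "G = res2 (\<lambda>p. (weight \<omega> p)\<^sup>2) E"
  have F: "F E > 0" "F E' > 0" using res_weight_pos E by (auto simp: F_def)
  define s where "s = F E / F E'"
  have s: "s > 0" using F by (simp add: s_def)
  \<comment> \<open>The excluded value is the solution \<open>e p\<close> of \<open>E' - e p = s (E - e p)\<close>; for \<open>s = 1\<close> there is none.\<close>
  obtain p where p: "p \<in> open_square" "weight \<omega> p \<noteq> 0" "e p \<noteq> (if s = 1 then m else (E' - s * E) / (1 - s))"
    using weight_nonzero_gap_varies[OF \<omega>] by blast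
  have ne: "weight \<omega> p * (E' - e p) \<noteq> s * weight \<omega> p * (E - e p)"
  proof
    assume "weight \<omega> p * (E' - e p) = s * weight \<omega> p * (E - e p)"
    then have eq: "E' - e p = s * (E - e p)" using p(2) by simp
    then have "e p * (1 - s) = E' - s * E" by (simp add: algebra_simps)
    moreover have "s \<noteq> 1" using eq E(3) by auto
    ultimately show False using p(3) by (simp add: eq_divide_eq)
  qed
  have lin: "res (\<lambda>q. s * (weight \<omega> q)\<^sup>2) E = s * F E" "res (\<lambda>q. s\<^sup>2 * (weight \<omega> q)\<^sup>2) E' = s\<^sup>2 * F E'"
    using res_linear(1)[OF weight_sq_cont weight_sq_cont E(1), of s \<omega> 0 \<omega>]
      res_linear(1)[OF weight_sq_cont weight_sq_cont E(2), of "s\<^sup>2" \<omega> 0 \<omega>] by (simp_all add: F_def)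
  have "2 * res (\<lambda>q. weight \<omega> q * (s * weight \<omega> q)) E
      < F E + (E' - E) * G + res (\<lambda>q. (s * weight \<omega> q)\<^sup>2) E'"
    unfolding F_def G_def using ne
    by (intro trial_inequality_strict[OF continuous_weight _ E(1,2) p(1)] continuous_intros continuous_weight)
  moreover have "(\<lambda>q. weight \<omega> q * (s * weight \<omega> q)) = (\<lambda>q. s * (weight \<omega> q)\<^sup>2)"
    "(\<lambda>q. (s * weight \<omega> q)\<^sup>2) = (\<lambda>q. s\<^sup>2 * (weight \<omega> q)\<^sup>2)"
    by (auto simp: power2_eq_square)
  ultimately have "2 * (s * F E) < F E + (E' - E) * G + s\<^sup>2 * F E'"
    by (simp only: lin)
  moreover have "s\<^sup>2 * F E' = s * F E" using F by (simp add: s_def power2_eq_square)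
  ultimately have "s * F E < F E + (E' - E) * G" by simp
  then have "s * F E / (b * (F E)\<^sup>2) < (F E + (E' - E) * G) / (b * (F E)\<^sup>2)"
    using b F by (intro divide_strict_right_mono) auto
  moreover have "s * F E / (b * (F E)\<^sup>2) = 1 / (b * F E')" using b F by (simp add: s_def power2_eq_square)
  moreover have "(F E + (E' - E) * G) / (b * (F E)\<^sup>2) = 1 / (b * F E) + G / (b * (F E)\<^sup>2) * (E' - E)"
    using b F by (simp add: power2_eq_square field_simps)
  ultimately show ?thesis by (simp add: G_def)
qed

text \<open>The eigenvalue equation reads \<open>M E = \<mu>\<close> with \<open>M E = 1 / (b F E)\<close>, and \<open>M\<close> increases from \<open>1 / (b F m)\<close>,
  the critical coupling, to infinity.\<close>

lemma rank_one_eigenvalue_branch: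
  assumes \<omega>: "\<omega> \<noteq> ES" and b: "b > 0"
  shows "\<exists>E :: real \<Rightarrow> real.
     (\<forall>\<mu>>mu0 e a b \<omega>.
        eigenvalues_above e a b \<mu> \<omega> = {E \<mu>} \<and> has_multiplicity e a b \<mu> \<omega> (E \<mu>) 1 \<and>
        eigenfunction e a b \<mu> \<omega> (E \<mu>) (Psi e \<omega> (E \<mu>))) \<and>
     real_analytic_on E {mu0 e a b \<omega><..} \<and>
     strict_mono_on {mu0 e a b \<omega><..} E \<and>
     strictly_convex_on {mu0 e a b \<omega><..} E"
proof -
  define F where "F = res (\<lambda>p. (weight \<omega> p)\<^sup>2)"
  define M where "M = (\<lambda>E. 1 / (b * F E))"
  define \<mu>\<^sub>0 where "\<mu>\<^sub>0 = mu0 e a b \<omega>"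
  have \<mu>\<^sub>0: "\<mu>\<^sub>0 = 1 / (b * F m)" using \<omega> by (simp add: \<mu>\<^sub>0_def mu0_def gamma_eq F_def mult.commute)
  have Fpos: "0 < F E" if "m < E" for E using res_weight_pos that by (auto simp: F_def)
  have Fm: "0 < F m" using res_weight_threshold_pos by (simp add: F_def)
  have \<mu>\<^sub>0_pos: "0 < \<mu>\<^sub>0" using Fm b by (simp add: \<mu>\<^sub>0)
  have an: "real_analytic_at M E" if "m < E" for E
    unfolding M_def F_def using b res_weight_pos(1)[OF that, of \<omega>]
    by (intro real_analytic_at_divide real_analytic_at_mult real_analytic_at_const res_analytic weight_sq_cont that) auto
  have super: "\<exists>c>0. \<forall>y>m. y \<noteq> x \<longrightarrow> M y < M x + c * (y - x)" if x: "m < x" for x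
  proof (intro exI[of _ "res2 (\<lambda>p. (weight \<omega> p)\<^sup>2) x / (b * (F x)\<^sup>2)"] conjI allI impI)
    show "0 < res2 (\<lambda>p. (weight \<omega> p)\<^sup>2) x / (b * (F x)\<^sup>2)"
      using res_weight_pos(2)[OF x] Fpos[OF x] b by simp
    fix y assume "m < y" "y \<noteq> x"
    then show "M y < M x + res2 (\<lambda>p. (weight \<omega> p)\<^sup>2) x / (b * (F x)\<^sup>2) * (y - x)"
      unfolding M_def F_def by (rule rank_one_supergradient[OF \<omega> x _ _ b])
  qed
  have der: "\<exists>d>0. (M has_real_derivative d) (at x)" if x: "m < x" for x
  proof -
    obtain c where c: "c > 0" "\<And>y. m < y \<Longrightarrow> y \<noteq> x \<Longrightarrow> M y < M x + c * (y - x)" using super[OF x] by blast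
    obtain d where d: "(M has_real_derivative d) (at x)" using an[OF x] real_analytic_at_imp_DERIV by blast
    have "d = c" by (rule supergradient_eq_derivative[OF d x]) (use c(2) in force)
    then show ?thesis using c(1) d by blast
  qed
  have lower: "\<mu>\<^sub>0 < M x" if "m < x" for x
    unfolding \<mu>\<^sub>0 M_def using Fpos[OF that] Fm b res_weight_less[OF that, of \<omega>]
    by (intro divide_strict_left_mono mult_strict_left_mono mult_pos_pos) (auto simp: F_def)
  have low: "\<exists>x>m. M x \<le> \<mu>" if \<mu>: "\<mu>\<^sub>0 < \<mu>" for \<mu>
  proof -
    have "1 / (b * \<mu>) < F m"
    proof -
      have "1 < \<mu> * (b * F m)" using \<mu> b Fm unfolding \<mu>\<^sub>0 by (simp add: pos_divide_less_eq)
      moreover have "0 < b * \<mu>" using \<mu> \<mu>\<^sub>0_pos b by simp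
      ultimately show ?thesis by (simp add: pos_divide_less_eq mult.commute mult.left_commute)
    qed
    then have "\<forall>\<^sub>F n in sequentially. 1 / (b * \<mu>) < F (approach n)"
      using order_tendstoD(1)[OF res_weight_tendsto] by (simp add: F_def)
    then obtain n where "1 / (b * \<mu>) < F (approach n)" by (auto simp: eventually_sequentially)
    then have "M (approach n) \<le> \<mu>"
      using \<mu> \<mu>\<^sub>0_pos b Fpos[OF approach_gt, of n] by (simp add: M_def field_simps)
    then show ?thesis using approach_gt by blast
  qed
  have up: "\<exists>x>m. \<mu> \<le> M x" if \<mu>: "\<mu>\<^sub>0 < \<mu>" for \<mu>
  proof -
    have "0 < 1 / (b * \<mu>)" using \<mu> \<mu>\<^sub>0_pos b by simp
    then obtain x where x: "m < x" "\<bar>F x\<bar> < 1 / (b * \<mu>)"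
      unfolding F_def using res_small[OF weight_sq_cont] by (metis order_refl)
    then have "\<mu> \<le> M x" using Fpos[OF x(1)] \<mu> \<mu>\<^sub>0_pos b by (simp add: M_def field_simps)
    then show ?thesis using x(1) by blast
  qed
  obtain E where E: "\<And>\<mu>. \<mu>\<^sub>0 < \<mu> \<Longrightarrow> m < E \<mu>" "\<And>\<mu>. \<mu>\<^sub>0 < \<mu> \<Longrightarrow> M (E \<mu>) = \<mu>" "\<And>x. m < x \<Longrightarrow> E (M x) = x"
    "real_analytic_on E {\<mu>\<^sub>0<..}" "strict_mono_on {\<mu>\<^sub>0<..} E"
    using analytic_inverse_branch[OF an der lower low up] by blast
  have conv: "strictly_convex_on {\<mu>\<^sub>0<..} E"
    using super by (intro strictly_convex_on_inverse_if_strict_supergradient[OF E(1,2,3) lower E(5)]) blast+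
  have iff: "\<mu> * b * F x = 1 \<longleftrightarrow> x = E \<mu>" if "\<mu>\<^sub>0 < \<mu>" "m < x" for \<mu> x
  proof -
    have "\<mu> * b * F x = 1 \<longleftrightarrow> M x = \<mu>" using Fpos[OF that(2)] b by (auto simp: M_def field_simps)
    then show ?thesis using E that by metis
  qed
  show ?thesis
  proof (intro exI[of _ E] conjI allI impI)
    fix \<mu> assume "mu0 e a b \<omega> < \<mu>"
    then have \<mu>: "\<mu>\<^sub>0 < \<mu>" by (simp add: \<mu>\<^sub>0_def)
    have 1: "\<mu> * b * F (E \<mu>) = 1" using iff[OF \<mu> E(1)[OF \<mu>]] by simp
    show "eigenvalues_above e a b \<mu> \<omega> = {E \<mu>}"
      unfolding eigenvalues_rank_one[OF \<omega>] F_def[symmetric] using iff[OF \<mu>] E(1)[OF \<mu>] by auto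
    show "has_multiplicity e a b \<mu> \<omega> (E \<mu>) 1"
      using multiplicity_rank_one[OF \<omega> E(1)[OF \<mu>]] 1 by (simp add: F_def)
    show "eigenfunction e a b \<mu> \<omega> (E \<mu>) (Psi e \<omega> (E \<mu>))"
      using Psi_eigenfunction[OF \<omega> E(1)[OF \<mu>]] 1 by (simp add: F_def)
  qed (use E(4,5) conv in \<open>auto simp: \<mu>\<^sub>0_def\<close>)
qed

end

section \<open>Thresholds in the even symmetric sector\<close>

lemma psd_form_nonneg:
  fixes P Q R x y :: real
  assumes "P * R = Q\<^sup>2" "P > 0 \<or> R > 0"
  shows "0 \<le> P * x\<^sup>2 - 2 * Q * x * y + R * y\<^sup>2"
  using assms(2)
proof
  assume P: "P > 0"
  have "P * (P * x\<^sup>2 - 2 * Q * x * y + R * y\<^sup>2) = (P * x - Q * y)\<^sup>2 + (P * R - Q\<^sup>2) * y\<^sup>2"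
    by (simp add: power2_eq_square algebra_simps)
  then have "0 \<le> P * (P * x\<^sup>2 - 2 * Q * x * y + R * y\<^sup>2)" using assms(1) by simp
  then show ?thesis using P by (simp only: zero_le_mult_iff) linarith
next
  assume R: "R > 0"
  have "R * (P * x\<^sup>2 - 2 * Q * x * y + R * y\<^sup>2) = (R * y - Q * x)\<^sup>2 + (P * R - Q\<^sup>2) * x\<^sup>2"
    by (simp add: power2_eq_square algebra_simps)
  then have "0 \<le> R * (P * x\<^sup>2 - 2 * Q * x * y + R * y\<^sup>2)" using assms(1) by simp
  then show ?thesis using R by (simp only: zero_le_mult_iff) linarith
qed

context threshold_dispersion
begin

abbreviation G\<^sub>0 :: "real \<Rightarrow> real" where "G\<^sub>0 \<equiv> res2 (\<lambda>_. 1)"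
abbreviation G\<^sub>1 :: "real \<Rightarrow> real" where "G\<^sub>1 \<equiv> res2 cos_sum"
abbreviation G\<^sub>2 :: "real \<Rightarrow> real" where "G\<^sub>2 \<equiv> res2 (\<lambda>p. (cos_sum p)\<^sup>2)"

lemma gram_continuous: "continuous_on UNIV (\<lambda>_ :: real \<times> real. 1 :: real)" "continuous_on UNIV cos_sum"
  "continuous_on UNIV (\<lambda>p. (cos_sum p)\<^sup>2)"
  by (intro continuous_intros)+

lemma res_linear3:
  assumes "continuous_on UNIV f" "continuous_on UNIV g" "continuous_on UNIV h" "m < E"
  shows "res (\<lambda>p. x * f p + y * g p + z * h p) E = x * res f E + y * res g E + z * res h E"
    "res2 (\<lambda>p. x * f p + y * g p + z * h p) E = x * res2 f E + y * res2 g E + z * res2 h E"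
proof -
  have c: "continuous_on UNIV (\<lambda>p. x * f p + y * g p)" by (intro continuous_intros assms)
  show "res (\<lambda>p. x * f p + y * g p + z * h p) E = x * res f E + y * res g E + z * res h E"
    "res2 (\<lambda>p. x * f p + y * g p + z * h p) E = x * res2 f E + y * res2 g E + z * res2 h E"
    using res_linear[OF c assms(3,4), of 1 z] res_linear[OF assms(1,2,4), of x y] by simp_all
qed

lemma gram_quadratic:
  assumes "m < E"
  shows "res (\<lambda>p. (x + y * cos_sum p)\<^sup>2) E = x\<^sup>2 * L\<^sub>0 E + 2 * x * y * L\<^sub>1 E + y\<^sup>2 * L\<^sub>2 E"
    and "res2 (\<lambda>p. (x + y * cos_sum p)\<^sup>2) E = x\<^sup>2 * G\<^sub>0 E + 2 * x * y * G\<^sub>1 E + y\<^sup>2 * G\<^sub>2 E"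
    and "res (\<lambda>p. (x + y * cos_sum p) * (x' + y' * cos_sum p)) E
      = x * x' * L\<^sub>0 E + (x * y' + y * x') * L\<^sub>1 E + y * y' * L\<^sub>2 E"
proof -
  have *: "(\<lambda>p. (x + y * cos_sum p)\<^sup>2) = (\<lambda>p. x\<^sup>2 * 1 + 2 * x * y * cos_sum p + y\<^sup>2 * (cos_sum p)\<^sup>2)"
    "(\<lambda>p. (x + y * cos_sum p) * (x' + y' * cos_sum p)) = (\<lambda>p. x * x' * 1 + (x * y' + y * x') * cos_sum p + y * y' * (cos_sum p)\<^sup>2)"
    by (auto simp: fun_eq_iff power2_eq_square algebra_simps)
  show "res (\<lambda>p. (x + y * cos_sum p)\<^sup>2) E = x\<^sup>2 * L\<^sub>0 E + 2 * x * y * L\<^sub>1 E + y\<^sup>2 * L\<^sub>2 E"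
    "res2 (\<lambda>p. (x + y * cos_sum p)\<^sup>2) E = x\<^sup>2 * G\<^sub>0 E + 2 * x * y * G\<^sub>1 E + y\<^sup>2 * G\<^sub>2 E"
    "res (\<lambda>p. (x + y * cos_sum p) * (x' + y' * cos_sum p)) E
      = x * x' * L\<^sub>0 E + (x * y' + y * x') * L\<^sub>1 E + y * y' * L\<^sub>2 E"
    unfolding * by (rule res_linear3[OF gram_continuous assms])+
qed

lemma gram_pos:
  assumes E: "m < E" and xy: "x \<noteq> 0 \<or> y \<noteq> 0"
  shows "0 < x\<^sup>2 * L\<^sub>0 E + 2 * x * y * L\<^sub>1 E + y\<^sup>2 * L\<^sub>2 E" "0 < x\<^sup>2 * G\<^sub>0 E + 2 * x * y * G\<^sub>1 E + y\<^sup>2 * G\<^sub>2 E"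
proof -
  have "\<exists>p\<in>open_square. x + y * cos_sum p \<noteq> 0"
  proof (rule ccontr)
    assume "\<not> ?thesis"
    then have "\<And>p. p \<in> open_square \<Longrightarrow> x + y * cos_sum p = 0" by blast
    from this[of "(0, 0)"] this[of "(pi / 2, pi / 2)"] show False using xy by simp
  qed
  then obtain p where p: "p \<in> open_square" "(x + y * cos_sum p)\<^sup>2 \<noteq> 0" by auto
  have c: "continuous_on UNIV (\<lambda>p. (x + y * cos_sum p)\<^sup>2)" by (intro continuous_intros)
  show "0 < x\<^sup>2 * L\<^sub>0 E + 2 * x * y * L\<^sub>1 E + y\<^sup>2 * L\<^sub>2 E" "0 < x\<^sup>2 * G\<^sub>0 E + 2 * x * y * G\<^sub>1 E + y\<^sup>2 * G\<^sub>2 E"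
    using res_pos[OF c E _ p] by (simp_all add: gram_quadratic[OF E])
qed

lemma gram_facts:
  assumes E: "m < E"
  shows "0 < L\<^sub>0 E" "0 < L\<^sub>2 E" "0 < G\<^sub>0 E" "0 < G\<^sub>2 E"
    "(L\<^sub>1 E)\<^sup>2 < L\<^sub>0 E * L\<^sub>2 E" "(G\<^sub>1 E)\<^sup>2 < G\<^sub>0 E * G\<^sub>2 E"
proof -
  show p: "0 < L\<^sub>0 E" "0 < L\<^sub>2 E" "0 < G\<^sub>0 E" "0 < G\<^sub>2 E"
    using gram_pos[OF E, of 1 0] gram_pos[OF E, of 0 1] by simp_all
  have "0 < L\<^sub>0 E * (L\<^sub>0 E * L\<^sub>2 E - (L\<^sub>1 E)\<^sup>2)"
    using gram_pos(1)[OF E, of "- L\<^sub>1 E" "L\<^sub>0 E"] p by (simp add: power2_eq_square algebra_simps)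
  then show "(L\<^sub>1 E)\<^sup>2 < L\<^sub>0 E * L\<^sub>2 E" using p by (simp add: zero_less_mult_iff)
  have "0 < G\<^sub>0 E * (G\<^sub>0 E * G\<^sub>2 E - (G\<^sub>1 E)\<^sup>2)"
    using gram_pos(2)[OF E, of "- G\<^sub>1 E" "G\<^sub>0 E"] p by (simp add: power2_eq_square algebra_simps)
  then show "(G\<^sub>1 E)\<^sup>2 < G\<^sub>0 E * G\<^sub>2 E" using p by (simp add: zero_less_mult_iff)
qed

text \<open>Near the threshold all three entries of the Gram matrix diverge. Replacing \<open>cos_sum\<close> by the weight
  \<open>cos_sum + 2\<close>, which vanishes at the maximum, concentrates the divergence in \<open>L\<^sub>0\<close>.\<close>

lemma gram_shift:
  assumes E: "m < E"
  shows "L\<^sub>1 E = res (weight ES) E - 2 * L\<^sub>0 E"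
    and "L\<^sub>2 E = res (\<lambda>p. (weight ES p)\<^sup>2) E - 4 * res (weight ES) E + 4 * L\<^sub>0 E"
proof -
  have *: "weight ES = (\<lambda>p. 2 * 1 + 1 * cos_sum p)" "(\<lambda>p. (weight ES p)\<^sup>2) = (\<lambda>p. (2 + 1 * cos_sum p)\<^sup>2)"
    by (auto simp: add.commute)
  have 1: "res (weight ES) E = 2 * L\<^sub>0 E + L\<^sub>1 E"
    unfolding *(1) using res_linear(1)[OF gram_continuous(1,2) E, of 2 1] by simp
  have 2: "res (\<lambda>p. (weight ES p)\<^sup>2) E = 4 * L\<^sub>0 E + 4 * L\<^sub>1 E + L\<^sub>2 E"
    unfolding *(2) gram_quadratic(1)[OF E] by simp
  show "L\<^sub>1 E = res (weight ES) E - 2 * L\<^sub>0 E"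
    "L\<^sub>2 E = res (\<lambda>p. (weight ES p)\<^sup>2) E - 4 * res (weight ES) E + 4 * L\<^sub>0 E"
    using 1 2 by auto
qed

text \<open>Up to the factor \<open>1 / (a b)\<close> the secular determinant is the characteristic polynomial of the matrix
  \<open>D L\<close> with \<open>D = diag a b\<close> and \<open>L\<close> the Gram matrix; its positive roots are the inverse couplings for which
  the given energy is an eigenvalue.\<close>

definition trace :: "real \<Rightarrow> real \<Rightarrow> real \<Rightarrow> real" where
  "trace a b E = a * L\<^sub>0 E + b * L\<^sub>2 E"

definition gram_det :: "real \<Rightarrow> real" where
  "gram_det E = L\<^sub>0 E * L\<^sub>2 E - (L\<^sub>1 E)\<^sup>2"

definition charpoly :: "real \<Rightarrow> real \<Rightarrow> real \<Rightarrow> real \<Rightarrow> real" where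
  "charpoly a b k E = k\<^sup>2 - trace a b E * k + a * b * gram_det E"

lemma secular_iff_charpoly:
  assumes "a \<noteq> 0" "b \<noteq> 0"
  shows "secular a b k E = 0 \<longleftrightarrow> charpoly a b k E = 0"
proof -
  have "charpoly a b k E = a * b * secular a b k E"
    using assms by (simp add: charpoly_def secular_def trace_def gram_det_def field_simps power2_eq_square)
  then show ?thesis using assms by simp
qed

lemma charpoly_at_infinity: "(charpoly a b k \<longlongrightarrow> k\<^sup>2) at_top"
proof -
  note t = res_tendsto_0[OF gram_continuous(1)] res_tendsto_0[OF gram_continuous(2)] res_tendsto_0[OF gram_continuous(3)]
  show ?thesis
    unfolding charpoly_def[abs_def] trace_def gram_det_def
    by (rule tendsto_eq_intros t refl | simp)+
qed

text \<open>In the shifted Gram matrix the determinant equals \<open>L\<^sub>0 W\<^sub>2 - W\<^sub>1\<^sup>2\<close>, so the characteristic polynomial is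
  \<open>(a b W\<^sub>2 - k (a + 4 b)) L\<^sub>0\<close> plus a convergent remainder, and only the sign of the coefficient of the
  divergent \<open>L\<^sub>0\<close> matters.\<close>

lemma charpoly_threshold:
  defines "W \<equiv> res (\<lambda>p. (weight ES p)\<^sup>2) m"
  shows "k * (a + 4 * b) < a * b * W \<Longrightarrow> filterlim (\<lambda>n. charpoly a b k (approach n)) at_top sequentially"
    and "a * b * W < k * (a + 4 * b) \<Longrightarrow> filterlim (\<lambda>n. charpoly a b k (approach n)) at_bot sequentially"
proof -
  define W1 where "W1 = (\<lambda>n. res (weight ES) (approach n))"
  define W2 where "W2 = (\<lambda>n. res (\<lambda>p. (weight ES p)\<^sup>2) (approach n))"
  define u where "u = (\<lambda>n. a * b * W2 n - k * (a + 4 * b))"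
  define v where "v = (\<lambda>n. k\<^sup>2 - k * b * (W2 n - 4 * W1 n) - a * b * (W1 n)\<^sup>2)"
  obtain K where K: "\<And>p. weight ES p \<le> K * (m - e p)" using weight_ES_bound by blast
  have W1: "W1 \<longlonglongrightarrow> res (weight ES) m"
    unfolding W1_def by (rule res_tendsto_threshold[OF continuous_weight weight_ES_range(1) K])
  have W2: "W2 \<longlonglongrightarrow> W" unfolding W2_def W_def by (rule res_weight_tendsto)
  have u: "u \<longlonglongrightarrow> a * b * W - k * (a + 4 * b)" unfolding u_def by (intro tendsto_intros W2)
  have v: "v \<longlonglongrightarrow> k\<^sup>2 - k * b * (W - 4 * res (weight ES) m) - a * b * (res (weight ES) m)\<^sup>2"
    unfolding v_def by (intro tendsto_intros W1 W2)
  have eq: "charpoly a b k (approach n) = u n * L\<^sub>0 (approach n) + v n" for n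
    unfolding charpoly_def trace_def gram_det_def gram_shift[OF approach_gt] u_def v_def W1_def W2_def
    by (simp add: power2_eq_square algebra_simps)
  note L = res_unbounded[OF not_integrable_threshold]
  { assume "k * (a + 4 * b) < a * b * W"
    then have "filterlim (\<lambda>n. u n * L\<^sub>0 (approach n)) at_top sequentially"
      by (intro filterlim_tendsto_pos_mult_at_top[OF u _ L]) simp
    then show "filterlim (\<lambda>n. charpoly a b k (approach n)) at_top sequentially"
      unfolding eq add.commute[of "_ * _"] by (rule filterlim_tendsto_add_at_top[OF v])
  }
  { assume "a * b * W < k * (a + 4 * b)"
    then have "filterlim (\<lambda>n. u n * L\<^sub>0 (approach n)) at_bot sequentially"
      by (intro filterlim_tendsto_neg_mult_at_bot[OF u _ L]) simp
    then show "filterlim (\<lambda>n. charpoly a b k (approach n)) at_bot sequentially"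
      unfolding eq add.commute[of "_ * _"] by (simp add: filterlim_tendsto_add_at_bot_iff[OF v])
  }
qed

lemma eventually_approach_less: "m < E \<Longrightarrow> \<forall>\<^sub>F n in sequentially. approach n < E"
  using order_tendstoD(2)[OF approach_tendsto] .

lemma mu0_ES: "(a + 4 * b) / (a * b) > 0 \<Longrightarrow>
    mu0 e a b ES = (a + 4 * b) / (a * b * res (\<lambda>p. (weight ES p)\<^sup>2) m)"
  "\<not> (a + 4 * b) / (a * b) > 0 \<Longrightarrow> mu0 e a b ES = 0"
  by (simp_all only: mu0_def gamma_eq if_True if_False) (simp_all del: weight.simps)

text \<open>The coefficient of \<open>L\<^sub>0\<close> changes sign exactly at \<open>1 / k = mu0\<close>; this is the origin of the critical
  coupling. At the borderline \<open>1 / k = mu0\<close> strict monotonicity of the roots in \<open>E\<close> decides instead.\<close>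

lemma charpoly_sign_vs_mu0:
  assumes "a \<noteq> 0" "b \<noteq> 0" "0 < k"
  defines "W \<equiv> res (\<lambda>p. (weight ES p)\<^sup>2) m"
  shows "a * b < 0 \<Longrightarrow> mu0 e a b ES < 1 / k \<Longrightarrow> a * b * W < k * (a + 4 * b)"
    "a * b < 0 \<Longrightarrow> 0 < mu0 e a b ES \<Longrightarrow> 1 / k < mu0 e a b ES \<Longrightarrow> k * (a + 4 * b) < a * b * W"
    "0 < a \<Longrightarrow> 0 < b \<Longrightarrow> mu0 e a b ES < 1 / k \<Longrightarrow> k * (a + 4 * b) < a * b * W"
    "0 < a \<Longrightarrow> 0 < b \<Longrightarrow> 1 / k < mu0 e a b ES \<Longrightarrow> a * b * W < k * (a + 4 * b)"
proof -
  have W: "0 < W" unfolding W_def by (rule res_weight_threshold_pos)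
  { assume ab: "a * b < 0" and \<mu>: "mu0 e a b ES < 1 / k"
    have abW: "a * b * W < 0" using ab W by (rule mult_neg_pos)
    show "a * b * W < k * (a + 4 * b)"
    proof (cases "(a + 4 * b) / (a * b) > 0")
      case True
      then have "(a + 4 * b) / (a * b * W) < 1 / k" using \<mu> mu0_ES(1)[OF True] by (simp add: W_def)
      then have "1 / k * (a * b * W) < a + 4 * b" using abW by (simp only: neg_divide_less_eq)
      then show ?thesis using \<open>0 < k\<close> by (simp add: field_simps)
    next
      case False
      then have "0 \<le> a + 4 * b" using ab by (simp add: divide_pos_neg zero_less_divide_iff)
      then have "0 \<le> k * (a + 4 * b)" using \<open>0 < k\<close> by simp
      then show ?thesis using abW by linarith
    qed }
  { assume ab: "a * b < 0" and pos: "0 < mu0 e a b ES" and \<mu>: "1 / k < mu0 e a b ES"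
    have abW: "a * b * W < 0" using ab W by (rule mult_neg_pos)
    have True: "(a + 4 * b) / (a * b) > 0" using pos mu0_ES(2)[of a b] by force
    have "1 / k < (a + 4 * b) / (a * b * W)" using \<mu> mu0_ES(1)[OF True] by (simp add: W_def)
    then have "a + 4 * b < 1 / k * (a * b * W)" using abW by (simp only: neg_less_divide_eq)
    then show "k * (a + 4 * b) < a * b * W" using \<open>0 < k\<close> by (simp add: field_simps) }
  { assume ab: "0 < a" "0 < b"
    have abW: "0 < a * b * W" using ab W by simp
    have True: "(a + 4 * b) / (a * b) > 0" using ab by simp
    { assume \<mu>: "mu0 e a b ES < 1 / k"
      have "(a + 4 * b) / (a * b * W) < 1 / k" using \<mu> mu0_ES(1)[OF True] by (simp add: W_def)
      then have "a + 4 * b < 1 / k * (a * b * W)" using abW by (simp only: pos_divide_less_eq)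
      then show "k * (a + 4 * b) < a * b * W" using \<open>0 < k\<close> by (simp add: field_simps) }
    { assume \<mu>: "1 / k < mu0 e a b ES"
      have "1 / k < (a + 4 * b) / (a * b * W)" using \<mu> mu0_ES(1)[OF True] by (simp add: W_def)
      then have "1 / k * (a * b * W) < a + 4 * b" using abW by (simp only: pos_less_divide_eq)
      then show "a * b * W < k * (a + 4 * b)" using \<open>0 < k\<close> by (simp add: field_simps) }
  }
qed

lemma mu0_ES_pos: "0 < a \<Longrightarrow> 0 < b \<Longrightarrow> 0 < mu0 e a b ES"
  and mu0_ES_nonneg: "0 \<le> mu0 e a b ES"
proof -
  have W: "0 < res (\<lambda>p. (weight ES p)\<^sup>2) m" by (rule res_weight_threshold_pos)
  show "0 < mu0 e a b ES" if "0 < a" "0 < b"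
    using that W by (subst mu0_ES(1)) (simp_all del: weight.simps)
  show "0 \<le> mu0 e a b ES"
  proof (cases "(a + 4 * b) / (a * b) > 0")
    case True
    then have "0 < ((a + 4 * b) / (a * b)) / res (\<lambda>p. (weight ES p)\<^sup>2) m" using W by (rule divide_pos_pos)
    then show ?thesis using mu0_ES(1)[OF True] by (simp del: weight.simps)
  qed (simp add: mu0_ES(2))
qed

lemma trace_analytic: "m < E \<Longrightarrow> real_analytic_at (trace a b) E"
  unfolding trace_def[abs_def]
  by (intro real_analytic_at_add real_analytic_at_mult real_analytic_at_const res_analytic gram_continuous)

lemma gram_det_analytic: "m < E \<Longrightarrow> real_analytic_at gram_det E"
  unfolding gram_det_def[abs_def]
  by (intro real_analytic_at_diff real_analytic_at_power real_analytic_at_mult res_analytic gram_continuous)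

lemma gram_det_pos: "m < E \<Longrightarrow> 0 < gram_det E"
  using gram_facts(5) by (simp add: gram_det_def)

lemma no_eigenvalues_ES_negative:
  assumes "a < 0" "b < 0" "\<mu> > 0"
  shows "eigenvalues_above e a b \<mu> ES = {}"
proof -
  have "charpoly a b (1 / \<mu>) E \<noteq> 0" if E: "m < E" for E
  proof -
    have "trace a b E < 0" using gram_facts(1,2)[OF E] assms unfolding trace_def by (intro add_neg_neg mult_neg_pos)
    then have "0 < - trace a b E * (1 / \<mu>)" using assms(3) by (intro mult_pos_pos) auto
    moreover have "0 < a * b * gram_det E" using gram_det_pos[OF E] assms by (simp add: mult_neg_neg)
    ultimately show ?thesis unfolding charpoly_def using zero_le_power2[of "1 / \<mu>"] by linarith
  qed
  then show ?thesis using assms by (auto simp: eigenvalues_ES secular_iff_charpoly)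
qed

end

section \<open>The even symmetric sector with couplings of opposite sign\<close>

context threshold_dispersion
begin

definition pos_root :: "real \<Rightarrow> real \<Rightarrow> real \<Rightarrow> real" where
  "pos_root a b E = (trace a b E + sqrt ((trace a b E)\<^sup>2 - 4 * (a * b) * gram_det E)) / 2"

context
  fixes a b :: real
  assumes ab: "a * b < 0"
begin

lemma discriminant_pos: "m < E \<Longrightarrow> (trace a b E)\<^sup>2 < (trace a b E)\<^sup>2 - 4 * (a * b) * gram_det E"
  using mult_neg_pos[OF ab gram_det_pos] by (simp add: mult.assoc)

lemma pos_root_factor:
  assumes E: "m < E"
  obtains k' where "k' < 0" "0 < pos_root a b E" "\<And>k. charpoly a b k E = (k - pos_root a b E) * (k - k')"
proof -
  define t where "t = trace a b E"
  define s where "s = sqrt (t\<^sup>2 - 4 * (a * b) * gram_det E)"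
  have D: "t\<^sup>2 < t\<^sup>2 - 4 * (a * b) * gram_det E" using discriminant_pos[OF E] by (simp add: t_def)
  have "sqrt (t\<^sup>2) < s" unfolding s_def using D by (rule real_sqrt_less_mono)
  then have st: "\<bar>t\<bar> < s" by simp
  have s2: "s\<^sup>2 = t\<^sup>2 - 4 * (a * b) * gram_det E" unfolding s_def using D zero_le_power2[of t] by (intro real_sqrt_pow2) linarith
  show ?thesis
  proof (rule that[of "(t - s) / 2"])
    show "(t - s) / 2 < 0" "0 < pos_root a b E" using st by (auto simp: pos_root_def t_def[symmetric] s_def[symmetric])
    fix k
    have "(k - (t + s) / 2) * (k - (t - s) / 2) = k\<^sup>2 - t * k + (t\<^sup>2 - s\<^sup>2) / 4"
      by (simp add: power2_eq_square field_simps)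
    also have "\<dots> = charpoly a b k E" unfolding s2 charpoly_def t_def by simp
    finally show "charpoly a b k E = (k - pos_root a b E) * (k - (t - s) / 2)"
      by (simp add: pos_root_def t_def s_def)
  qed
qed

lemma pos_root_pos: "m < E \<Longrightarrow> 0 < pos_root a b E"
  by (rule pos_root_factor) auto

lemma pos_root_iff: "m < E \<Longrightarrow> 0 < k \<Longrightarrow> charpoly a b k E = 0 \<longleftrightarrow> k = pos_root a b E"
  by (rule pos_root_factor) auto

lemma charpoly_neg_iff: "m < E \<Longrightarrow> 0 < k \<Longrightarrow> charpoly a b k E < 0 \<longleftrightarrow> k < pos_root a b E"
  by (rule pos_root_factor) (auto simp: mult_less_0_iff)

lemma pos_root_analytic:
  assumes "m < E" shows "real_analytic_at (pos_root a b) E"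
proof -
  have "0 < (trace a b E)\<^sup>2 - 4 * (a * b) * gram_det E"
    using discriminant_pos[OF assms] zero_le_power2[of "trace a b E"] by linarith
  then show ?thesis
    unfolding pos_root_def[abs_def]
    by (intro real_analytic_at_divide real_analytic_at_add real_analytic_at_sqrt real_analytic_at_diff
        real_analytic_at_mult real_analytic_at_power real_analytic_at_const trace_analytic gram_det_analytic assms) auto
qed

text \<open>The kernel vector \<open>(x, y)\<close> at the energy \<open>E\<close> yields the trial function, with moments \<open>\<alpha>\<close>, \<open>\<beta>\<close>. At the
  energy \<open>E'\<close> the dual vector is \<open>(x', y') = L(E')^(-1) (\<alpha>, \<beta>)\<close>, and the bound needed is that the
  matrix \<open>L(E')^(-1) - D / \<kappa>'\<close> is positive semidefinite. It is singular by the choice of \<open>\<kappa>'\<close>, and one of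
  its diagonal entries is positive because one of \<open>a\<close>, \<open>b\<close> is negative.\<close>

lemma pos_root_supergradient:
  assumes E: "m < E"
  shows "\<exists>c>0. \<forall>y>m. 1 / pos_root a b y \<le> 1 / pos_root a b E + c * (y - E)"
proof -
  define \<kappa> where "\<kappa> = pos_root a b E"
  have \<kappa>: "\<kappa> > 0" using pos_root_pos[OF E] by (simp add: \<kappa>_def)
  have a: "a \<noteq> 0" and b: "b \<noteq> 0" using ab by auto
  have "secular a b \<kappa> E = 0" using pos_root_iff[OF E \<kappa>] secular_iff_charpoly[OF a b] by (simp add: \<kappa>_def)
  then have det: "(\<kappa> / a - L\<^sub>0 E) * (\<kappa> / b - L\<^sub>2 E) = (- L\<^sub>1 E)\<^sup>2" by (simp add: secular_def)
  have "\<not> (\<kappa> = a * L\<^sub>0 E \<and> \<kappa> = b * L\<^sub>2 E)"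
    using \<kappa> gram_facts(1,2)[OF E] ab by (metis mult_less_0_iff zero_less_mult_iff less_asym)
  then have ne: "\<kappa> / a - L\<^sub>0 E \<noteq> 0 \<or> \<kappa> / b - L\<^sub>2 E \<noteq> 0" using a b by (auto simp: field_simps)
  obtain x y where xy: "x \<noteq> 0 \<or> y \<noteq> 0"
    "(\<kappa> / a - L\<^sub>0 E) * x + (- L\<^sub>1 E) * y = 0" "(- L\<^sub>1 E) * x + (\<kappa> / b - L\<^sub>2 E) * y = 0"
    by (rule singular_symmetric_system[OF det ne], rule that)
  define \<alpha> where "\<alpha> = x * L\<^sub>0 E + y * L\<^sub>1 E"
  define \<beta> where "\<beta> = x * L\<^sub>1 E + y * L\<^sub>2 E"
  have \<alpha>: "a * \<alpha> = \<kappa> * x" and \<beta>: "b * \<beta> = \<kappa> * y" using xy(2,3) a b by (simp_all add: \<alpha>_def \<beta>_def field_simps)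
  define Q where "Q = x\<^sup>2 * L\<^sub>0 E + 2 * x * y * L\<^sub>1 E + y\<^sup>2 * L\<^sub>2 E"
  define G where "G = x\<^sup>2 * G\<^sub>0 E + 2 * x * y * G\<^sub>1 E + y\<^sup>2 * G\<^sub>2 E"
  have Q: "Q > 0" and G: "G > 0" using gram_pos[OF E xy(1)] by (auto simp: Q_def G_def)
  have Q_eq: "Q = x * \<alpha> + y * \<beta>" by (simp add: Q_def \<alpha>_def \<beta>_def power2_eq_square algebra_simps)
  have V: "a * \<alpha>\<^sup>2 + b * \<beta>\<^sup>2 = \<kappa> * Q"
  proof -
    have "a * \<alpha>\<^sup>2 + b * \<beta>\<^sup>2 = (a * \<alpha>) * \<alpha> + (b * \<beta>) * \<beta>" by (simp add: power2_eq_square)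
    also have "\<dots> = \<kappa> * Q" unfolding \<alpha> \<beta> Q_eq by (simp add: algebra_simps)
    finally show ?thesis .
  qed
  show ?thesis
  proof (intro exI[of _ "G / (\<kappa> * Q)"] conjI allI impI)
    show "0 < G / (\<kappa> * Q)" using G \<kappa> Q by simp
    fix E' assume E': "m < E'"
    define \<kappa>' where "\<kappa>' = pos_root a b E'"
    have \<kappa>': "\<kappa>' > 0" using pos_root_pos[OF E'] by (simp add: \<kappa>'_def)
    define d where "d = gram_det E'"
    have d: "d > 0" using gram_det_pos[OF E'] by (simp add: d_def)
    define x' where "x' = (L\<^sub>2 E' * \<alpha> - L\<^sub>1 E' * \<beta>) / d"
    define y' where "y' = (L\<^sub>0 E' * \<beta> - L\<^sub>1 E' * \<alpha>) / d"
    have inv: "x' * L\<^sub>0 E' + y' * L\<^sub>1 E' = \<alpha>" "x' * L\<^sub>1 E' + y' * L\<^sub>2 E' = \<beta>"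
    proof -
      have "d * (x' * L\<^sub>0 E' + y' * L\<^sub>1 E') = d * \<alpha>" "d * (x' * L\<^sub>1 E' + y' * L\<^sub>2 E') = d * \<beta>"
        using d by (simp_all add: x'_def y'_def field_simps) (simp_all add: d_def gram_det_def power2_eq_square algebra_simps)
      then show "x' * L\<^sub>0 E' + y' * L\<^sub>1 E' = \<alpha>" "x' * L\<^sub>1 E' + y' * L\<^sub>2 E' = \<beta>" using d by simp_all
    qed
    define T where "T = x' * \<alpha> + y' * \<beta>"
    have T1: "res (\<lambda>p. (x + y * cos_sum p) * (x' + y' * cos_sum p)) E = T"
      unfolding gram_quadratic(3)[OF E] by (simp add: T_def \<alpha>_def \<beta>_def algebra_simps)
    have T2: "res (\<lambda>p. (x' + y' * cos_sum p)\<^sup>2) E' = T"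
    proof -
      have "res (\<lambda>p. (x' + y' * cos_sum p)\<^sup>2) E' = x' * (x' * L\<^sub>0 E' + y' * L\<^sub>1 E') + y' * (x' * L\<^sub>1 E' + y' * L\<^sub>2 E')"
        unfolding gram_quadratic(1)[OF E'] by (simp add: power2_eq_square algebra_simps)
      then show ?thesis by (simp only: inv T_def)
    qed
    have "2 * T \<le> Q + (E' - E) * G + T"
    proof -
      have "continuous_on UNIV (\<lambda>p. x + y * cos_sum p)" "continuous_on UNIV (\<lambda>p. x' + y' * cos_sum p)"
        by (intro continuous_intros)+
      from trial_inequality[OF this E E'] show ?thesis
        unfolding T1 T2 gram_quadratic(1,2)[OF E] Q_def G_def .
    qed
    then have T: "T \<le> Q + (E' - E) * G" by simp
    \<comment> \<open>The matrix \<open>L(E')^(-1) - D / \<kappa>'\<close>, multiplied by the positive number \<open>\<kappa>' d\<close>.\<close>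
    have "0 \<le> (\<kappa>' * L\<^sub>2 E' - a * d) * \<alpha>\<^sup>2 - 2 * (\<kappa>' * L\<^sub>1 E') * \<alpha> * \<beta> + (\<kappa>' * L\<^sub>0 E' - b * d) * \<beta>\<^sup>2"
    proof (rule psd_form_nonneg)
      have "(\<kappa>' * L\<^sub>2 E' - a * d) * (\<kappa>' * L\<^sub>0 E' - b * d) - (\<kappa>' * L\<^sub>1 E')\<^sup>2 = d * charpoly a b \<kappa>' E'"
        by (simp add: charpoly_def trace_def d_def[symmetric] power2_eq_square algebra_simps)
           (simp add: d_def gram_det_def power2_eq_square algebra_simps)
      also have "charpoly a b \<kappa>' E' = 0" using pos_root_iff[OF E' \<kappa>'] by (simp add: \<kappa>'_def)
      finally show "(\<kappa>' * L\<^sub>2 E' - a * d) * (\<kappa>' * L\<^sub>0 E' - b * d) = (\<kappa>' * L\<^sub>1 E')\<^sup>2" by simp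
      have "a < 0 \<or> b < 0" using ab by (auto simp: mult_less_0_iff)
      then show "\<kappa>' * L\<^sub>2 E' - a * d > 0 \<or> \<kappa>' * L\<^sub>0 E' - b * d > 0"
      proof
        assume "a < 0"
        then have "a * d < 0" using d by (rule mult_neg_pos)
        moreover have "0 < \<kappa>' * L\<^sub>2 E'" using \<kappa>' gram_facts(2)[OF E'] by simp
        ultimately show ?thesis by linarith
      next
        assume "b < 0"
        then have "b * d < 0" using d by (rule mult_neg_pos)
        moreover have "0 < \<kappa>' * L\<^sub>0 E'" using \<kappa>' gram_facts(1)[OF E'] by simp
        ultimately show ?thesis by linarith
      qed
    qed
    also have "\<dots> = \<kappa>' * (d * T) - d * (a * \<alpha>\<^sup>2 + b * \<beta>\<^sup>2)"
    proof -
      have dT: "d * T = L\<^sub>2 E' * \<alpha>\<^sup>2 - 2 * L\<^sub>1 E' * \<alpha> * \<beta> + L\<^sub>0 E' * \<beta>\<^sup>2"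
        using d by (simp add: T_def x'_def y'_def power2_eq_square field_simps)
      show ?thesis unfolding dT by (simp add: algebra_simps)
    qed
    finally have "0 \<le> d * (\<kappa>' * T - \<kappa> * Q)" unfolding V by (simp add: algebra_simps)
    then have "\<kappa> * Q \<le> \<kappa>' * T" using d by (simp add: zero_le_mult_iff)
    also have "\<dots> \<le> \<kappa>' * (Q + (E' - E) * G)" using T \<kappa>' by (intro mult_left_mono) auto
    finally have le: "\<kappa> * Q \<le> \<kappa>' * (Q + (E' - E) * G)" .
    then have "\<kappa> * Q / (\<kappa>' * (\<kappa> * Q)) \<le> \<kappa>' * (Q + (E' - E) * G) / (\<kappa>' * (\<kappa> * Q))"
      using \<kappa> \<kappa>' Q by (intro divide_right_mono) auto
    moreover have "\<kappa> * Q / (\<kappa>' * (\<kappa> * Q)) = 1 / \<kappa>'" using \<kappa> Q by simp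
    moreover have "\<kappa>' * (Q + (E' - E) * G) / (\<kappa>' * (\<kappa> * Q)) = 1 / \<kappa> + G / (\<kappa> * Q) * (E' - E)"
      using \<kappa> \<kappa>' Q by (simp add: field_simps)
    ultimately show "1 / pos_root a b E' \<le> 1 / pos_root a b E + G / (\<kappa> * Q) * (E' - E)"
      by (simp add: \<kappa>_def \<kappa>'_def)
  qed
qed

lemma pos_root_strict_antimono:
  assumes "m < E" "E < E'" shows "pos_root a b E' < pos_root a b E"
proof -
  have E': "m < E'" using assms by simp
  obtain c where c: "c > 0" "\<And>y. m < y \<Longrightarrow> 1 / pos_root a b y \<le> 1 / pos_root a b E' + c * (y - E')"
    using pos_root_supergradient[OF E'] by blast
  have "c * (E - E') < 0" using c(1) assms(2) by (intro mult_pos_neg) auto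
  then have "1 / pos_root a b E < 1 / pos_root a b E'" using c(2)[OF assms(1)] by linarith
  then show ?thesis using pos_root_pos[OF assms(1)] pos_root_pos[OF E'] by (simp add: field_simps)
qed

text \<open>If the positive root reached \<open>1 / mu0\<close> at some energy, then by strict monotonicity it would exceed a
  number \<open>k > 1 / mu0\<close> at all smaller energies, contradicting the sign of the characteristic polynomial
  near the threshold.\<close>

lemma mu0_less_inverse_pos_root:
  assumes E: "m < E" shows "mu0 e a b ES < 1 / pos_root a b E"
proof (cases "0 < mu0 e a b ES")
  case True
  show ?thesis
  proof (rule ccontr)
    assume "\<not> ?thesis"
    then have le: "1 / pos_root a b E \<le> mu0 e a b ES" by simp
    define E1 where "E1 = (m + E) / 2"
    have E1: "m < E1" "E1 < E" using E by (auto simp: E1_def)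
    define k where "k = pos_root a b E1"
    have k: "0 < k" using pos_root_pos[OF E1(1)] by (simp add: k_def)
    have "1 / k < 1 / pos_root a b E"
      using pos_root_strict_antimono[OF E1] pos_root_pos[OF E] k by (simp add: k_def field_simps)
    then have "1 / k < mu0 e a b ES" using le by linarith
    then have "filterlim (\<lambda>n. charpoly a b k (approach n)) at_top sequentially"
      using ab k True by (intro charpoly_threshold(1) charpoly_sign_vs_mu0(2)) auto
    then have "\<forall>\<^sub>F n in sequentially. 0 < charpoly a b k (approach n)"
      by (simp add: filterlim_at_top_dense)
    then have "\<forall>\<^sub>F n in sequentially. False"
      using eventually_approach_less[OF E1(1)]
    proof eventually_elim
      case (elim n)
      have "k < pos_root a b (approach n)"
        unfolding k_def using pos_root_strict_antimono[OF approach_gt elim(2)] .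
      then show ?case using charpoly_neg_iff[OF approach_gt k, of n] elim(1) by simp
    qed
    then show False by simp
  qed
next
  case False
  then show ?thesis using pos_root_pos[OF E] by (simp add: not_less) (metis divide_pos_pos le_less_trans zero_less_one)
qed

lemma eigenvalues_ES_opposite:
  assumes "0 < \<mu>" shows "eigenvalues_above e a b \<mu> ES = {E. m < E \<and> 1 / pos_root a b E = \<mu>}"
proof -
  have nz: "a \<noteq> 0" "b \<noteq> 0" using ab by auto
  have "charpoly a b (1 / \<mu>) E = 0 \<longleftrightarrow> 1 / pos_root a b E = \<mu>" if E: "m < E" for E
  proof -
    have "charpoly a b (1 / \<mu>) E = 0 \<longleftrightarrow> 1 / \<mu> = pos_root a b E" using pos_root_iff[OF E, of "1 / \<mu>"] assms by simp
    also have "\<dots> \<longleftrightarrow> 1 / pos_root a b E = \<mu>" using assms pos_root_pos[OF E] by (auto simp: field_simps)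
    finally show ?thesis .
  qed
  then show ?thesis unfolding eigenvalues_ES[OF nz assms] secular_iff_charpoly[OF nz] by blast
qed

lemma no_eigenvalues_ES_opposite:
  assumes "\<mu> \<in> {0<..mu0 e a b ES}" shows "eigenvalues_above e a b \<mu> ES = {}"
proof -
  have "1 / pos_root a b E \<noteq> \<mu>" if "m < E" for E
    using mu0_less_inverse_pos_root[OF that] assms by auto
  then show ?thesis using eigenvalues_ES_opposite assms by auto
qed

lemma ES_branch_opposite:
  "\<exists>E :: real \<Rightarrow> real.
    (\<forall>\<mu>>mu0 e a b ES.
       eigenvalues_above e a b \<mu> ES = {E \<mu>} \<and>
       has_multiplicity e a b \<mu> ES (E \<mu>) 1 \<and>
       (\<exists>C1 C2 :: real. eigenfunction e a b \<mu> ES (E \<mu>) (Psi_es e C1 C2 (E \<mu>)))) \<and>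
    real_analytic_on E {mu0 e a b ES<..} \<and>
    strict_mono_on {mu0 e a b ES<..} E \<and>
    convex_on {mu0 e a b ES<..} E"
proof -
  have nz: "a \<noteq> 0" "b \<noteq> 0" using ab by auto
  define \<mu>\<^sub>0 where "\<mu>\<^sub>0 = mu0 e a b ES"
  have \<mu>\<^sub>0: "0 \<le> \<mu>\<^sub>0" unfolding \<mu>\<^sub>0_def by (rule mu0_ES_nonneg)
  define M where "M = (\<lambda>E. 1 / pos_root a b E)"
  have an: "real_analytic_at M E" if "m < E" for E
    unfolding M_def using pos_root_pos[OF that]
    by (intro real_analytic_at_divide real_analytic_at_const pos_root_analytic that) auto
  have super: "\<exists>c>0. \<forall>y>m. M y \<le> M x + c * (y - x)" if x: "m < x" for x
    unfolding M_def by (rule pos_root_supergradient[OF x])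
  have der: "\<exists>d>0. (M has_real_derivative d) (at x)" if x: "m < x" for x
  proof -
    obtain c where c: "c > 0" "\<And>y. m < y \<Longrightarrow> M y \<le> M x + c * (y - x)" using super[OF x] by blast
    obtain d where d: "(M has_real_derivative d) (at x)" using an[OF x] real_analytic_at_imp_DERIV by blast
    have "d = c" by (rule supergradient_eq_derivative[OF d x c(2)])
    then show ?thesis using c(1) d by blast
  qed
  have lower: "\<mu>\<^sub>0 < M x" if "m < x" for x
    unfolding \<mu>\<^sub>0_def M_def by (rule mu0_less_inverse_pos_root[OF that])
  have low: "\<exists>x>m. M x \<le> \<mu>" if \<mu>: "\<mu>\<^sub>0 < \<mu>" for \<mu>
  proof -
    have pos: "0 < \<mu>" using \<mu> \<mu>\<^sub>0 by simp
    have "filterlim (\<lambda>n. charpoly a b (1 / \<mu>) (approach n)) at_bot sequentially"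
      using ab pos \<mu> nz by (intro charpoly_threshold(2) charpoly_sign_vs_mu0(1)) (auto simp: \<mu>\<^sub>0_def)
    then have "\<forall>\<^sub>F n in sequentially. charpoly a b (1 / \<mu>) (approach n) < 0" by (simp add: filterlim_at_bot_dense)
    then obtain n where "charpoly a b (1 / \<mu>) (approach n) < 0" by (auto simp: eventually_sequentially)
    then have "1 / \<mu> < pos_root a b (approach n)" using charpoly_neg_iff[OF approach_gt, of "1 / \<mu>"] pos by simp
    then have "M (approach n) \<le> \<mu>" using pos pos_root_pos[OF approach_gt, of n] by (simp add: M_def field_simps)
    then show ?thesis using approach_gt by blast
  qed
  have up: "\<exists>x>m. \<mu> \<le> M x" if \<mu>: "\<mu>\<^sub>0 < \<mu>" for \<mu>
  proof -
    have pos: "0 < \<mu>" using \<mu> \<mu>\<^sub>0 by simp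
    have "\<forall>\<^sub>F E in at_top. 0 < charpoly a b (1 / \<mu>) E"
      using order_tendstoD(1)[OF charpoly_at_infinity, of 0] pos by simp
    with eventually_gt_at_top[of m] have "\<forall>\<^sub>F E in at_top. m < E \<and> 0 < charpoly a b (1 / \<mu>) E"
      by eventually_elim simp
    then obtain E where E: "m < E" "0 < charpoly a b (1 / \<mu>) E" by (auto simp: eventually_at_top_linorder)
    then have "pos_root a b E \<le> 1 / \<mu>" using charpoly_neg_iff[OF E(1), of "1 / \<mu>"] pos by force
    then have "\<mu> \<le> M E" using pos pos_root_pos[OF E(1)] by (simp add: M_def field_simps)
    then show ?thesis using E(1) by blast
  qed
  obtain E where E: "\<And>\<mu>. \<mu>\<^sub>0 < \<mu> \<Longrightarrow> m < E \<mu>" "\<And>\<mu>. \<mu>\<^sub>0 < \<mu> \<Longrightarrow> M (E \<mu>) = \<mu>" "\<And>x. m < x \<Longrightarrow> E (M x) = x"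
    "real_analytic_on E {\<mu>\<^sub>0<..}" "strict_mono_on {\<mu>\<^sub>0<..} E"
    using analytic_inverse_branch[OF an der lower low up] by blast
  have conv: "convex_on {\<mu>\<^sub>0<..} E"
    using super by (intro convex_on_inverse_if_supergradient[OF E(1,2,3) lower E(5)]) blast+
  show ?thesis
  proof (intro exI[of _ E] conjI allI impI)
    fix \<mu> assume "mu0 e a b ES < \<mu>"
    then have \<mu>: "\<mu>\<^sub>0 < \<mu>" by (simp add: \<mu>\<^sub>0_def)
    then have pos: "0 < \<mu>" using \<mu>\<^sub>0 by simp
    note Em = E(1)[OF \<mu>]
    show ev: "eigenvalues_above e a b \<mu> ES = {E \<mu>}"
      unfolding eigenvalues_ES_opposite[OF pos] using E(1,2)[OF \<mu>] E(3) by (auto simp: M_def)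
    then have "E \<mu> \<in> eigenvalues_above e a b \<mu> ES" by simp
    then have sec: "secular a b (1 / \<mu>) (E \<mu>) = 0" unfolding eigenvalues_ES[OF nz pos] by simp
    have "1 / \<mu> / a \<noteq> L\<^sub>0 (E \<mu>) \<or> 1 / \<mu> / b \<noteq> L\<^sub>2 (E \<mu>)"
    proof (rule ccontr)
      assume "\<not> ?thesis"
      then have "0 < 1 / \<mu> / a" "0 < 1 / \<mu> / b" using gram_facts(1,2)[OF Em] by simp_all
      then have "0 < a" "0 < b" using pos by (simp_all add: zero_less_divide_iff zero_less_mult_iff)
      then show False using ab by (simp add: mult_less_0_iff)
    qed
    then show "has_multiplicity e a b \<mu> ES (E \<mu>) 1"
      "\<exists>C1 C2. eigenfunction e a b \<mu> ES (E \<mu>) (Psi_es e C1 C2 (E \<mu>))"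
      using simple_ES_eigenvalue[OF nz pos Em sec] by auto
  qed (use E(4,5) conv in \<open>auto simp: \<mu>\<^sub>0_def\<close>)
qed

end

end

section \<open>The even symmetric sector with positive couplings\<close>

text \<open>Where \<open>r\<close> does not vanish this is the Cauchy-Schwarz inequality for \<open>r r' = p p' + q q'\<close>. At a zero of
  \<open>r\<close> the functions \<open>p\<close> and \<open>q\<close> vanish as well, and comparing difference quotients gives equality.\<close>

lemma DERIV_eq_norm_bound:
  fixes r p q :: "real \<Rightarrow> real"
  assumes r: "(r has_real_derivative r') (at x)" and p: "(p has_real_derivative p') (at x)"
    and q: "(q has_real_derivative q') (at x)"
    and eq: "\<forall>\<^sub>F y in nhds x. (r y)\<^sup>2 = (p y)\<^sup>2 + (q y)\<^sup>2"
  shows "r'\<^sup>2 \<le> p'\<^sup>2 + q'\<^sup>2"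
proof (cases "r x = 0")
  case True
  have "(r x)\<^sup>2 = (p x)\<^sup>2 + (q x)\<^sup>2" using eventually_nhds_x_imp_x[OF eq] .
  then have z: "p x = 0" "q x = 0" using True by (simp_all add: sum_power2_eq_zero_iff)
  have lim: "((\<lambda>y. (f y / (y - x))\<^sup>2) \<longlongrightarrow> f'\<^sup>2) (at x)" if "(f has_real_derivative f') (at x)" "f x = 0" for f f'
    using that by (intro tendsto_power) (simp add: has_field_derivative_iff)
  have "((\<lambda>y. (p y / (y - x))\<^sup>2 + (q y / (y - x))\<^sup>2) \<longlongrightarrow> p'\<^sup>2 + q'\<^sup>2) (at x)"
    by (intro tendsto_add lim p q z)
  moreover have "\<forall>\<^sub>F y in at x. (r y / (y - x))\<^sup>2 = (p y / (y - x))\<^sup>2 + (q y / (y - x))\<^sup>2"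
    using eq unfolding eventually_nhds_conv_at
    by (auto elim!: eventually_mono simp: power_divide add_divide_distrib)
  then have "((\<lambda>y. (p y / (y - x))\<^sup>2 + (q y / (y - x))\<^sup>2) \<longlongrightarrow> r'\<^sup>2) (at x)"
    by (rule Lim_transform_eventually[OF lim[OF r True]])
  ultimately have "r'\<^sup>2 = p'\<^sup>2 + q'\<^sup>2" using tendsto_unique[OF trivial_limit_at] by blast
  then show ?thesis by simp
next
  case False
  have "((\<lambda>y. (p y)\<^sup>2 + (q y)\<^sup>2) has_real_derivative 2 * r x * r') (at x)"
  proof (rule DERIV_cong_ev[OF refl eq refl, THEN iffD1])
    show "((\<lambda>y. (r y)\<^sup>2) has_real_derivative 2 * r x * r') (at x)"
      using r by (auto intro!: derivative_eq_intros)
  qed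
  moreover have "((\<lambda>y. (p y)\<^sup>2 + (q y)\<^sup>2) has_real_derivative 2 * p x * p' + 2 * q x * q') (at x)"
    using p q by (auto intro!: derivative_eq_intros)
  ultimately have rr: "r x * r' = p x * p' + q x * q'" using DERIV_unique by fastforce
  have sq: "(r x)\<^sup>2 = (p x)\<^sup>2 + (q x)\<^sup>2" using eventually_nhds_x_imp_x[OF eq] .
  have "(r x)\<^sup>2 * r'\<^sup>2 = (p x * p' + q x * q')\<^sup>2" by (simp add: power_mult_distrib flip: rr)
  also have "\<dots> \<le> ((p x)\<^sup>2 + (q x)\<^sup>2) * (p'\<^sup>2 + q'\<^sup>2)"
    using zero_le_power2[of "p x * q' - q x * p'"] by (simp add: power2_eq_square algebra_simps)
  finally have "(r x)\<^sup>2 * r'\<^sup>2 \<le> (r x)\<^sup>2 * (p'\<^sup>2 + q'\<^sup>2)" by (simp only: sq)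
  then show ?thesis using False by (simp add: mult_le_cancel_left_pos)
qed

context threshold_dispersion
begin

text \<open>The eigenvalues of the symmetric matrix with diagonal \<open>a L\<^sub>0\<close>, \<open>b L\<^sub>2\<close> and off-diagonal entry
  \<open>sqrt (a b) L\<^sub>1\<close> are \<open>(t \<plusminus> r) / 2\<close>. They may cross, so \<open>r\<close> is an analytic square root of the discriminant
  that may change sign. Close to the threshold there is no crossing because \<open>L\<^sub>1\<close> tends to \<open>- \<infinity>\<close>, and
  there \<open>r\<close> is normalised to be positive.\<close>

lemma analytic_eigenvalue_difference:
  assumes a: "0 < a" and b: "0 < b"
  obtains r N where "\<And>E. m < E \<Longrightarrow> real_analytic_at r E"
    "\<And>E. m < E \<Longrightarrow> (r E)\<^sup>2 = (a * L\<^sub>0 E - b * L\<^sub>2 E)\<^sup>2 + 4 * (a * b) * (L\<^sub>1 E)\<^sup>2"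
    "\<And>E. m < E \<Longrightarrow> E \<le> approach N \<Longrightarrow> 0 < r E"
proof -
  define s where "s = 2 * sqrt (a * b)"
  have s: "0 < s" "s\<^sup>2 = 4 * (a * b)" using a b by (auto simp: s_def power_mult_distrib)
  define h where "h = (\<lambda>z. of_real a * cres (\<lambda>_. 1) z - of_real b * cres (\<lambda>p. (cos_sum p)\<^sup>2) z
      + \<i> * (of_real s * cres cos_sum z))"
  have h_real: "h (of_real E) = Complex (a * L\<^sub>0 E - b * L\<^sub>2 E) (s * L\<^sub>1 E)" for E
    by (simp add: h_def cres_of_real complex_eq_iff)
  have hol: "h holomorphic_on {z. Re z > m}"
    unfolding h_def by (intro holomorphic_intros cres_holomorphic gram_continuous)
  obtain K where K: "\<And>p. weight ES p \<le> K * (m - e p)" using weight_ES_bound by blast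
  have "\<forall>\<^sub>F n in sequentially. res (weight ES) m < L\<^sub>0 (approach n)"
    using res_unbounded[OF not_integrable_threshold] by (simp add: filterlim_at_top_dense)
  then obtain N where N: "res (weight ES) m < L\<^sub>0 (approach N)" by (auto simp: eventually_sequentially)
  have L1: "L\<^sub>1 E < 0" if E: "m < E" "E \<le> approach N" for E
  proof -
    have "res (weight ES) E \<le> res (weight ES) m"
      by (rule res_le_threshold[OF continuous_weight weight_ES_range(1) K E(1)])
    moreover have "L\<^sub>0 (approach N) \<le> L\<^sub>0 E"
      using res_strict_antimono[OF gram_continuous(1) _ weight_nonzero(1) _ E(1), of "approach N"] E(2)
      by (cases "E = approach N") auto
    ultimately show ?thesis using gram_shift(1)[OF E(1)] gram_facts(1)[OF E(1)] N by linarith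
  qed
  have \<delta>: "0 < approach N - m" using approach_gt[of N] by simp
  have nz: "h (of_real E) \<noteq> 0" if "m < E" "E \<le> m + (approach N - m)" for E
    using L1[of E] that s(1) by (simp add: h_real complex_eq_iff)
  obtain r where r: "\<And>x. m < x \<Longrightarrow> real_analytic_at r x" "\<And>x. m < x \<Longrightarrow> \<bar>r x\<bar> = norm (h (of_real x))"
    "\<And>x. m < x \<Longrightarrow> x \<le> m + (approach N - m) \<Longrightarrow> r x > 0"
    using analytic_signed_norm[OF hol \<delta> nz] by metis
  have "(r E)\<^sup>2 = (a * L\<^sub>0 E - b * L\<^sub>2 E)\<^sup>2 + 4 * (a * b) * (L\<^sub>1 E)\<^sup>2" if E: "m < E" for E
  proof -
    have "(r E)\<^sup>2 = (norm (h (of_real E)))\<^sup>2" using r(2)[OF E] by (metis power2_abs)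
    then show ?thesis by (simp add: h_real cmod_power2 power_mult_distrib s(2))
  qed
  then show ?thesis using r(1,3) by (intro that[of r N]) auto
qed

text \<open>Both analytic eigenvalue branches \<open>\<kappa>1\<close>, \<open>\<kappa>2\<close> of the positive definite matrix decrease strictly, also
  through crossings: \<open>\<bar>r'\<bar> < - t'\<close>, since the Gram determinant of the derivatives is positive. Near the
  threshold \<open>\<kappa>1\<close> tends to infinity, which produces an eigenvalue for every coupling, whereas \<open>\<kappa>2\<close> stays
  below \<open>1 / mu0\<close>. A double eigenvalue occurs exactly when the branches meet.\<close>

lemma ES_branches_positive:
  assumes a: "0 < a" and b: "0 < b"
  shows "\<exists>E1 E2 :: real \<Rightarrow> real.
        (\<forall>\<mu>\<in>{0<..mu0 e a b ES}.
           eigenvalues_above e a b \<mu> ES = {E1 \<mu>} \<and>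
           has_multiplicity e a b \<mu> ES (E1 \<mu>) 1 \<and>
           (\<exists>C1 C2 :: real. eigenfunction e a b \<mu> ES (E1 \<mu>) (Psi_es e C1 C2 (E1 \<mu>)))) \<and>
        (\<forall>\<mu>>mu0 e a b ES.
           eigenvalues_above e a b \<mu> ES = {E1 \<mu>, E2 \<mu>} \<and>
           (\<forall>E\<in>{E1 \<mu>, E2 \<mu>}.
              has_multiplicity e a b \<mu> ES E (if E1 \<mu> = E2 \<mu> then 2 else 1)) \<and>
           (\<exists>C11 C21 C12 C22 :: real.
              eigenfunction e a b \<mu> ES (E1 \<mu>) (Psi_es e C11 C21 (E1 \<mu>)) \<and>
              eigenfunction e a b \<mu> ES (E2 \<mu>) (Psi_es e C12 C22 (E2 \<mu>)) \<and>
              ae_lin_indep [Psi_es e C11 C21 (E1 \<mu>), Psi_es e C12 C22 (E2 \<mu>)])) \<and>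
        real_analytic_on E1 {0<..} \<and> strict_mono_on {0<..} E1 \<and>
        real_analytic_on E2 {mu0 e a b ES<..} \<and> strict_mono_on {mu0 e a b ES<..} E2"
proof -
  have nz: "a \<noteq> 0" "b \<noteq> 0" using a b by auto
  define \<mu>\<^sub>0 where "\<mu>\<^sub>0 = mu0 e a b ES"
  have \<mu>\<^sub>0: "0 < \<mu>\<^sub>0" unfolding \<mu>\<^sub>0_def by (rule mu0_ES_pos[OF a b])
  obtain r N where r_an: "\<And>E. m < E \<Longrightarrow> real_analytic_at r E"
    and r_sq: "\<And>E. m < E \<Longrightarrow> (r E)\<^sup>2 = (a * L\<^sub>0 E - b * L\<^sub>2 E)\<^sup>2 + 4 * (a * b) * (L\<^sub>1 E)\<^sup>2"
    and r_pos: "\<And>E. m < E \<Longrightarrow> E \<le> approach N \<Longrightarrow> 0 < r E"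
    using analytic_eigenvalue_difference[OF a b] by blast
  define t where "t = trace a b"
  define \<kappa>1 where "\<kappa>1 = (\<lambda>E. (t E + r E) / 2)"
  define \<kappa>2 where "\<kappa>2 = (\<lambda>E. (t E - r E) / 2)"
  have sum: "\<kappa>1 E + \<kappa>2 E = t E" and diff: "\<kappa>1 E - \<kappa>2 E = r E" for E by (auto simp: \<kappa>1_def \<kappa>2_def field_simps)
  have t_pos: "0 < t E" if "m < E" for E
    using gram_facts(1,2)[OF that] a b by (simp add: t_def trace_def add_pos_pos)
  have prod: "\<kappa>1 E * \<kappa>2 E = a * b * gram_det E" if E: "m < E" for E
  proof -
    have "\<kappa>1 E * \<kappa>2 E = ((t E)\<^sup>2 - (r E)\<^sup>2) / 4" by (simp add: \<kappa>1_def \<kappa>2_def power2_eq_square field_simps)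
    also have "\<dots> = a * b * gram_det E"
      unfolding r_sq[OF E] t_def trace_def gram_det_def by (simp add: power2_eq_square field_simps)
    finally show ?thesis .
  qed
  have char: "charpoly a b k E = (k - \<kappa>1 E) * (k - \<kappa>2 E)" if E: "m < E" for k E
  proof -
    have "charpoly a b k E = k\<^sup>2 - (\<kappa>1 E + \<kappa>2 E) * k + \<kappa>1 E * \<kappa>2 E"
      unfolding charpoly_def sum prod[OF E] t_def by simp
    then show ?thesis by (simp add: power2_eq_square algebra_simps)
  qed
  have \<kappa>_pos: "0 < \<kappa>1 E" "0 < \<kappa>2 E" if E: "m < E" for E
  proof -
    have p: "0 < \<kappa>1 E * \<kappa>2 E" unfolding prod[OF E] using a b gram_det_pos[OF E] by simp
    moreover have "0 < \<kappa>1 E + \<kappa>2 E" unfolding sum by (rule t_pos[OF E])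
    ultimately show "0 < \<kappa>1 E" "0 < \<kappa>2 E" by (auto simp: zero_less_mult_iff)
  qed
  have an\<kappa>: "real_analytic_at \<kappa>1 E" "real_analytic_at \<kappa>2 E" if "m < E" for E
    unfolding \<kappa>1_def \<kappa>2_def t_def
    by (intro real_analytic_at_divide real_analytic_at_add real_analytic_at_diff real_analytic_at_const
        trace_analytic r_an that; simp)+
  have der\<kappa>: "\<exists>d<0. (\<kappa>1 has_real_derivative d) (at E)" "\<exists>d<0. (\<kappa>2 has_real_derivative d) (at E)" if E: "m < E" for E
  proof -
    define s where "s = 2 * sqrt (a * b)"
    have s: "s\<^sup>2 = 4 * (a * b)" using a b by (auto simp: s_def power_mult_distrib)
    obtain r' where r': "(r has_real_derivative r') (at E)" using r_an[OF E] real_analytic_at_imp_DERIV by blast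
    define t' where "t' = - (a * G\<^sub>0 E + b * G\<^sub>2 E)"
    define p' where "p' = - (a * G\<^sub>0 E - b * G\<^sub>2 E)"
    define q' where "q' = - (s * G\<^sub>1 E)"
    note D = res_DERIV[OF gram_continuous(1) E] res_DERIV[OF gram_continuous(2) E] res_DERIV[OF gram_continuous(3) E]
    have dt: "(t has_real_derivative t') (at E)"
      unfolding t_def trace_def[abs_def] t'_def by (rule derivative_eq_intros D refl | simp)+
    have dp: "((\<lambda>E. a * L\<^sub>0 E - b * L\<^sub>2 E) has_real_derivative p') (at E)"
      unfolding p'_def by (rule derivative_eq_intros D refl | simp)+
    have dq: "((\<lambda>E. s * L\<^sub>1 E) has_real_derivative q') (at E)"
      unfolding q'_def by (rule derivative_eq_intros D refl | simp)+
    have "\<forall>\<^sub>F y in nhds E. m < y" using eventually_nhds_in_open[of "{m<..}" E] E by simp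
    then have "\<forall>\<^sub>F y in nhds E. (r y)\<^sup>2 = (a * L\<^sub>0 y - b * L\<^sub>2 y)\<^sup>2 + (s * L\<^sub>1 y)\<^sup>2"
      by eventually_elim (simp add: r_sq power_mult_distrib s)
    from DERIV_eq_norm_bound[OF r' dp dq this] have "r'\<^sup>2 \<le> p'\<^sup>2 + q'\<^sup>2" .
    also have "\<dots> < t'\<^sup>2"
    proof -
      have "t'\<^sup>2 - (p'\<^sup>2 + q'\<^sup>2) = 4 * (a * b) * (G\<^sub>0 E * G\<^sub>2 E - (G\<^sub>1 E)\<^sup>2)"
        unfolding t'_def p'_def q'_def power2_minus power_mult_distrib s
        by (simp add: power2_eq_square algebra_simps)
      moreover have "0 < 4 * (a * b) * (G\<^sub>0 E * G\<^sub>2 E - (G\<^sub>1 E)\<^sup>2)"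
        using a b gram_facts(6)[OF E] by simp
      ultimately show ?thesis by linarith
    qed
    finally have "\<bar>r'\<bar> < \<bar>t'\<bar>" by (metis abs_le_square_iff not_le)
    moreover have "0 < a * G\<^sub>0 E + b * G\<^sub>2 E"
      using a b gram_facts(3,4)[OF E] by (intro add_pos_pos mult_pos_pos)
    then have "t' < 0" by (simp only: t'_def neg_less_0_iff_less)
    ultimately have neg: "(t' + r') / 2 < 0" "(t' - r') / 2 < 0" by auto
    have "(\<kappa>1 has_real_derivative (t' + r') / 2) (at E)" "(\<kappa>2 has_real_derivative (t' - r') / 2) (at E)"
      unfolding \<kappa>1_def \<kappa>2_def using dt r' by (auto intro!: derivative_eq_intros)
    then show "\<exists>d<0. (\<kappa>1 has_real_derivative d) (at E)" "\<exists>d<0. (\<kappa>2 has_real_derivative d) (at E)"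
      using neg by blast+
  qed
  have inverse_der: "\<exists>d>0. ((\<lambda>E. 1 / f E) has_real_derivative d) (at E)"
    if f: "\<exists>d<0. (f has_real_derivative d) (at E)" "0 < f E" for f :: "real \<Rightarrow> real" and E
  proof -
    obtain d where d: "d < 0" "(f has_real_derivative d) (at E)" using f(1) by blast
    have "((\<lambda>E. 1 / f E) has_real_derivative - d / (f E)\<^sup>2) (at E)"
      using d(2) f(2) by (auto intro!: derivative_eq_intros simp: power2_eq_square)
    moreover have "0 < - d / (f E)\<^sup>2" using d(1) f(2) by (intro divide_pos_pos) auto
    ultimately show ?thesis by blast
  qed
  define M1 where "M1 = (\<lambda>E. 1 / \<kappa>1 E)"
  define M2 where "M2 = (\<lambda>E. 1 / \<kappa>2 E)"
  have an: "real_analytic_at M1 E" "real_analytic_at M2 E" if "m < E" for E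
    unfolding M1_def M2_def using \<kappa>_pos[OF that] an\<kappa>[OF that]
    by (auto intro!: real_analytic_at_divide real_analytic_at_const)
  have der: "\<exists>d>0. (M1 has_real_derivative d) (at E)" "\<exists>d>0. (M2 has_real_derivative d) (at E)" if "m < E" for E
    unfolding M1_def M2_def by (intro inverse_der der\<kappa> \<kappa>_pos that)+
  have M_eq: "M1 E = \<mu> \<longleftrightarrow> \<kappa>1 E = 1 / \<mu>" "M2 E = \<mu> \<longleftrightarrow> \<kappa>2 E = 1 / \<mu>" if "m < E" "0 < \<mu>" for E \<mu>
    using \<kappa>_pos[OF that(1)] that(2) by (auto simp: M1_def M2_def field_simps)
  have up: "\<exists>x>m. \<mu> \<le> M1 x \<and> \<mu> \<le> M2 x" if \<mu>: "0 < \<mu>" for \<mu>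
  proof -
    have "(t \<longlongrightarrow> 0) at_top" unfolding t_def trace_def[abs_def]
      by (rule tendsto_eq_intros res_tendsto_0 gram_continuous refl | simp)+
    then have "\<forall>\<^sub>F E in at_top. t E < 1 / \<mu>" using \<mu> by (intro order_tendstoD) auto
    with eventually_gt_at_top[of m] have "\<forall>\<^sub>F E in at_top. m < E \<and> t E < 1 / \<mu>" by eventually_elim simp
    then obtain E where E: "m < E" "t E < 1 / \<mu>" by (auto simp: eventually_at_top_linorder)
    have "\<kappa>1 E < 1 / \<mu>" "\<kappa>2 E < 1 / \<mu>" using \<kappa>_pos[OF E(1)] E(2) sum[of E] by linarith+
    then have "\<mu> \<le> M1 E" "\<mu> \<le> M2 E" using \<kappa>_pos[OF E(1)] \<mu> by (simp_all add: M1_def M2_def field_simps)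
    then show ?thesis using E(1) by blast
  qed
  have near: "\<forall>\<^sub>F n in sequentially. k < \<kappa>1 (approach n)" for k
  proof -
    have "\<forall>\<^sub>F n in sequentially. 2 * k / a < L\<^sub>0 (approach n)"
      using res_unbounded[OF not_integrable_threshold] by (simp add: filterlim_at_top_dense)
    then show ?thesis
      using eventually_ge_at_top[of N]
    proof eventually_elim
      case (elim n)
      have "2 * k < a * L\<^sub>0 (approach n)" using elim(1) a by (simp add: field_simps)
      moreover have "0 < b * L\<^sub>2 (approach n)" using gram_facts(2)[OF approach_gt] b by simp
      moreover have "0 < r (approach n)" by (rule r_pos[OF approach_gt approach_decseq[OF elim(2)]])
      ultimately show ?case by (simp add: \<kappa>1_def t_def trace_def)
    qed
  qed
  have lower2: "\<mu>\<^sub>0 < M2 E" if E: "m < E" for E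
  proof (rule ccontr)
    assume "\<not> ?thesis"
    then have le: "M2 E \<le> \<mu>\<^sub>0" by simp
    define E1 where "E1 = (m + E) / 2"
    have E1: "m < E1" "E1 < E" using E by (auto simp: E1_def)
    have anti: "\<kappa>2 y < \<kappa>2 x" if "m < x" "x < y" for x y
    proof (rule DERIV_neg_imp_decreasing[OF that(2)])
      fix z assume "x \<le> z" "z \<le> y"
      then have "m < z" using that(1) by linarith
      then show "\<exists>d. (\<kappa>2 has_real_derivative d) (at z) \<and> d < 0" using der\<kappa>(2) by blast
    qed
    define k where "k = \<kappa>2 E1"
    have k: "0 < k" using \<kappa>_pos[OF E1(1)] by (simp add: k_def)
    have "1 / k < M2 E"
      using anti[OF E1] \<kappa>_pos[OF E] k by (simp add: k_def M2_def field_simps)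
    then have "1 / k < mu0 e a b ES" using le by (simp add: \<mu>\<^sub>0_def)
    then have "filterlim (\<lambda>n. charpoly a b k (approach n)) at_bot sequentially"
      using a b k nz by (intro charpoly_threshold(2) charpoly_sign_vs_mu0(4)) auto
    then have "\<forall>\<^sub>F n in sequentially. charpoly a b k (approach n) < 0"
      by (simp add: filterlim_at_bot_dense)
    then have "\<forall>\<^sub>F n in sequentially. False"
      using eventually_approach_less[OF E1(1)] near[of k]
    proof eventually_elim
      case (elim n)
      have "k < \<kappa>2 (approach n)" unfolding k_def using anti[OF approach_gt elim(2)] .
      then have "0 < (k - \<kappa>1 (approach n)) * (k - \<kappa>2 (approach n))" using elim(3) by (intro mult_neg_neg) auto
      then show ?case using char[OF approach_gt, of k n] elim(1) by simp
    qed
    then show False by simp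
  qed
  have lower1: "0 < M1 E" if "m < E" for E using \<kappa>_pos[OF that] by (simp add: M1_def)
  have low1: "\<exists>x>m. M1 x \<le> \<mu>" if \<mu>: "0 < \<mu>" for \<mu>
  proof -
    obtain n where "1 / \<mu> < \<kappa>1 (approach n)" using near[of "1 / \<mu>"] by (auto simp: eventually_sequentially)
    then have "M1 (approach n) \<le> \<mu>" using \<mu> \<kappa>_pos[OF approach_gt, of n] by (simp add: M1_def field_simps)
    then show ?thesis using approach_gt by blast
  qed
  have low2: "\<exists>x>m. M2 x \<le> \<mu>" if \<mu>: "\<mu>\<^sub>0 < \<mu>" for \<mu>
  proof -
    have pos: "0 < \<mu>" using \<mu> \<mu>\<^sub>0 by simp
    have "filterlim (\<lambda>n. charpoly a b (1 / \<mu>) (approach n)) at_top sequentially"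
      using a b pos \<mu> nz by (intro charpoly_threshold(1) charpoly_sign_vs_mu0(3)) (auto simp: \<mu>\<^sub>0_def)
    then have "\<forall>\<^sub>F n in sequentially. 0 < charpoly a b (1 / \<mu>) (approach n)" by (simp add: filterlim_at_top_dense)
    with near[of "1 / \<mu>"] have "\<forall>\<^sub>F n in sequentially. 1 / \<mu> < \<kappa>1 (approach n) \<and> 0 < charpoly a b (1 / \<mu>) (approach n)"
      by eventually_elim simp
    then obtain n where n: "1 / \<mu> < \<kappa>1 (approach n)" "0 < charpoly a b (1 / \<mu>) (approach n)"
      by (auto simp: eventually_sequentially)
    then have "1 / \<mu> < \<kappa>2 (approach n)" unfolding char[OF approach_gt] by (simp add: zero_less_mult_iff)
    then have "M2 (approach n) \<le> \<mu>" using pos \<kappa>_pos[OF approach_gt, of n] by (simp add: M2_def field_simps)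
    then show ?thesis using approach_gt by blast
  qed
  have up1: "\<exists>x>m. \<mu> \<le> M1 x" if "0 < \<mu>" for \<mu> using up[OF that] by blast
  have up2: "\<exists>x>m. \<mu> \<le> M2 x" if "\<mu>\<^sub>0 < \<mu>" for \<mu> using up[of \<mu>] that \<mu>\<^sub>0 by auto
  obtain E1 where E1: "\<And>\<mu>. 0 < \<mu> \<Longrightarrow> m < E1 \<mu>" "\<And>\<mu>. 0 < \<mu> \<Longrightarrow> M1 (E1 \<mu>) = \<mu>" "\<And>x. m < x \<Longrightarrow> E1 (M1 x) = x"
    "real_analytic_on E1 {0<..}" "strict_mono_on {0<..} E1"
    using analytic_inverse_branch[OF an(1) der(1) lower1 low1 up1] by blast
  obtain E2 where E2: "\<And>\<mu>. \<mu>\<^sub>0 < \<mu> \<Longrightarrow> m < E2 \<mu>" "\<And>\<mu>. \<mu>\<^sub>0 < \<mu> \<Longrightarrow> M2 (E2 \<mu>) = \<mu>" "\<And>x. m < x \<Longrightarrow> E2 (M2 x) = x"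
    "real_analytic_on E2 {\<mu>\<^sub>0<..}" "strict_mono_on {\<mu>\<^sub>0<..} E2"
    using analytic_inverse_branch[OF an(2) der(2) lower2 low2 up2] by blast
  have ev: "eigenvalues_above e a b \<mu> ES = {E. m < E \<and> (M1 E = \<mu> \<or> M2 E = \<mu>)}" if \<mu>: "0 < \<mu>" for \<mu>
  proof -
    have "charpoly a b (1 / \<mu>) E = 0 \<longleftrightarrow> M1 E = \<mu> \<or> M2 E = \<mu>" if E: "m < E" for E
      unfolding M_eq[OF E \<mu>] char[OF E] by auto
    then show ?thesis unfolding eigenvalues_ES[OF nz \<mu>] secular_iff_charpoly[OF nz] by blast
  qed
  have sec: "secular a b (1 / \<mu>) E = 0" if "0 < \<mu>" "E \<in> eigenvalues_above e a b \<mu> ES" for \<mu> E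
    using that(2) unfolding eigenvalues_ES[OF nz that(1)] by simp
  \<comment> \<open>The matrix of the linear system vanishes exactly at a crossing of the two branches.\<close>
  have double_iff: "1 / \<mu> / a = L\<^sub>0 E \<and> 1 / \<mu> / b = L\<^sub>2 E \<longleftrightarrow> M1 E = \<mu> \<and> M2 E = \<mu>"
    if \<mu>: "0 < \<mu>" and E: "m < E" and sec: "secular a b (1 / \<mu>) E = 0" for \<mu> E
  proof
    assume *: "1 / \<mu> / a = L\<^sub>0 E \<and> 1 / \<mu> / b = L\<^sub>2 E"
    then have L1: "L\<^sub>1 E = 0" using sec by (simp add: secular_def)
    have "a * (1 / \<mu> / a) = 1 / \<mu>" "b * (1 / \<mu> / b) = 1 / \<mu>" using nz by simp_all
    then have aL: "a * L\<^sub>0 E = 1 / \<mu>" "b * L\<^sub>2 E = 1 / \<mu>" by (simp_all only: *)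
    then have "r E = 0" using r_sq[OF E] L1 by simp
    then have "\<kappa>1 E = 1 / \<mu>" "\<kappa>2 E = 1 / \<mu>" using aL by (simp_all add: \<kappa>1_def \<kappa>2_def t_def trace_def)
    then show "M1 E = \<mu> \<and> M2 E = \<mu>" using M_eq[OF E \<mu>] by simp
  next
    assume "M1 E = \<mu> \<and> M2 E = \<mu>"
    then have \<kappa>: "\<kappa>1 E = 1 / \<mu>" "\<kappa>2 E = 1 / \<mu>" using M_eq[OF E \<mu>] by auto
    then have "r E = 0" using diff[of E] by simp
    then have "(a * L\<^sub>0 E - b * L\<^sub>2 E)\<^sup>2 + 4 * (a * b) * (L\<^sub>1 E)\<^sup>2 = 0" using r_sq[OF E] by simp
    moreover have "0 \<le> 4 * (a * b) * (L\<^sub>1 E)\<^sup>2" using a b by simp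
    moreover have "0 \<le> (a * L\<^sub>0 E - b * L\<^sub>2 E)\<^sup>2" by simp
    ultimately have "(a * L\<^sub>0 E - b * L\<^sub>2 E)\<^sup>2 = 0" by linarith
    then have "a * L\<^sub>0 E = b * L\<^sub>2 E" by simp
    moreover have "a * L\<^sub>0 E + b * L\<^sub>2 E = 1 / \<mu> + 1 / \<mu>" using sum[of E] \<kappa> by (simp add: t_def trace_def)
    ultimately have "a * L\<^sub>0 E = 1 / \<mu>" "b * L\<^sub>2 E = 1 / \<mu>" by linarith+
    then show "1 / \<mu> / a = L\<^sub>0 E \<and> 1 / \<mu> / b = L\<^sub>2 E" using nz by (metis nonzero_mult_div_cancel_left)
  qed
  have subcritical: "eigenvalues_above e a b \<mu> ES = {E1 \<mu>} \<and> has_multiplicity e a b \<mu> ES (E1 \<mu>) 1 \<and>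
      (\<exists>C1 C2 :: real. eigenfunction e a b \<mu> ES (E1 \<mu>) (Psi_es e C1 C2 (E1 \<mu>)))"
    if "\<mu> \<in> {0<..mu0 e a b ES}" for \<mu>
  proof -
    from that have \<mu>: "0 < \<mu>" "\<mu> \<le> \<mu>\<^sub>0" by (auto simp: \<mu>\<^sub>0_def)
    note Em = E1(1)[OF \<mu>(1)]
    have M2: "M2 E \<noteq> \<mu>" if "m < E" for E using lower2[OF that] \<mu>(2) by simp
    have e1: "eigenvalues_above e a b \<mu> ES = {E1 \<mu>}"
      unfolding ev[OF \<mu>(1)] using M2 E1(1,2)[OF \<mu>(1)] E1(3) by auto
    have s: "secular a b (1 / \<mu>) (E1 \<mu>) = 0" by (rule sec[OF \<mu>(1)]) (simp add: e1)
    have ne: "1 / \<mu> / a \<noteq> L\<^sub>0 (E1 \<mu>) \<or> 1 / \<mu> / b \<noteq> L\<^sub>2 (E1 \<mu>)"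
      using double_iff[OF \<mu>(1) Em s] M2[OF Em] by blast
    show ?thesis using e1 simple_ES_eigenvalue[OF nz \<mu>(1) Em s ne] by blast
  qed
  have supercritical: "eigenvalues_above e a b \<mu> ES = {E1 \<mu>, E2 \<mu>} \<and>
      (\<forall>E\<in>{E1 \<mu>, E2 \<mu>}. has_multiplicity e a b \<mu> ES E (if E1 \<mu> = E2 \<mu> then 2 else 1)) \<and>
      (\<exists>C11 C21 C12 C22 :: real.
              eigenfunction e a b \<mu> ES (E1 \<mu>) (Psi_es e C11 C21 (E1 \<mu>)) \<and>
              eigenfunction e a b \<mu> ES (E2 \<mu>) (Psi_es e C12 C22 (E2 \<mu>)) \<and>
              ae_lin_indep [Psi_es e C11 C21 (E1 \<mu>), Psi_es e C12 C22 (E2 \<mu>)])"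
    if "mu0 e a b ES < \<mu>" for \<mu>
  proof -
    from that have \<mu>: "\<mu>\<^sub>0 < \<mu>" by (simp add: \<mu>\<^sub>0_def)
    have pos: "0 < \<mu>" using \<mu> \<mu>\<^sub>0 by simp
    note Em = E1(1)[OF pos] E2(1)[OF \<mu>]
    have e12: "eigenvalues_above e a b \<mu> ES = {E1 \<mu>, E2 \<mu>}"
      unfolding ev[OF pos] using E1(1,2)[OF pos] E1(3) E2(1,2)[OF \<mu>] E2(3) by auto
    have s: "secular a b (1 / \<mu>) (E1 \<mu>) = 0" "secular a b (1 / \<mu>) (E2 \<mu>) = 0"
      by (rule sec[OF pos], simp add: e12)+
    have "(\<forall>E\<in>{E1 \<mu>, E2 \<mu>}. has_multiplicity e a b \<mu> ES E (if E1 \<mu> = E2 \<mu> then 2 else 1)) \<and>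
      (\<exists>C11 C21 C12 C22 :: real.
              eigenfunction e a b \<mu> ES (E1 \<mu>) (Psi_es e C11 C21 (E1 \<mu>)) \<and>
              eigenfunction e a b \<mu> ES (E2 \<mu>) (Psi_es e C12 C22 (E2 \<mu>)) \<and>
              ae_lin_indep [Psi_es e C11 C21 (E1 \<mu>), Psi_es e C12 C22 (E2 \<mu>)])"
    proof (cases "E1 \<mu> = E2 \<mu>")
      case True
      have dbl: "1 / \<mu> / a = L\<^sub>0 (E1 \<mu>)" "1 / \<mu> / b = L\<^sub>2 (E1 \<mu>)"
        using double_iff[OF pos Em(1) s(1)] E1(2)[OF pos] E2(2)[OF \<mu>] True by auto
      then have "L\<^sub>1 (E1 \<mu>) = 0" using s(1) by (simp add: secular_def)
      note D = double_ES_eigenvalue[OF nz pos Em(1) dbl this]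
      show ?thesis unfolding True[symmetric] using D by auto
    next
      case False
      have ne: "1 / \<mu> / a \<noteq> L\<^sub>0 (E1 \<mu>) \<or> 1 / \<mu> / b \<noteq> L\<^sub>2 (E1 \<mu>)"
        using double_iff[OF pos Em(1) s(1)] E2(3)[OF Em(1)] False by auto
      have ne': "1 / \<mu> / a \<noteq> L\<^sub>0 (E2 \<mu>) \<or> 1 / \<mu> / b \<noteq> L\<^sub>2 (E2 \<mu>)"
        using double_iff[OF pos Em(2) s(2)] E1(3)[OF Em(2)] False by auto
      note S = simple_ES_eigenvalue[OF nz pos Em(1) s(1) ne] simple_ES_eigenvalue[OF nz pos Em(2) s(2) ne']
      obtain C11 C21 where C1: "eigenfunction e a b \<mu> ES (E1 \<mu>) (Psi_es e C11 C21 (E1 \<mu>))" using S(2) by blast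
      obtain C12 C22 where C2: "eigenfunction e a b \<mu> ES (E2 \<mu>) (Psi_es e C12 C22 (E2 \<mu>))" using S(4) by blast
      show ?thesis using S(1,3) C1 C2 ae_lin_indep_distinct_eigenvalues[OF C1 C2 False] False by auto
    qed
    then show ?thesis using e12 by blast
  qed
  show ?thesis
    using subcritical supercritical E1(4,5) E2(4,5) unfolding \<mu>\<^sub>0_def
    by (intro exI[of _ E1] exI[of _ E2]) simp
qed

end

theorem theorem3p1:
  fixes ehat :: "int \<times> int \<Rightarrow> complex"
    and e :: "real \<times> real \<Rightarrow> real"
    and a b :: real
  assumes ehat_l1: "(\<lambda>x. cmod (ehat x)) summable_on UNIV"
    and ehat_hermitian: "\<And>x. ehat x = cnj (ehat (- x))"
    and e_fourier: "\<And>p. complex_of_real (e p) = fourier_sum ehat p"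
    and e_even: "\<And>p. e (- p) = e p"
    and e_symmetric: "\<And>p1 p2. e (p1, p2) = e (p2, p1)"
    and e_unique_max: "\<And>p. p \<in> torus \<Longrightarrow> p \<noteq> (pi, pi) \<Longrightarrow> e p < e (pi, pi)"
    and e_nondegenerate: "negative_definite_hessian_at e (pi, pi)"
    and e_analytic: "\<forall>\<^sub>F p in nhds (pi, pi). real_analytic2_at e p"
    and a_nz: "a \<noteq> 0"
    and b_nz: "b \<noteq> 0"
  shows
    "(\<forall>\<omega>\<in>{OS, OA, EA}.
        \<comment> \<open>(a.i)\<close>
        (\<forall>\<mu>. (b < 0 \<and> \<mu> > 0) \<or> (b > 0 \<and> \<mu> \<in> {0<..mu0 e a b \<omega>}) \<longrightarrow>
           eigenvalues_above e a b \<mu> \<omega> = {}) \<and>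
        \<comment> \<open>(a.ii)\<close>
        (b > 0 \<longrightarrow> (\<exists>E :: real \<Rightarrow> real.
           (\<forall>\<mu>>mu0 e a b \<omega>.
              eigenvalues_above e a b \<mu> \<omega> = {E \<mu>} \<and>
              has_multiplicity e a b \<mu> \<omega> (E \<mu>) 1 \<and>
              eigenfunction e a b \<mu> \<omega> (E \<mu>) (Psi e \<omega> (E \<mu>))) \<and>
           real_analytic_on E {mu0 e a b \<omega><..} \<and>
           strict_mono_on {mu0 e a b \<omega><..} E \<and>
           strictly_convex_on {mu0 e a b \<omega><..} E))) \<and>
     \<comment> \<open>(b.i)\<close>
     (\<forall>\<mu>. (a < 0 \<and> b < 0 \<and> \<mu> > 0) \<or> (a * b < 0 \<and> \<mu> \<in> {0<..mu0 e a b ES}) \<longrightarrow>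
        eigenvalues_above e a b \<mu> ES = {}) \<and>
     \<comment> \<open>(b.ii)\<close>
     (a * b < 0 \<longrightarrow> (\<exists>E :: real \<Rightarrow> real.
        (\<forall>\<mu>>mu0 e a b ES.
           eigenvalues_above e a b \<mu> ES = {E \<mu>} \<and>
           has_multiplicity e a b \<mu> ES (E \<mu>) 1 \<and>
           (\<exists>C1 C2 :: real. eigenfunction e a b \<mu> ES (E \<mu>) (Psi_es e C1 C2 (E \<mu>)))) \<and>
        real_analytic_on E {mu0 e a b ES<..} \<and>
        strict_mono_on {mu0 e a b ES<..} E \<and>
        convex_on {mu0 e a b ES<..} E)) \<and>
     \<comment> \<open>(b.iii)\<close>
     (a > 0 \<and> b > 0 \<longrightarrow> (\<exists>E1 E2 :: real \<Rightarrow> real.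
        (\<forall>\<mu>\<in>{0<..mu0 e a b ES}.
           eigenvalues_above e a b \<mu> ES = {E1 \<mu>} \<and>
           has_multiplicity e a b \<mu> ES (E1 \<mu>) 1 \<and>
           (\<exists>C1 C2 :: real. eigenfunction e a b \<mu> ES (E1 \<mu>) (Psi_es e C1 C2 (E1 \<mu>)))) \<and>
        (\<forall>\<mu>>mu0 e a b ES.
           eigenvalues_above e a b \<mu> ES = {E1 \<mu>, E2 \<mu>} \<and>
           (\<forall>E\<in>{E1 \<mu>, E2 \<mu>}.
              has_multiplicity e a b \<mu> ES E (if E1 \<mu> = E2 \<mu> then 2 else 1)) \<and>
           (\<exists>C11 C21 C12 C22 :: real.
              eigenfunction e a b \<mu> ES (E1 \<mu>) (Psi_es e C11 C21 (E1 \<mu>)) \<and>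
              eigenfunction e a b \<mu> ES (E2 \<mu>) (Psi_es e C12 C22 (E2 \<mu>)) \<and>
              ae_lin_indep [Psi_es e C11 C21 (E1 \<mu>), Psi_es e C12 C22 (E2 \<mu>)])) \<and>
        real_analytic_on E1 {0<..} \<and> strict_mono_on {0<..} E1 \<and>
        real_analytic_on E2 {mu0 e a b ES<..} \<and> strict_mono_on {mu0 e a b ES<..} E2))"
proof -
  interpret threshold_dispersion e "e (pi, pi)"
    by (rule threshold_dispersion_if_nondegenerate_maximum[OF ehat_l1 e_fourier e_even e_symmetric
          e_unique_max e_nondegenerate])
  show ?thesis
  proof (intro conjI ballI)
    fix \<omega> assume "\<omega> \<in> {OS, OA, EA}"
    then have \<omega>: "\<omega> \<noteq> ES" by auto
    show "\<forall>\<mu>. (b < 0 \<and> \<mu> > 0) \<or> (b > 0 \<and> \<mu> \<in> {0<..mu0 e a b \<omega>}) \<longrightarrow>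
        eigenvalues_above e a b \<mu> \<omega> = {}"
      using rank_one_no_eigenvalues[OF \<omega>] by (intro allI impI)
  qed (intro allI impI rank_one_eigenvalue_branch ES_branch_opposite ES_branches_positive; auto;
      auto simp: no_eigenvalues_ES_negative no_eigenvalues_ES_opposite)+
qed

end
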